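(* Let $r\in\mathbb{N}$, $k\in\mathbb{Z}_+$ with $k\leqslant r-1$, and $t\in(-1,1)$. Then \[ \Gamma_t=\Gamma\left(D^k_t;L_2^r\right)=\left\{\left(\left\|u_{\lambda,t}^{(r)}\right\|_2,\left\|u_{\lambda,t}\right\|_2\right):\ \lambda\geqslant 0\right\}. \]
   Context: Let $\mathbb{I}=[-1,1]$, $L_2=L_2(\mathbb{I})$ (real-valued functions) with norm $\|f\|_2=\left(\int_{-1}^1|f(x)|^2\,dx\right)^{1/2}$. For $m\in\mathbb{N}$, $L_2^m$ is the space of functions $f:\mathbb{I}\to\mathbb{R}$ having absolutely continuous derivative $f^{(m-1)}$ and such that $f^{(m)}\in L_2$; $L_2^m((a,b))$ is the analogous space on an interval $(a,b)$. Let $W^r_2=\{f\in L_2^r:\|f^{(r)}\|_2\leqslant 1\}$. For $\lambda\geqslant 0$ and $t\in(-1,1)$ (with $r,k$ fixed), $u_{\lambda,t}$ denotes the unique function whose restrictions to $(-1,t)$ and $(t,1)$ belong to $L_2^{2r}((-1,t))$ and $L_2^{2r}((t,1))$ respectively and which satisfies \[ \begin{cases}(-1)^ru^{(2r)}(x)+\lambda u(x)=0,& x\in(-1,t)\cup(t,1),\\ u^{(s)}(-1)=u^{(s)}(1)=0,& s=0,1,\ldots,r-1,\\ u^{(s)}(t+0)-u^{(s)}(t-0)=(-1)^{k-1}\delta_{r-k-1,s},& s=0,1,\ldots,2r-1,\end{cases} \] where $\delta_{i,j}$ is the Kronecker symbol. The derivatives $u_{\lambda,t}^{(s)}$ are taken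 on $(-1,t)\cup(t,1)$; for $0\leqslant s\leqslant 2r-1$, $s\ne r-k-1$, they are extended to $\mathbb{I}$ by continuity. $\Gamma_t=\Gamma(D^k_t;L_2^r)$ is the set of all pairs $(A,B)$ of non-negative (finite) numbers such that the inequality $|f^{(k)}(t)|\leqslant A\|f\|_2+B\|f^{(r)}\|_2$ holds for every $f\in L_2^r$ and is sharp in the sense that $B$ is the smallest possible for the given $A$, i.e. \[ B=B_t(A)=\sup_{f\in W^r_2}\left(|f^{(k)}(t)|-A\|f\|_2\right)<\infty . \] *)

theory Defs
  imports "HOL-Analysis.Analysis"
begin

text \<open>The \<open>n\<close>-th derivative of \<open>f\<close> relative to \<open>S\<close>. Only the values of \<open>f\<close> on \<open>S\<close> enter at points of
  \<open>S\<close>; derivatives at endpoints belonging to \<open>S\<close> are one-sided. The value is unspecified where the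
  derivative does not exist, so existence is always required separately (or known almost
  everywhere).\<close>

definition nth_deriv :: "real set \<Rightarrow> nat \<Rightarrow> (real \<Rightarrow> real) \<Rightarrow> real \<Rightarrow> real" where
  "nth_deriv S n f = ((\<lambda>g x. vector_derivative g (at x within S)) ^^ n) f"

definition abs_continuous_on :: "real set \<Rightarrow> (real \<Rightarrow> real) \<Rightarrow> bool" where
  "abs_continuous_on S f \<longleftrightarrow>
     (\<forall>\<epsilon>>0. \<exists>\<delta>>0. \<forall>(n::nat) a b.
        (\<forall>i<n. a i \<le> b i \<and> {a i..b i} \<subseteq> S) \<and>
        disjoint_family_on (\<lambda>i. {a i<..<b i}) {..<n} \<and>
        (\<Sum>i<n. b i - a i) < \<delta>
        \<longrightarrow> (\<Sum>i<n. \<bar>f (b i) - f (a i)\<bar>) < \<epsilon>)"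

definition L2_fun :: "real set \<Rightarrow> (real \<Rightarrow> real) set" where
  "L2_fun S = {f. f \<in> borel_measurable (lebesgue_on S) \<and>
                  integrable (lebesgue_on S) (\<lambda>x. \<bar>f x\<bar>\<^sup>2)}"

definition L2_norm :: "real set \<Rightarrow> (real \<Rightarrow> real) \<Rightarrow> real" where
  "L2_norm S f = sqrt (LINT x|lebesgue_on S. \<bar>f x\<bar>\<^sup>2)"

text \<open>The space \<open>L\<^sub>2\<^sup>m(S)\<close> for an interval \<open>S\<close> and \<open>m \<ge> 1\<close>. The derivative of order \<open>m\<close> exists
  almost everywhere on \<open>S\<close> by absolute continuity.\<close>

definition L2_sobolev :: "real set \<Rightarrow> nat \<Rightarrow> (real \<Rightarrow> real) set" where
  "L2_sobolev S m = {f.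
     (\<forall>j<m - 1. \<forall>x\<in>S. nth_deriv S j f differentiable (at x within S)) \<and>
     abs_continuous_on S (nth_deriv S (m - 1) f) \<and>
     nth_deriv S m f \<in> L2_fun S}"

abbreviation II :: "real set" where "II \<equiv> {-1..1}"

definition W2 :: "nat \<Rightarrow> (real \<Rightarrow> real) set" where
  "W2 r = {f \<in> L2_sobolev II r. L2_norm II (nth_deriv II r f) \<le> 1}"

definition Gamma_set :: "nat \<Rightarrow> nat \<Rightarrow> real \<Rightarrow> (real \<times> real) set" where
  "Gamma_set r k t = {(A, B). 0 \<le> A \<and> 0 \<le> B \<and>
     (\<forall>f\<in>L2_sobolev II r.
        \<bar>nth_deriv II k f t\<bar> \<le> A * L2_norm II f + B * L2_norm II (nth_deriv II r f)) \<and>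
     bdd_above ((\<lambda>f. \<bar>nth_deriv II k f t\<bar> - A * L2_norm II f) ` W2 r) \<and>
     B = (SUP f\<in>W2 r. \<bar>nth_deriv II k f t\<bar> - A * L2_norm II f)}"

abbreviation punctured :: "real \<Rightarrow> real set" where
  "punctured t \<equiv> {-1<..<t} \<union> {t<..<1}"

text \<open>The boundary value problem. Boundary values of derivatives are the one-sided limits from
  inside the intervals; \<open>(-1)\<^bsup>k+1\<^esup>\<close> stands for \<open>(-1)\<^bsup>k-1\<^esup>\<close>, since \<open>k\<close> may be \<open>0\<close>.\<close>

definition bvp_solution :: "nat \<Rightarrow> nat \<Rightarrow> real \<Rightarrow> real \<Rightarrow> (real \<Rightarrow> real) \<Rightarrow> bool" where
  "bvp_solution r k l t u \<longleftrightarrow>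
     u \<in> L2_sobolev {-1<..<t} (2 * r) \<and> u \<in> L2_sobolev {t<..<1} (2 * r) \<and>
     (\<forall>x\<in>punctured t. nth_deriv (punctured t) (2 * r - 1) u differentiable (at x) \<and>
        (-1) ^ r * nth_deriv (punctured t) (2 * r) u x + l * u x = 0) \<and>
     (\<forall>s<r. (nth_deriv (punctured t) s u \<longlongrightarrow> 0) (at_right (-1)) \<and>
            (nth_deriv (punctured t) s u \<longlongrightarrow> 0) (at_left 1)) \<and>
     (\<forall>s<2 * r. \<exists>p q.
        (nth_deriv (punctured t) s u \<longlongrightarrow> p) (at_right t) \<and>
        (nth_deriv (punctured t) s u \<longlongrightarrow> q) (at_left t) \<and>
        p - q = (-1) ^ (k + 1) * (if s = r - k - 1 then 1 else 0))"

text \<open>The problem determines \<open>u\<close> only on \<open>(-1,t) \<union> (t,1)\<close>; it is extended by \<open>0\<close> to make it a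
  unique total function. The choice on this null set does not affect any norm over \<open>[-1,1]\<close>.\<close>

definition u_fun :: "nat \<Rightarrow> nat \<Rightarrow> real \<Rightarrow> real \<Rightarrow> real \<Rightarrow> real" where
  "u_fun r k l t = (THE u. bvp_solution r k l t u \<and> (\<forall>x. x \<notin> punctured t \<longrightarrow> u x = 0))"

end

theory Submission
  imports Defs "Jordan_Normal_Form.Determinant"
begin

text \<open>
  Integrating by parts over \<open>[-1,t]\<close> and \<open>[t,1]\<close> against \<open>u = u\<^bsub>\<lambda>,t\<^esub>\<close>, all boundary terms vanish except the
  prescribed jump, so \<open>f\<^bsup>(k)\<^esup>(t) = \<langle>f, u\<^bsup>(r)\<^esup>\<rangle> - (-1)\<^sup>r \<langle>f\<^bsup>(r)\<^esup>, u\<rangle>\<close> for all \<open>f \<in> L\<^sub>2\<^sup>r\<close>. By Cauchy-Schwarz the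
  inequality holds with \<open>A = \<parallel>u\<^bsup>(r)\<^esup>\<parallel>\<close> and \<open>B = \<parallel>u\<parallel>\<close>, and \<open>f = u\<^bsup>(r)\<^esup>\<close>, whose \<open>r\<close>-th derivative is a multiple of
  \<open>u\<close>, shows that it is sharp. Since \<open>u\<close> minimises \<open>\<parallel>v\<^bsup>(r)\<^esup>\<parallel>\<^sup>2 + \<lambda> \<parallel>v\<parallel>\<^sup>2\<close> among all functions with the same jumps
  below order \<open>r\<close> and the same boundary values, \<open>\<parallel>u\<^bsup>(r)\<^esup>\<parallel>\<close> is continuous and unbounded in \<open>\<lambda>\<close>. No smaller \<open>A\<close> than at
  \<open>\<lambda> = 0\<close> is possible, because there \<open>u\<^bsup>(r)\<^esup>\<close> is a polynomial of degree less than \<open>r\<close>; the intermediate value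
  theorem gives all other \<open>A\<close>.
  Existence of \<open>u\<close> follows from uniqueness by linear algebra on the initial values at \<open>t\<close>.
\<close>

section \<open>Absolutely continuous functions\<close>

text \<open>Membership in the Sobolev space gives only the epsilon-delta form of absolute continuity
  of f^(r-1). Integration by parts therefore rests on Lebesgue's theorem for such functions:
  differentiability almost everywhere, and recovery of increments by integrating the derivative. The
  representation of f^(k)(t) does not use the differential equation. It holds for every pair of
  smooth branches on the two sides of t with the right jumps at orders below r and the right zeros
  at the ends, so competitors may take the place of u. The equation enters through u^(r): among the
  orders below 2r the only jump of u is at r-k-1 < r, so u^(r) lies in the space of test functions
  although u does not, and its own r-th derivative is proportional to u. As the equation has
  constant coefficients, each branch of u continues to a solution on the whole line. One-sided
  limits at -1, t and 1 thus become plain values, and uniqueness reduces to one global solution with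
  zeros at -1 and 1.\<close>

lemma abs_continuous_on_division:
  assumes ac: "abs_continuous_on S g" and e: "0 < \<epsilon>"
  obtains \<delta> where "0 < \<delta>"
    "\<And>D T. D division_of T \<Longrightarrow> T \<subseteq> S \<Longrightarrow> measure lebesgue T < \<delta> \<Longrightarrow>
       (\<Sum>K\<in>D. \<bar>g (Sup K) - g (Inf K)\<bar>) < \<epsilon>"
proof -
  obtain \<delta> where \<delta>: "0 < \<delta>" "\<And>(n::nat) a b. (\<forall>i<n. a i \<le> b i \<and> {a i..b i} \<subseteq> S) \<Longrightarrow>
        disjoint_family_on (\<lambda>i. {a i<..<b i}) {..<n} \<Longrightarrow>
        (\<Sum>i<n. b i - a i) < \<delta> \<Longrightarrow> (\<Sum>i<n. \<bar>g (b i) - g (a i)\<bar>) < \<epsilon>"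
    using ac e unfolding abs_continuous_on_def by meson
  have "(\<Sum>K\<in>D. \<bar>g (Sup K) - g (Inf K)\<bar>) < \<epsilon>"
    if D: "D division_of T" and T: "T \<subseteq> S" "measure lebesgue T < \<delta>" for D T
  proof -
    have fin: "finite D" using D by blast
    obtain h where h: "bij_betw h {..<card D} D"
      using ex_bij_betw_nat_finite[OF fin] atLeast0LessThan by metis
    have K: "K = {Inf K..Sup K} \<and> Inf K \<le> Sup K \<and> K \<subseteq> T \<and> interior K = {Inf K<..<Sup K}"
      if KD: "K \<in> D" for K
    proof -
      obtain c d where cd: "K = {c..d}" using division_ofD(4)[OF D KD] box_real(2) by metis
      moreover have "c \<le> d" using cd division_ofD(3)[OF D KD] by auto
      ultimately show ?thesis using division_ofD(2)[OF D KD] by simp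
    qed
    have hD: "h i \<in> D" if "i < card D" for i using bij_betwE[OF h] that by blast
    have "(\<Sum>i<card D. \<bar>g (Sup (h i)) - g (Inf (h i))\<bar>) < \<epsilon>"
    proof (rule \<delta>(2))
      show "\<forall>i<card D. Inf (h i) \<le> Sup (h i) \<and> {Inf (h i)..Sup (h i)} \<subseteq> S"
        using K[OF hD] T by blast
      show "disjoint_family_on (\<lambda>i. {Inf (h i)<..<Sup (h i)}) {..<card D}"
        unfolding disjoint_family_on_def
      proof (intro ballI impI)
        fix i j assume ij: "i \<in> {..<card D}" "j \<in> {..<card D}" "i \<noteq> j"
        then have "h i \<noteq> h j" using h unfolding bij_betw_def inj_on_def by blast
        then have "interior (h i) \<inter> interior (h j) = {}"
          using division_ofD(5)[OF D] hD ij by auto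
        then show "{Inf (h i)<..<Sup (h i)} \<inter> {Inf (h j)<..<Sup (h j)} = {}"
          using K[OF hD] ij by auto
      qed
      have "(\<Sum>i<card D. Sup (h i) - Inf (h i)) = (\<Sum>K\<in>D. Sup K - Inf K)"
        by (rule sum.reindex_bij_betw[OF h])
      also have "\<dots> = (\<Sum>K\<in>D. measure lebesgue K)"
      proof (rule sum.cong)
        fix x assume "x \<in> D"
        then have x: "x = {Inf x..Sup x}" "Inf x \<le> Sup x" using K by auto
        have "measure lebesgue {Inf x..Sup x} = Sup x - Inf x" using x(2) by simp
        then show "Sup x - Inf x = measure lebesgue x" using x(1) by metis
      qed simp
      also have "\<dots> = measure lebesgue T" using content_division[OF D] .
      finally show "(\<Sum>i<card D. Sup (h i) - Inf (h i)) < \<delta>" using T by simp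
    qed
    also have "(\<Sum>i<card D. \<bar>g (Sup (h i)) - g (Inf (h i))\<bar>) = (\<Sum>K\<in>D. \<bar>g (Sup K) - g (Inf K)\<bar>)"
      by (rule sum.reindex_bij_betw[OF h])
    finally show ?thesis .
  qed
  then show ?thesis using that \<delta>(1) by blast
qed

lemma abs_continuous_on_imp_continuous_on:
  assumes ac: "abs_continuous_on {a..b} g"
  shows "continuous_on {a..b} g"
  unfolding continuous_on_iff
proof (intro ballI allI impI)
  fix x and \<epsilon> :: real assume x: "x \<in> {a..b}" and e: "0 < \<epsilon>"
  obtain \<delta> where \<delta>: "0 < \<delta>" "\<And>(n::nat) p q. (\<forall>i<n. p i \<le> q i \<and> {p i..q i} \<subseteq> {a..b}) \<Longrightarrow>
        disjoint_family_on (\<lambda>i. {p i<..<q i}) {..<n} \<Longrightarrow>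
        (\<Sum>i<n. q i - p i) < \<delta> \<Longrightarrow> (\<Sum>i<n. \<bar>g (q i) - g (p i)\<bar>) < \<epsilon>"
    using ac e unfolding abs_continuous_on_def by meson
  have "dist (g y) (g x) < \<epsilon>" if y: "y \<in> {a..b}" "dist y x < \<delta>" for y
  proof -
    have "disjoint_family_on (\<lambda>_. {min x y<..<max x y}) {..<1::nat}"
      unfolding disjoint_family_on_def by simp
    moreover have "{min x y..max x y} \<subseteq> {a..b}" using x y(1) by auto
    moreover have "max x y - min x y < \<delta>" using y(2) unfolding dist_real_def by linarith
    ultimately have "\<bar>g (max x y) - g (min x y)\<bar> < \<epsilon>"
      using \<delta>(2)[of 1 "\<lambda>_. min x y" "\<lambda>_. max x y"] by simp
    then show ?thesis unfolding dist_real_def by (cases "x \<le> y") (simp_all add: abs_minus_commute)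
  qed
  then show "\<exists>d>0. \<forall>x'\<in>{a..b}. dist x' x < d \<longrightarrow> dist (g x') (g x) < \<epsilon>"
    using \<delta>(1) by blast
qed

lemma abs_continuous_on_subset:
  "abs_continuous_on S g \<Longrightarrow> T \<subseteq> S \<Longrightarrow> abs_continuous_on T g"
  unfolding abs_continuous_on_def by (meson order_trans)

lemma abs_continuous_on_lipschitz:
  assumes "\<And>x y. x \<in> S \<Longrightarrow> y \<in> S \<Longrightarrow> \<bar>g x - g y\<bar> \<le> C * \<bar>x - y\<bar>"
  shows "abs_continuous_on S g"
  unfolding abs_continuous_on_def
proof (intro allI impI)
  fix \<epsilon> :: real assume e: "0 < \<epsilon>"
  have "(\<Sum>i<n. \<bar>g (q i) - g (p i)\<bar>) < \<epsilon>"
    if "\<forall>i<n. p i \<le> q i \<and> {p i..q i} \<subseteq> S" "(\<Sum>i<n. q i - p i) < \<epsilon> / (\<bar>C\<bar> + 1)" for n :: nat and p q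
  proof -
    have "(\<Sum>i<n. \<bar>g (q i) - g (p i)\<bar>) \<le> (\<Sum>i<n. (\<bar>C\<bar> + 1) * (q i - p i))"
    proof (rule sum_mono)
      fix i assume "i \<in> {..<n}"
      then have "p i \<le> q i" "{p i..q i} \<subseteq> S" using that(1) by blast+
      then have i: "p i \<le> q i" "p i \<in> S" "q i \<in> S" by auto
      have "\<bar>g (q i) - g (p i)\<bar> \<le> C * (q i - p i)" using assms[OF i(3) i(2)] i(1) by simp
      also have "\<dots> \<le> (\<bar>C\<bar> + 1) * (q i - p i)" using i(1) by (intro mult_right_mono) auto
      finally show "\<bar>g (q i) - g (p i)\<bar> \<le> (\<bar>C\<bar> + 1) * (q i - p i)" .
    qed
    also have "\<dots> = (\<bar>C\<bar> + 1) * (\<Sum>i<n. q i - p i)" by (simp add: sum_distrib_left)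
    also have "\<dots> < \<epsilon>" using that(2) by (simp add: field_simps)
    finally show ?thesis .
  qed
  moreover have "0 < \<epsilon> / (\<bar>C\<bar> + 1)" using e by simp
  ultimately show "\<exists>\<delta>>0. \<forall>(n::nat) p q. (\<forall>i<n. p i \<le> q i \<and> {p i..q i} \<subseteq> S) \<and>
    disjoint_family_on (\<lambda>i. {p i<..<q i}) {..<n} \<and> (\<Sum>i<n. q i - p i) < \<delta> \<longrightarrow>
    (\<Sum>i<n. \<bar>g (q i) - g (p i)\<bar>) < \<epsilon>" by blast
qed

text \<open>Increments of \<open>h\<close> are dominated by those of \<open>f\<close> and
  \<open>g\<close>, so one choice of lengths serves both. This single estimate yields closure under
  differences, products and sums, and invariance under changing a function off \<open>S\<close>.
  Replacing \<open>C\<close> by |C| + 1 keeps the factor positive whatever the sign of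
  \<open>C\<close>.\<close>

lemma abs_continuous_on_combine:
  assumes f: "abs_continuous_on S f" and g: "abs_continuous_on S g"
    and h: "\<And>x y. x \<in> S \<Longrightarrow> y \<in> S \<Longrightarrow> \<bar>h x - h y\<bar> \<le> C * \<bar>f x - f y\<bar> + C * \<bar>g x - g y\<bar>"
  shows "abs_continuous_on S h"
  unfolding abs_continuous_on_def
proof (intro allI impI)
  fix \<epsilon> :: real assume e: "0 < \<epsilon>"
  define e' where "e' = \<epsilon> / (2 * (\<bar>C\<bar> + 1))"
  have e': "0 < e'" using e by (simp add: e'_def)
  obtain \<delta>1 where \<delta>1: "0 < \<delta>1" "\<And>(n::nat) p q. (\<forall>i<n. p i \<le> q i \<and> {p i..q i} \<subseteq> S) \<Longrightarrow>
        disjoint_family_on (\<lambda>i. {p i<..<q i}) {..<n} \<Longrightarrow>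
        (\<Sum>i<n. q i - p i) < \<delta>1 \<Longrightarrow> (\<Sum>i<n. \<bar>f (q i) - f (p i)\<bar>) < e'"
    using f e' unfolding abs_continuous_on_def by meson
  obtain \<delta>2 where \<delta>2: "0 < \<delta>2" "\<And>(n::nat) p q. (\<forall>i<n. p i \<le> q i \<and> {p i..q i} \<subseteq> S) \<Longrightarrow>
        disjoint_family_on (\<lambda>i. {p i<..<q i}) {..<n} \<Longrightarrow>
        (\<Sum>i<n. q i - p i) < \<delta>2 \<Longrightarrow> (\<Sum>i<n. \<bar>g (q i) - g (p i)\<bar>) < e'"
    using g e' unfolding abs_continuous_on_def by meson
  have "(\<Sum>i<n. \<bar>h (q i) - h (p i)\<bar>) < \<epsilon>"
    if *: "\<forall>i<n. p i \<le> q i \<and> {p i..q i} \<subseteq> S" "disjoint_family_on (\<lambda>i. {p i<..<q i}) {..<n}"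
      "(\<Sum>i<n. q i - p i) < min \<delta>1 \<delta>2" for n :: nat and p q
  proof -
    have "(\<Sum>i<n. \<bar>h (q i) - h (p i)\<bar>)
        \<le> (\<Sum>i<n. (\<bar>C\<bar> + 1) * (\<bar>f (q i) - f (p i)\<bar> + \<bar>g (q i) - g (p i)\<bar>))"
    proof (rule sum_mono)
      fix i assume "i \<in> {..<n}"
      then have "p i \<le> q i" "{p i..q i} \<subseteq> S" using *(1) by blast+
      then have i: "p i \<in> S" "q i \<in> S" by auto
      have "\<bar>h (q i) - h (p i)\<bar> \<le> C * (\<bar>f (q i) - f (p i)\<bar> + \<bar>g (q i) - g (p i)\<bar>)"
        using h[OF i(2) i(1)] by (simp add: distrib_left)
      also have "\<dots> \<le> (\<bar>C\<bar> + 1) * (\<bar>f (q i) - f (p i)\<bar> + \<bar>g (q i) - g (p i)\<bar>)"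
        by (intro mult_right_mono) auto
      finally show "\<bar>h (q i) - h (p i)\<bar> \<le> (\<bar>C\<bar> + 1) * (\<bar>f (q i) - f (p i)\<bar> + \<bar>g (q i) - g (p i)\<bar>)" .
    qed
    also have "\<dots> = (\<bar>C\<bar> + 1) * ((\<Sum>i<n. \<bar>f (q i) - f (p i)\<bar>) + (\<Sum>i<n. \<bar>g (q i) - g (p i)\<bar>))"
      by (simp only: sum_distrib_left[symmetric] sum.distrib)
    also have "\<dots> < (\<bar>C\<bar> + 1) * (e' + e')"
      using \<delta>1(2)[OF *(1,2)] \<delta>2(2)[OF *(1,2)] *(3) by (intro mult_strict_left_mono add_strict_mono) auto
    also have "\<dots> = \<epsilon>" unfolding e'_def by (simp add: divide_simps)
    finally show ?thesis .
  qed
  moreover have "0 < min \<delta>1 \<delta>2" using \<delta>1 \<delta>2 by simp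
  ultimately show "\<exists>\<delta>>0. \<forall>(n::nat) p q. (\<forall>i<n. p i \<le> q i \<and> {p i..q i} \<subseteq> S) \<and>
    disjoint_family_on (\<lambda>i. {p i<..<q i}) {..<n} \<and> (\<Sum>i<n. q i - p i) < \<delta> \<longrightarrow>
    (\<Sum>i<n. \<bar>h (q i) - h (p i)\<bar>) < \<epsilon>" by blast
qed

lemma abs_continuous_on_diff:
  "abs_continuous_on S f \<Longrightarrow> abs_continuous_on S g \<Longrightarrow> abs_continuous_on S (\<lambda>x. f x - g x)"
  by (rule abs_continuous_on_combine[where C=1 and f=f and g=g]) auto

lemma abs_continuous_on_mult:
  assumes f: "abs_continuous_on {a..b} f" and g: "abs_continuous_on {a..b} g"
  shows "abs_continuous_on {a..b} (\<lambda>x. f x * g x)"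
proof -
  have "bounded (f ` {a..b})" "bounded (g ` {a..b})"
    using f g by (auto intro!: compact_imp_bounded compact_continuous_image abs_continuous_on_imp_continuous_on)
  then obtain A B where A: "\<And>x. x \<in> {a..b} \<Longrightarrow> \<bar>f x\<bar> \<le> A" and B: "\<And>x. x \<in> {a..b} \<Longrightarrow> \<bar>g x\<bar> \<le> B"
    unfolding bounded_real by blast
  show ?thesis
  proof (rule abs_continuous_on_combine[OF f g, where C="max A B"])
    fix x y assume xy: "x \<in> {a..b}" "y \<in> {a..b}"
    have "f x * g x - f y * g y = g x * (f x - f y) + f y * (g x - g y)" by (simp add: algebra_simps)
    then have "\<bar>f x * g x - f y * g y\<bar> \<le> \<bar>g x\<bar> * \<bar>f x - f y\<bar> + \<bar>f y\<bar> * \<bar>g x - g y\<bar>"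
      by (metis abs_mult abs_triangle_ineq)
    also have "\<dots> \<le> max A B * \<bar>f x - f y\<bar> + max A B * \<bar>g x - g y\<bar>"
      using A[OF xy(2)] B[OF xy(1)] by (intro add_mono mult_right_mono) auto
    finally show "\<bar>f x * g x - f y * g y\<bar> \<le> max A B * \<bar>f x - f y\<bar> + max A B * \<bar>g x - g y\<bar>" .
  qed
qed

section \<open>Difference quotients and differentiability almost everywhere\<close>

text \<open>Encodes failure of an eventual bound: a point of (a,b) belongs to the set for
  \<open>{..<p}\<close> exactly when p is not an eventual lower bound of the difference quotients
  there, and likewise for \<open>{q<..}\<close> and upper bounds. Dini derivates with their infinite
  values are thereby avoided.\<close>

definition dq_cluster :: "real \<Rightarrow> real \<Rightarrow> (real \<Rightarrow> real) \<Rightarrow> real set \<Rightarrow> real set" where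
  "dq_cluster a b g Q = {x\<in>{a<..<b}. \<forall>d>0. \<exists>y\<in>{a<..<b}. y \<noteq> x \<and> \<bar>y - x\<bar> < d \<and> (g y - g x) / (y - x) \<in> Q}"

text \<open>The distances d may be restricted to 1/(n+1), giving a countable intersection. The union
  over the uncountably many y is harmless because for fixed y the admissible x form an open
  set.\<close>

lemma dq_cluster_measurable:
  assumes g: "continuous_on {a<..<b} g" and Q: "open Q"
  shows "dq_cluster a b g Q \<in> lmeasurable"
proof -
  define X where "X d y = {x\<in>{a<..<b} - {y}. \<bar>y - x\<bar> < d \<and> (g y - g x) / (y - x) \<in> Q}" for d y
  have op: "open (X d y)" for d y
  proof -
    have 1: "open ({a<..<b} - {y})" by auto
    have 2: "continuous_on ({a<..<b} - {y}) (\<lambda>x. (g y - g x) / (y - x))"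
      by (intro continuous_intros continuous_on_subset[OF g]) auto
    have "open ((({a<..<b} - {y}) \<inter> (\<lambda>x. (g y - g x) / (y - x)) -` Q) \<inter> ball y d)"
      by (rule open_Int[OF continuous_open_preimage[OF 2 1 Q] open_ball])
    also have "(({a<..<b} - {y}) \<inter> (\<lambda>x. (g y - g x) / (y - x)) -` Q) \<inter> ball y d = X d y"
      by (auto simp: X_def dist_real_def)
    finally show ?thesis .
  qed
  have "dq_cluster a b g Q = (\<Inter>n::nat. \<Union>y\<in>{a<..<b}. X (1 / Suc n) y)"
  proof (intro Set.set_eqI iffI)
    fix x assume x: "x \<in> dq_cluster a b g Q"
    show "x \<in> (\<Inter>n::nat. \<Union>y\<in>{a<..<b}. X (1 / Suc n) y)"
    proof
      fix n :: nat
      have "(0::real) < 1 / Suc n" by simp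
      then obtain y where "y\<in>{a<..<b}" "y \<noteq> x" "\<bar>y - x\<bar> < 1 / Suc n" "(g y - g x) / (y - x) \<in> Q"
        using x unfolding dq_cluster_def by blast
      then show "x \<in> (\<Union>y\<in>{a<..<b}. X (1 / Suc n) y)" using x unfolding X_def dq_cluster_def by auto
    qed
  next
    fix x assume x: "x \<in> (\<Inter>n::nat. \<Union>y\<in>{a<..<b}. X (1 / Suc n) y)"
    then have "x \<in> {a<..<b}" unfolding X_def by blast
    moreover have "\<exists>y\<in>{a<..<b}. y \<noteq> x \<and> \<bar>y - x\<bar> < d \<and> (g y - g x) / (y - x) \<in> Q" if "d > 0" for d
    proof -
      obtain n :: nat where n: "1 / Suc n < d" using \<open>d > 0\<close> nat_approx_posE by blast
      from x obtain y where "y \<in> {a<..<b}" "x \<in> X (1 / Suc n) y" by blast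
      then show ?thesis using n unfolding X_def by (intro bexI[of _ y]) auto
    qed
    ultimately show "x \<in> dq_cluster a b g Q" unfolding dq_cluster_def by blast
  qed
  also have "\<dots> \<in> sets borel" using op by (intro sets.countable_INT'') (auto intro!: borel_open open_UN)
  finally have "dq_cluster a b g Q \<in> sets lebesgue" by simp
  moreover have "dq_cluster a b g Q \<subseteq> {a..b}" unfolding dq_cluster_def by auto
  ultimately show ?thesis by (rule_tac lmeasurable_cbox[THEN fmeasurableI2, of _ a b]) auto
qed

text \<open>The intervals between x and nearby y with quotient in \<open>Q\<close>, short enough to
  lie in one member of \<U>, cover \<open>E\<close> in the sense of Vitali. Countably many disjoint
  ones exhaust \<open>E\<close> up to a null set, and by continuity of measure from above finitely
  many leave less than \<epsilon>.\<close>

lemma dq_cluster_finite_cover: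
  assumes E: "E \<subseteq> dq_cluster a b g Q" "E \<in> lmeasurable" and e: "0 < \<epsilon>"
    and op: "\<And>U. U \<in> \<U> \<Longrightarrow> open U" and cov: "E \<subseteq> \<Union>\<U>"
  obtains D where "finite D" "disjoint D" "measure lebesgue (E - \<Union>D) < \<epsilon>"
    "\<And>K. K \<in> D \<Longrightarrow> \<exists>U\<in>\<U>. K \<subseteq> U"
    "\<And>K. K \<in> D \<Longrightarrow> \<exists>u v. a < u \<and> u < v \<and> v < b \<and> K = {u..v} \<and> (g v - g u) / (v - u) \<in> Q"
proof -
  define P where "P = {(u,v). a < u \<and> u < v \<and> v < b \<and> (\<exists>U\<in>\<U>. {u..v} \<subseteq> U) \<and> (g v - g u) / (v - u) \<in> Q}"
  define c where "c = (\<lambda>(u,v). (u + v) / 2 :: real)"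
  define \<rho> where "\<rho> = (\<lambda>(u,v). (v - u) / 2 :: real)"
  have cb: "cball (c i) (\<rho> i) = {fst i..snd i}" for i
    by (cases i) (auto simp: c_def \<rho>_def cball_def dist_real_def abs_if field_simps split: if_splits)
  obtain C where C: "countable C" "C \<subseteq> P"
    "pairwise (\<lambda>i j. disjnt (cball (c i) (\<rho> i)) (cball (c j) (\<rho> j))) C"
    "negligible (E - (\<Union>i\<in>C. cball (c i) (\<rho> i)))"
  proof (rule Vitali_covering_theorem_cballs[of P \<rho> E c])
    show "0 < \<rho> i" if "i \<in> P" for i using that by (auto simp: P_def \<rho>_def)
  next
    fix x and d :: real assume x: "x \<in> E" "0 < d"
    then obtain U where U: "U \<in> \<U>" "x \<in> U" using cov by blast
    obtain d' where d': "d' > 0" "ball x d' \<subseteq> U" using op[OF U(1)] U(2) openE by blast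
    have "0 < min d d'" using x d' by auto
    then obtain y where y: "y\<in>{a<..<b}" "y \<noteq> x" "\<bar>y - x\<bar> < min d d'" "(g y - g x) / (y - x) \<in> Q"
      using x E unfolding dq_cluster_def by blast
    have xab: "x \<in> {a<..<b}" using x E unfolding dq_cluster_def by blast
    let ?i = "(min x y, max x y)"
    \<comment> \<open>The quotient is symmetric in its two points, so the interval qualifies whether
      x is its left or its right end.\<close>
    have sw: "(g x - g y) / (x - y) = (g y - g x) / (y - x)"
      by (metis minus_diff_eq minus_divide_divide)
    have "{min x y..max x y} \<subseteq> ball x d'" using y by (auto simp: dist_real_def)
    then have "?i \<in> P" unfolding P_def using y xab d' U sw
      by (auto simp: min_def max_def intro!: bexI[of _ U])
    moreover have "x \<in> cball (c ?i) (\<rho> ?i)" unfolding cb by simp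
    moreover have "\<rho> ?i < d" using y x by (auto simp: \<rho>_def min_def max_def split: if_splits)
    ultimately show "\<exists>i. i \<in> P \<and> x \<in> cball (c i) (\<rho> i) \<and> \<rho> i < d" by blast
  qed blast
  define J where "J i = {fst i..snd i}" for i :: "real \<times> real"
  have neg: "negligible (E - (\<Union>i\<in>C. J i))" using C(4) unfolding cb J_def .
  have "\<exists>F. finite F \<and> F \<subseteq> C \<and> measure lebesgue (E - (\<Union>i\<in>F. J i)) < \<epsilon>"
  proof (cases "finite C")
    case True
    then show ?thesis using neg e by (intro exI[of _ C]) (auto simp: negligible_imp_measure0)
  next
    case False
    define e where "e = from_nat_into C"
    have re: "range e = C" unfolding e_def using C(1) False by (intro range_from_nat_into) auto
    define A where "A n = E - (\<Union>i<n. J (e i))" for n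
    have Am: "A n \<in> lmeasurable" for n unfolding A_def J_def using E(2) by (intro fmeasurable.Diff) auto
    have A: "emeasure lebesgue (A n) \<noteq> \<infinity>" "A n \<in> sets lebesgue" for n
      using fmeasurableD2[OF Am] fmeasurableD[OF Am] by simp_all
    have "(\<lambda>n. measure lebesgue (A n)) \<longlonglongrightarrow> measure lebesgue (\<Inter>n. A n)"
      using A by (intro Lim_measure_decseq) (auto simp: A_def decseq_def)
    moreover have "(\<Inter>n. A n) = E - (\<Union>i\<in>C. J i)"
      unfolding A_def re[symmetric] by (auto intro: lessI)
    ultimately have "(\<lambda>n. measure lebesgue (A n)) \<longlonglongrightarrow> 0"
      using neg by (simp add: negligible_imp_measure0)
    then have "eventually (\<lambda>n. measure lebesgue (A n) < \<epsilon>) sequentially"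
      using \<open>0 < \<epsilon>\<close> by (rule order_tendstoD)
    then obtain n where "measure lebesgue (A n) < \<epsilon>" by (auto simp: eventually_sequentially)
    then show ?thesis using re by (intro exI[of _ "e ` {..<n}"]) (auto simp: A_def)
  qed
  then obtain F where F: "finite F" "F \<subseteq> C" "measure lebesgue (E - (\<Union>i\<in>F. J i)) < \<epsilon>" by blast
  show ?thesis
  proof (rule that[of "J ` F"])
    show "finite (J ` F)" using F by simp
    show "disjoint (J ` F)"
    proof (rule disjointI)
      fix K L assume "K \<in> J ` F" "L \<in> J ` F" "K \<noteq> L"
      then obtain i j where "i \<in> C" "j \<in> C" "i \<noteq> j" "K = J i" "L = J j" using F by blast
      then show "K \<inter> L = {}" using C(3) unfolding pairwise_def cb J_def disjnt_def by blast
    qed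
    show "measure lebesgue (E - \<Union> (J ` F)) < \<epsilon>" using F by simp
    show "\<exists>U\<in>\<U>. K \<subseteq> U" if K: "K \<in> J ` F" for K
    proof -
      obtain i where "i \<in> P" "K = J i" using K F C(2) by blast
      moreover obtain u v where "i = (u, v)" by (cases i)
      ultimately show ?thesis by (simp add: P_def J_def)
    qed
    show "\<exists>u v. a < u \<and> u < v \<and> v < b \<and> K = {u..v} \<and> (g v - g u) / (v - u) \<in> Q" if K: "K \<in> J ` F" for K
    proof -
      obtain i where "i \<in> P" "K = J i" using K F C(2) by blast
      then show ?thesis unfolding P_def J_def by auto
    qed
  qed
qed

text \<open>Tagging every piece with its left end turns the division into a tagged one, for which
  additivity of increments applies.\<close>

lemma division_telescope:
  fixes g :: "real \<Rightarrow> real"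
  assumes "D division_of {c..d}" "c \<le> d"
  shows "(\<Sum>K\<in>D. g (Sup K) - g (Inf K)) = g d - g c"
proof -
  let ?h = "\<lambda>K::real set. (Inf K, K)"
  have K: "K \<noteq> {} \<and> (\<exists>u v. K = {u..v}) \<and> Inf K \<in> K" if KD: "K \<in> D" for K
  proof -
    obtain u v where uv: "K = {u..v}" using division_ofD(4)[OF assms(1) KD] box_real(2) by metis
    moreover have "u \<le> v" using uv division_ofD(3)[OF assms(1) KD] by auto
    ultimately show ?thesis by auto
  qed
  have "(?h ` D) tagged_division_of {c..d}"
    using assms(1) K unfolding tagged_division_of division_of_def
    by (auto simp: image_iff) (metis disjoint_iff)+
  from additive_tagged_division_1[OF assms(2) this, of g]
  have "(\<Sum>(x, K)\<in>?h ` D. g (Sup K) - g (Inf K)) = g d - g c" by simp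
  then show ?thesis by (subst (asm) sum.reindex) (auto simp: inj_on_def)
qed

lemma disjoint_intervals_division:
  assumes "finite F" "disjoint F" "\<And>K. K \<in> F \<Longrightarrow> K = {Inf K..Sup K :: real} \<and> Inf K < Sup K"
  shows "F division_of \<Union>F"
proof (rule division_ofI)
  fix K assume K: "K \<in> F"
  have "K = {Inf K..Sup K}" "Inf K < Sup K" using assms(3)[OF K] by auto
  then show "K \<noteq> {}" by (metis atLeastatMost_empty_iff2 less_imp_le)
  show "\<exists>a b. K = cbox a b" using \<open>K = {Inf K..Sup K}\<close> by (metis box_real(2))
  show "interior K \<inter> interior L = {}" if "L \<in> F" "K \<noteq> L" for L
    using assms(2) K that interior_subset unfolding disjoint_def by blast
qed (use assms(1) in auto)

text \<open>Vitali twice: cover almost all of the set by disjoint intervals \<open>I\<close> with negative increments, and then, inside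
  them, by disjoint intervals \<open>J\<close> with increments exceeding \<open>m |J|\<close>. What the \<open>J\<close> leave uncovered of the \<open>I\<close> has small
  measure, so by absolute continuity its increments cannot compensate the difference.\<close>

lemma dq_cluster_crossing_negligible_0:
  assumes ac: "abs_continuous_on {a..b} g" and m: "0 < m"
  shows "negligible (dq_cluster a b g {..<0} \<inter> dq_cluster a b g {m<..})" (is "negligible ?E")
proof -
  have cont: "continuous_on {a<..<b} g"
    using abs_continuous_on_imp_continuous_on[OF ac] by (rule continuous_on_subset) auto
  have Em: "?E \<in> lmeasurable"
    using dq_cluster_measurable[OF cont] by (intro fmeasurable.Int) auto
  define e where "e = measure lebesgue ?E"
  have "e = 0"
  proof (rule ccontr)
    assume "e \<noteq> 0"
    then have e: "e > 0" by (simp add: e_def zero_less_measure_iff)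
    then have "0 < m * e / 2" using m by simp
    from abs_continuous_on_division[OF ac this]
    obtain \<delta> where \<delta>: "0 < \<delta>" "\<And>D T. D division_of T \<Longrightarrow> T \<subseteq> {a..b} \<Longrightarrow> measure lebesgue T < \<delta> \<Longrightarrow>
       (\<Sum>K\<in>D. \<bar>g (Sup K) - g (Inf K)\<bar>) < m * e / 2" by blast
    \<comment> \<open>The balance at the end is: the uncovered pieces have total length below (e +
      \<epsilon>) - (e - 2\<epsilon>) = 3\<epsilon>, which must stay below \<delta>, and the inner
      intervals cover more than e - 2\<epsilon>, which must exceed e/2.\<close>
    define \<epsilon> where "\<epsilon> = min (\<delta> / 4) (e / 8)"
    have \<epsilon>: "0 < \<epsilon>" "3 * \<epsilon> < \<delta>" "2 * \<epsilon> < e / 2" using \<delta> e by (auto simp: \<epsilon>_def min_def)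
    obtain T where T: "open T" "?E \<subseteq> T" "T - ?E \<in> lmeasurable" "emeasure lebesgue (T - ?E) < ennreal \<epsilon>"
      using sets_lebesgue_outer_open[OF fmeasurableD[OF Em] \<epsilon>(1)] by blast
    have Ttot: "T = ?E \<union> (T - ?E)" using T(2) by blast
    have Tm: "T \<in> lmeasurable" using fmeasurable.Un[OF Em T(3)] Ttot by simp
    have "measure lebesgue (T - ?E) < \<epsilon>"
      using T(4) emeasure_eq_measure2[OF T(3)] \<epsilon>(1) by (simp add: ennreal_less_iff)
    moreover have "measure lebesgue T \<le> measure lebesgue ?E + measure lebesgue (T - ?E)"
      using measure_Un_le[OF fmeasurableD[OF Em] fmeasurableD[OF T(3)]] Ttot by simp
    ultimately have Tmeas: "measure lebesgue T < e + \<epsilon>" unfolding e_def by simp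
    obtain F where F: "finite F" "disjoint F" "measure lebesgue (?E - \<Union>F) < \<epsilon>"
      "\<And>K. K \<in> F \<Longrightarrow> \<exists>U\<in>{T}. K \<subseteq> U"
      "\<And>K. K \<in> F \<Longrightarrow> \<exists>u v. a < u \<and> u < v \<and> v < b \<and> K = {u..v} \<and> (g v - g u) / (v - u) \<in> {..<0}"
      using dq_cluster_finite_cover[OF _ Em \<epsilon>(1), of a b g "{..<0}" "{T}"] T(1,2) by auto
    \<comment> \<open>Passing to interiors supplies the open sets that the second covering must
      respect. It loses only the finitely many end points, collected in \<open>N\<close>
      below.\<close>
    define E' where "E' = ?E \<inter> \<Union>(interior ` F)"
    have "\<Union>(interior ` F) \<in> sets borel" by (intro borel_open) auto
    then have E'm: "E' \<in> lmeasurable"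
      unfolding E'_def by (intro fmeasurable_Int_fmeasurable[OF Em]) simp
    obtain G where G: "finite G" "disjoint G" "measure lebesgue (E' - \<Union>G) < \<epsilon>"
      "\<And>K. K \<in> G \<Longrightarrow> \<exists>U\<in>interior ` F. K \<subseteq> U"
      "\<And>K. K \<in> G \<Longrightarrow> \<exists>u v. a < u \<and> u < v \<and> v < b \<and> K = {u..v} \<and> (g v - g u) / (v - u) \<in> {m<..}"
    proof (rule dq_cluster_finite_cover[OF _ E'm \<epsilon>(1), of a b g "{m<..}" "interior ` F"])
      show "E' \<subseteq> dq_cluster a b g {m<..}" "E' \<subseteq> \<Union>(interior ` F)" unfolding E'_def by blast+
    qed auto
    have Fprop: "K \<subseteq> {a..b} \<and> K = {Inf K..Sup K} \<and> Inf K < Sup K \<and> g (Sup K) - g (Inf K) < 0" if "K \<in> F" for K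
      using F(5)[OF that] by (auto simp: divide_less_0_iff)
    have Gprop: "K = {Inf K..Sup K} \<and> Inf K < Sup K \<and> m * measure lebesgue K < g (Sup K) - g (Inf K)" if "K \<in> G" for K
      using G(5)[OF that] by (auto simp: pos_less_divide_eq)
    have GI: "\<exists>I\<in>F. K \<subseteq> I" if "K \<in> G" for K
      using G(4)[OF that] interior_subset by blast
    have Fd: "F division_of \<Union>F"
      using Fprop by (intro disjoint_intervals_division[OF F(1,2)]) simp
    have Gd: "G division_of \<Union>G"
      using Gprop by (intro disjoint_intervals_division[OF G(1,2)]) simp
    have "measure lebesgue (\<Union>F) \<le> measure lebesgue T"
      using F(4) Tm fmeasurableD[OF lmeasurable_division[OF Fd]]
      by (intro measure_mono_fmeasurable) auto
    then have sF: "(\<Sum>I\<in>F. measure lebesgue I) < e + \<epsilon>"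
      using Tmeas content_division[OF Fd] by simp
    have Fm: "\<Union>F \<in> lmeasurable" and Gm: "\<Union>G \<in> lmeasurable"
      using lmeasurable_division Fd Gd by blast+
    define N where "N = Inf ` F \<union> Sup ` F"
    have Nn: "negligible N" unfolding N_def using F(1) by (intro negligible_finite) auto
    have FN: "x \<in> \<Union>(interior ` F) \<union> N" if xF: "x \<in> \<Union>F" for x
    proof -
      obtain I where I: "I \<in> F" "x \<in> I" using xF by blast
      then have iI: "I = {Inf I..Sup I}" using Fprop by blast
      then have "interior I = {Inf I<..<Sup I}" by (metis interior_atLeastAtMost_real)
      moreover have "Inf I \<le> x" "x \<le> Sup I" using iI I(2) by (metis atLeastAtMost_iff)+
      ultimately show ?thesis using I(1) unfolding N_def by (cases "x = Inf I \<or> x = Sup I") auto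
    qed
    have "e \<le> measure lebesgue (((?E - \<Union>F) \<union> N) \<union> ((E' - \<Union>G) \<union> \<Union>G))"
      unfolding e_def
    proof (rule measure_mono_fmeasurable)
      show "?E \<subseteq> ((?E - \<Union>F) \<union> N) \<union> ((E' - \<Union>G) \<union> \<Union>G)" using FN unfolding E'_def by blast
      show "?E \<in> sets lebesgue" using Em by (rule fmeasurableD)
      show "((?E - \<Union>F) \<union> N) \<union> ((E' - \<Union>G) \<union> \<Union>G) \<in> lmeasurable"
        using Em E'm Fm Gm negligible_imp_measurable[OF Nn]
        by (intro fmeasurable.Un fmeasurable.Diff) auto
    qed
    also have "\<dots> \<le> measure lebesgue ((?E - \<Union>F) \<union> N) + measure lebesgue ((E' - \<Union>G) \<union> \<Union>G)"
      using Em E'm Fm Gm negligible_imp_measurable[OF Nn]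
      by (intro measure_Un_le fmeasurableD fmeasurable.Un fmeasurable.Diff) auto
    also have "\<dots> \<le> (measure lebesgue (?E - \<Union>F) + measure lebesgue N)
        + (measure lebesgue (E' - \<Union>G) + measure lebesgue (\<Union>G))"
      using Em E'm Fm Gm negligible_imp_measurable[OF Nn]
      by (intro add_mono measure_Un_le fmeasurableD fmeasurable.Un fmeasurable.Diff) auto
    also have "\<dots> < (\<epsilon> + 0) + (\<epsilon> + (\<Sum>K\<in>G. measure lebesgue K))"
      using F(3) G(3) content_division[OF Gd] negligible_imp_measure0[OF Nn] by simp
    finally have sG: "e - 2 * \<epsilon> < (\<Sum>K\<in>G. measure lebesgue K)" by simp
    \<comment> \<open>The inner intervals inside I are completed to a division \<open>R I\<close> of
      I. The pieces added in this way, over all I, form \<open>D\<close>.\<close>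
    define GI where "GI I = {K\<in>G. K \<subseteq> I}" for I
    have "\<exists>R. GI I \<subseteq> R \<and> R division_of I" if "I \<in> F" for I
    proof -
      have "GI I division_of \<Union>(GI I)" using Gd unfolding GI_def
        by (rule division_of_subset) auto
      moreover have "\<Union>(GI I) \<subseteq> cbox (Inf I) (Sup I)"
        using Fprop[OF that] unfolding GI_def by auto
      ultimately obtain R where "GI I \<subseteq> R" "R division_of cbox (Inf I) (Sup I)"
        by (rule partial_division_extend_interval)
      then show ?thesis using Fprop[OF that] by (metis box_real(2))
    qed
    then obtain R where R: "\<And>I. I \<in> F \<Longrightarrow> GI I \<subseteq> R I" "\<And>I. I \<in> F \<Longrightarrow> R I division_of I" by metis
    have Rfin: "finite (R I)" if "I \<in> F" for I using R(2)[OF that] by blast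
    have RI: "K \<subseteq> I \<and> K \<noteq> {}" if "I \<in> F" "K \<in> R I" for I K
      using division_ofD(2,3)[OF R(2)[OF that(1)] that(2)] by blast
    have RFd: "I = J" if "I \<in> F" "J \<in> F" "K \<in> R I" "K \<in> R J" for I J K
    proof (rule ccontr)
      assume "I \<noteq> J"
      then have "I \<inter> J = {}" using F(2) that unfolding disjoint_def by blast
      then show False using RI[of I K] RI[of J K] that by blast
    qed
    have Rdisj: "(R I - GI I) \<inter> (R J - GI J) = {}" if "I \<in> F" "J \<in> F" "I \<noteq> J" for I J
      using RFd that by blast
    have GIdisj: "GI I \<inter> GI J = {}" if "I \<in> F" "J \<in> F" "I \<noteq> J" for I J
      using RFd that R(1) by blast
    have GU: "G = (\<Union>I\<in>F. GI I)" using GI unfolding GI_def by blast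
    define D where "D = (\<Union>I\<in>F. R I - GI I)"
    have Dd: "D division_of \<Union>D"
    proof (rule division_ofI)
      show "finite D" unfolding D_def using F(1) Rfin by blast
      fix K assume "K \<in> D"
      then obtain I where I: "I \<in> F" "K \<in> R I" unfolding D_def by blast
      show "K \<subseteq> \<Union>D" using \<open>K \<in> D\<close> by blast
      show "K \<noteq> {}" using RI[OF I] by blast
      show "\<exists>a b. K = cbox a b" using division_ofD(4)[OF R(2)[OF I(1)] I(2)] .
      fix L assume "L \<in> D" "K \<noteq> L"
      then obtain J where J: "J \<in> F" "L \<in> R J" unfolding D_def by blast
      show "interior K \<inter> interior L = {}"
      proof (cases "I = J")
        case True
        then show ?thesis using division_ofD(5)[OF R(2)[OF I(1)] I(2)] J \<open>K \<noteq> L\<close> by blast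
      next
        case False
        then have "I \<inter> J = {}" using F(2) I J unfolding disjoint_def by blast
        then show ?thesis using RI[OF I] RI[OF J] interior_subset by blast
      qed
    qed blast
    have sumR: "(\<Sum>K\<in>R I - GI I. h K) = (\<Sum>K\<in>R I. h K) - (\<Sum>K\<in>GI I. h K)" if "I \<in> F" for I and h :: "real set \<Rightarrow> real"
      using sum_diff[OF Rfin[OF that] R(1)[OF that]] .
    have sumD: "(\<Sum>K\<in>D. h K) = (\<Sum>I\<in>F. \<Sum>K\<in>R I - GI I. h K)" for h :: "real set \<Rightarrow> real"
      unfolding D_def using F(1) Rfin Rdisj by (intro sum.UNION_disjoint) auto
    have sumG: "(\<Sum>K\<in>G. h K) = (\<Sum>I\<in>F. \<Sum>K\<in>GI I. h K)" for h :: "real set \<Rightarrow> real"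
      unfolding GU using F(1) Rfin R(1) GIdisj
      by (subst sum.UNION_disjoint) (auto simp: GU[symmetric] intro: finite_subset)
    have "measure lebesgue (\<Union>D) = (\<Sum>K\<in>D. measure lebesgue K)" using content_division[OF Dd] by simp
    also have "\<dots> = (\<Sum>I\<in>F. measure lebesgue I - (\<Sum>K\<in>GI I. measure lebesgue K))"
      unfolding sumD by (rule sum.cong) (simp_all add: sumR content_division[OF R(2)])
    also have "\<dots> = (\<Sum>I\<in>F. measure lebesgue I) - (\<Sum>K\<in>G. measure lebesgue K)"
      unfolding sumG by (simp add: sum_subtractf)
    also have "\<dots> < \<delta>" using sF sG \<epsilon> by linarith
    finally have "measure lebesgue (\<Union>D) < \<delta>" .
    moreover have "\<Union>D \<subseteq> {a..b}" unfolding D_def using RI Fprop by blast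
    ultimately have small: "(\<Sum>K\<in>D. \<bar>g (Sup K) - g (Inf K)\<bar>) < m * e / 2" using \<delta>(2)[OF Dd] by blast
    have "m * (\<Sum>K\<in>G. measure lebesgue K) \<le> (\<Sum>K\<in>G. g (Sup K) - g (Inf K))"
      unfolding sum_distrib_left using Gprop by (intro sum_mono) (simp add: less_imp_le)
    also have "\<dots> = (\<Sum>I\<in>F. \<Sum>K\<in>GI I. g (Sup K) - g (Inf K))" by (rule sumG)
    also have "\<dots> \<le> (\<Sum>I\<in>F. \<Sum>K\<in>R I - GI I. \<bar>g (Sup K) - g (Inf K)\<bar>)"
    proof (rule sum_mono)
      fix I assume I: "I \<in> F"
      have iI: "I = {Inf I..Sup I}" "Inf I \<le> Sup I" "g (Sup I) - g (Inf I) < 0" using Fprop[OF I] by auto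
      have "(\<Sum>K\<in>R I. g (Sup K) - g (Inf K)) = g (Sup I) - g (Inf I)"
        using division_telescope[of "R I" "Inf I" "Sup I"] R(2)[OF I] iI by simp
      \<comment> \<open>The increment over all of I is negative, so the increments over the inner
        intervals are compensated by those over the added pieces of I.\<close>
      then have "(\<Sum>K\<in>R I - GI I. g (Sup K) - g (Inf K)) + (\<Sum>K\<in>GI I. g (Sup K) - g (Inf K)) < 0"
        unfolding sumR[OF I] using iI(3) by simp
      moreover have "- (\<Sum>K\<in>R I - GI I. \<bar>g (Sup K) - g (Inf K)\<bar>) \<le> (\<Sum>K\<in>R I - GI I. g (Sup K) - g (Inf K))"
        unfolding sum_negf[symmetric] by (rule sum_mono) simp
      ultimately show "(\<Sum>K\<in>GI I. g (Sup K) - g (Inf K)) \<le> (\<Sum>K\<in>R I - GI I. \<bar>g (Sup K) - g (Inf K)\<bar>)"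
        by linarith
    qed
    also have "\<dots> < m * e / 2" using small unfolding sumD .
    finally have "m * (\<Sum>K\<in>G. measure lebesgue K) < m * (e / 2)" by simp
    then have "(\<Sum>K\<in>G. measure lebesgue K) < e / 2" using m mult_less_cancel_left_pos by blast
    then show False using sG \<epsilon> by linarith
  qed
  then show ?thesis using Em unfolding e_def by (simp add: negligible_iff_measure)
qed

text \<open>Subtracting the linear function p x lowers all difference quotients by p, which moves
  the gap (p,q) to (0,q-p).\<close>

lemma dq_cluster_crossing_negligible:
  assumes ac: "abs_continuous_on {a..b} g" and pq: "p < q"
  shows "negligible (dq_cluster a b g {..<p} \<inter> dq_cluster a b g {q<..})"
proof -
  define h where "h x = g x - p * x" for x
  have "abs_continuous_on {a..b} (\<lambda>x. p * x)"
    by (rule abs_continuous_on_lipschitz[where C="\<bar>p\<bar>"])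
      (simp add: right_diff_distrib[symmetric] abs_mult)
  then have "abs_continuous_on {a..b} h" unfolding h_def by (rule abs_continuous_on_diff[OF ac])
  then have "negligible (dq_cluster a b h {..<0} \<inter> dq_cluster a b h {q - p<..})"
    using pq by (intro dq_cluster_crossing_negligible_0) auto
  moreover have "(h y - h x) / (y - x) = (g y - g x) / (y - x) - p" if "y \<noteq> x" for x y
    using that by (simp add: h_def field_simps)
  then have "dq_cluster a b h {..<0} = dq_cluster a b g {..<p}"
      "dq_cluster a b h {q - p<..} = dq_cluster a b g {q<..}"
    unfolding dq_cluster_def by (auto 4 4)
  ultimately show ?thesis by simp
qed

text \<open>Inside a ball of diameter \<delta>/2, disjoint intervals have total length below
  \<delta>, so their increments sum to less than 1. If every increment exceeds n+1 times the length,
  the total length is at most 1/(n+1). The part of the set in the ball thus has measure at most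
  2/(n+1) for every n.\<close>

lemma dq_cluster_infinite_negligible:
  assumes ac: "abs_continuous_on {a..b} g"
  shows "negligible (\<Inter>n::nat. dq_cluster a b g {y. real n < \<bar>y\<bar>})" (is "negligible ?E")
proof -
  have cont: "continuous_on {a<..<b} g"
    using abs_continuous_on_imp_continuous_on[OF ac] by (rule continuous_on_subset) auto
  have op: "open {y::real. real n < \<bar>y\<bar>}" for n :: nat
    by (intro open_Collect_less continuous_intros)
  have Es: "?E \<in> sets lebesgue"
    using dq_cluster_measurable[OF cont op] by (intro sets.countable_INT'') (auto intro: fmeasurableD)
  have "(0::real) < 1" by simp
  from abs_continuous_on_division[OF ac this]
  obtain \<delta> where \<delta>: "0 < \<delta>" "\<And>D T. D division_of T \<Longrightarrow> T \<subseteq> {a..b} \<Longrightarrow> measure lebesgue T < \<delta> \<Longrightarrow>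
       (\<Sum>K\<in>D. \<bar>g (Sup K) - g (Inf K)\<bar>) < 1" by blast
  have loc: "negligible (?E \<inter> ball z (\<delta> / 4))" for z
  proof -
    let ?B = "ball z (\<delta> / 4)"
    define E where "E = ?E \<inter> ?B"
    have Em: "E \<in> lmeasurable" unfolding E_def
      by (subst Int_commute) (intro fmeasurable_Int_fmeasurable Es; simp)
    have "measure lebesgue E \<le> 2 / real (Suc n)" for n
    proof -
      have pos: "0 < 1 / real (Suc n)" by simp
      obtain D where D: "finite D" "disjoint D" "measure lebesgue (E - \<Union>D) < 1 / real (Suc n)"
        "\<And>K. K \<in> D \<Longrightarrow> \<exists>U\<in>{?B}. K \<subseteq> U"
        "\<And>K. K \<in> D \<Longrightarrow> \<exists>u v. a < u \<and> u < v \<and> v < b \<and> K = {u..v} \<and> (g v - g u) / (v - u) \<in> {y. real (Suc n) < \<bar>y\<bar>}"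
      proof (rule dq_cluster_finite_cover[OF _ Em pos, of a b g "{y. real (Suc n) < \<bar>y\<bar>}" "{?B}"])
        show "E \<subseteq> dq_cluster a b g {y. real (Suc n) < \<bar>y\<bar>}" "E \<subseteq> \<Union>{?B}" unfolding E_def by blast+
      qed auto
      have Dprop: "K \<subseteq> {a..b} \<and> K = {Inf K..Sup K} \<and> Inf K < Sup K \<and>
          real (Suc n) * measure lebesgue K \<le> \<bar>g (Sup K) - g (Inf K)\<bar>" if "K \<in> D" for K
        using D(5)[OF that] by (auto simp: abs_divide pos_less_divide_eq)
      have Dd: "D division_of \<Union>D" using Dprop by (intro disjoint_intervals_division[OF D(1,2)]) simp
      have Dm: "\<Union>D \<in> lmeasurable" using lmeasurable_division Dd by blast
      have "?B \<subseteq> {z - \<delta>/4..z + \<delta>/4}" by (auto simp: ball_eq_greaterThanLessThan)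
      then have "\<Union>D \<subseteq> {z - \<delta>/4..z + \<delta>/4}" using D(4) by blast
      then have "measure lebesgue (\<Union>D) \<le> measure lebesgue {z - \<delta>/4..z + \<delta>/4}"
        using fmeasurableD[OF Dm] by (intro measure_mono_fmeasurable) auto
      also have "\<dots> < \<delta>" using \<delta>(1) by simp
      finally have "measure lebesgue (\<Union>D) < \<delta>" .
      then have "(\<Sum>K\<in>D. \<bar>g (Sup K) - g (Inf K)\<bar>) < 1" using Dprop by (intro \<delta>(2)[OF Dd]) blast+
      moreover have "real (Suc n) * (\<Sum>K\<in>D. measure lebesgue K) \<le> (\<Sum>K\<in>D. \<bar>g (Sup K) - g (Inf K)\<bar>)"
        unfolding sum_distrib_left using Dprop by (intro sum_mono) simp
      ultimately have "real (Suc n) * (\<Sum>K\<in>D. measure lebesgue K) \<le> 1" by linarith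
      then have D1: "measure lebesgue (\<Union>D) \<le> 1 / real (Suc n)"
        unfolding content_division[OF Dd, symmetric] by (simp add: field_simps)
      have "measure lebesgue E \<le> measure lebesgue ((E - \<Union>D) \<union> \<Union>D)"
        using Em Dm by (intro measure_mono_fmeasurable fmeasurable.Un fmeasurable.Diff fmeasurableD) auto
      also have "\<dots> \<le> measure lebesgue (E - \<Union>D) + measure lebesgue (\<Union>D)"
        using Em Dm by (intro measure_Un_le fmeasurableD fmeasurable.Diff) auto
      also have "\<dots> \<le> 2 / real (Suc n)" using D(3) D1 by (simp add: field_simps)
      finally show ?thesis .
    qed
    then have *: "measure lebesgue E \<le> 2 * inverse (real (Suc n))" for n by (simp add: divide_inverse)
    have "(\<lambda>n. 2 * inverse (real (Suc n))) \<longlonglongrightarrow> 2 * 0"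
      by (intro tendsto_mult tendsto_const LIMSEQ_inverse_real_of_nat)
    then have "measure lebesgue E \<le> 2 * 0" by (rule LIMSEQ_le_const) (use * in blast)
    then have "measure lebesgue E = 0" using measure_nonneg[of lebesgue E] by linarith
    then show ?thesis using Em unfolding E_def by (simp add: negligible_iff_measure)
  qed
  show ?thesis
    unfolding locally_negligible_alt[of ?E]
  proof
    fix x assume "x \<in> ?E"
    then show "\<exists>U. openin (top_of_set ?E) U \<and> x \<in> U \<and> negligible U"
      using loc[of x] \<delta>(1) by (intro exI[of _ "?E \<inter> ball x (\<delta>/4)"]) (auto intro!: openin_open_Int)
  qed
qed

text \<open>Where the difference quotients neither cluster at infinity nor on both sides of a rational gap,
  they converge.\<close>

lemma abs_continuous_on_differentiable_ae:
  assumes ac: "abs_continuous_on {a..b} g"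
  obtains N where "negligible N" "\<And>x. x \<in> {a..b} - N \<Longrightarrow> a < x \<and> x < b \<and> g differentiable (at x)"
proof -
  define N1 where "N1 = (\<Union>p\<in>\<rat>. \<Union>q\<in>\<rat>\<inter>{p<..}. dq_cluster a b g {..<p} \<inter> dq_cluster a b g {q<..})"
  define N2 where "N2 = (\<Inter>n::nat. dq_cluster a b g {y. real n < \<bar>y\<bar>})"
  have neg1: "negligible (\<Union>q\<in>\<rat>\<inter>{p<..}. dq_cluster a b g {..<p} \<inter> dq_cluster a b g {q<..})" for p
    by (rule negligible_countable_Union)
      (auto intro!: dq_cluster_crossing_negligible[OF ac] countable_image countable_Int1 countable_rat)
  have "negligible N1"
    unfolding N1_def using neg1 by (intro negligible_countable_Union) (blast intro: countable_rat)+
  moreover have "negligible N2" unfolding N2_def by (rule dq_cluster_infinite_negligible[OF ac])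
  ultimately have "negligible (N1 \<union> N2 \<union> {a, b})" by (intro negligible_Un) auto
  moreover have "a < x \<and> x < b \<and> g differentiable (at x)" if x: "x \<in> {a..b} - (N1 \<union> N2 \<union> {a, b})" for x
  proof -
    have xab: "x \<in> {a<..<b}" using x by auto
    define Q where "Q y = (g y - g x) / (y - x)" for y
    have avoid: "\<forall>\<^sub>F y in at x. Q y \<notin> S" if S: "x \<notin> dq_cluster a b g S" for S
    proof -
      obtain d where d: "d > 0" "\<forall>y\<in>{a<..<b}. y \<noteq> x \<and> \<bar>y - x\<bar> < d \<longrightarrow> Q y \<notin> S"
        using S xab unfolding dq_cluster_def Q_def by blast
      have "\<forall>\<^sub>F y in at x. y \<in> {a<..<b}" using xab by (intro eventually_at_in_open') auto
      moreover have "\<forall>\<^sub>F y in at x. y \<noteq> x \<and> \<bar>y - x\<bar> < d"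
        unfolding eventually_at using d(1) by (auto simp: dist_real_def)
      ultimately show ?thesis using d(2) by (auto elim: eventually_elim2)
    qed
    obtain n :: nat where n: "x \<notin> dq_cluster a b g {y. real n < \<bar>y\<bar>}" using x unfolding N2_def by blast
    have bd: "\<forall>\<^sub>F y in at x. \<bar>Q y\<bar> \<le> real n" using avoid[OF n] by eventually_elim simp
    \<comment> \<open>The lower limit of the quotients, written as the supremum of their eventual
      lower bounds; finite because the quotients are eventually bounded.\<close>
    define L where "L = Sup {p. \<forall>\<^sub>F y in at x. p \<le> Q y}"
    have up: "p \<le> real n" if p: "\<forall>\<^sub>F y in at x. p \<le> Q y" for p
    proof -
      have "\<forall>\<^sub>F y in at x. p \<le> real n" using p bd by eventually_elim linarith
      then show ?thesis by simp
    qed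
    have ne: "{p. \<forall>\<^sub>F y in at x. p \<le> Q y} \<noteq> {}"
    proof -
      have "\<forall>\<^sub>F y in at x. - real n \<le> Q y" using bd by eventually_elim linarith
      then show ?thesis by blast
    qed
    have bdd: "bdd_above {p. \<forall>\<^sub>F y in at x. p \<le> Q y}" using up by (intro bdd_aboveI) auto
    have "(Q \<longlongrightarrow> L) (at x)"
    proof (rule order_tendstoI)
      fix c assume "c < L"
      then obtain p where "c < p" "\<forall>\<^sub>F y in at x. p \<le> Q y"
        unfolding L_def less_cSup_iff[OF ne bdd] by blast
      then show "\<forall>\<^sub>F y in at x. c < Q y" by (auto elim: eventually_mono)
    next
      fix c assume "L < c"
      \<comment> \<open>Since p > L is not an eventual lower bound, quotients below p recur
        arbitrarily close to x. Outside \<open>N1\<close> they cannot also recur above q, so they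
        are eventually at most q < c.\<close>
      then obtain p where p: "p \<in> \<rat>" "L < p" "p < c" using Rats_dense_in_real by blast
      then obtain q where q: "q \<in> \<rat>" "p < q" "q < c" using Rats_dense_in_real by blast
      have "\<not> (\<forall>\<^sub>F y in at x. p \<le> Q y)"
        using cSup_upper[OF _ bdd, of p] p(2) unfolding L_def by auto
      then have "x \<in> dq_cluster a b g {..<p}"
        using avoid[of "{..<p}"] by (auto elim: eventually_mono simp: not_less)
      then have "x \<notin> dq_cluster a b g {q<..}" using x p q unfolding N1_def by blast
      then have "\<forall>\<^sub>F y in at x. Q y \<notin> {q<..}" by (rule avoid)
      then show "\<forall>\<^sub>F y in at x. Q y < c" using q(3) by (auto elim!: eventually_mono)
    qed
    then have "(g has_field_derivative L) (at x)"
      unfolding has_field_derivative_iff Q_def .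
    then show ?thesis using xab real_differentiable_def by auto
  qed
  ultimately show ?thesis using that by blast
qed

text \<open>The Henstock sums over tags in the exceptional null set are small because the intervals with
  such tags lie in an open set of small measure; elsewhere the straddle estimate applies.\<close>

lemma abs_continuous_on_has_integral:
  assumes ac: "abs_continuous_on {a..b} F" and ab: "a \<le> b" and N: "negligible N"
    and der: "\<And>x. x \<in> {a..b} - N \<Longrightarrow> (F has_vector_derivative h x) (at x within {a..b})"
  shows "(h has_integral (F b - F a)) {a..b}"
proof -
  \<comment> \<open>With value 0 on \<open>N\<close>, a piece tagged there contributes nothing but
    the increment of \<open>F\<close>.\<close>
  define h' where "h' x = (if x \<in> N then 0 else h x)" for x
  have "(h' has_integral (F b - F a)) (cbox a b)"
    unfolding has_integral
  proof (intro allI impI)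
    fix e :: real assume e: "e > 0"
    define \<eta> where "\<eta> = e / (4 * (b - a + 1))"
    have "0 < \<eta>" "\<eta> * (b - a + 1) = e / 4" using e ab by (simp_all add: \<eta>_def divide_simps)
    then have \<eta>: "0 < \<eta>" "\<eta> * (b - a) < e / 2" using e by (simp_all add: algebra_simps)
    have "0 < e / 2" using e by simp
    from abs_continuous_on_division[OF ac this]
    obtain \<delta> where \<delta>: "0 < \<delta>" "\<And>D T. D division_of T \<Longrightarrow> T \<subseteq> {a..b} \<Longrightarrow> measure lebesgue T < \<delta> \<Longrightarrow>
       (\<Sum>K\<in>D. \<bar>F (Sup K) - F (Inf K)\<bar>) < e / 2" by blast
    obtain U where U: "open U" "N \<subseteq> U" "U - N \<in> lmeasurable" "emeasure lebesgue (U - N) < ennreal \<delta>"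
      using sets_lebesgue_outer_open[OF negligible_imp_sets[OF N] \<delta>(1)] by blast
    have Utot: "U = N \<union> (U - N)" using U(2) by blast
    have Um: "U \<in> lmeasurable"
      using fmeasurable.Un[OF negligible_imp_measurable[OF N] U(3)] Utot by simp
    have "measure lebesgue (U - N) < \<delta>"
      using U(4) emeasure_eq_measure2[OF U(3)] \<delta>(1) by (simp add: ennreal_less_iff)
    moreover have "measure lebesgue U \<le> measure lebesgue N + measure lebesgue (U - N)"
      using measure_Un_le[OF negligible_imp_sets[OF N] fmeasurableD[OF U(3)]] Utot by simp
    ultimately have Umeas: "measure lebesgue U < \<delta>" using negligible_imp_measure0[OF N] by simp
    have "\<exists>d>0. if x \<in> N then ball x d \<subseteq> U
        else x \<in> {a..b} \<longrightarrow> (\<forall>y\<in>{a..b}. \<bar>y - x\<bar> < d \<longrightarrow> \<bar>F y - F x - (y - x) * h x\<bar> \<le> \<eta> * \<bar>y - x\<bar>)" for x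
    proof (cases "x \<in> N")
      case True
      then show ?thesis using U(1,2) openE by (metis subsetD)
    next
      case False
      show ?thesis
      proof (cases "x \<in> {a..b}")
        case True
        then have "(F has_derivative (\<lambda>y. y *\<^sub>R h x)) (at x within {a..b})"
          using der False unfolding has_vector_derivative_def by blast
        then show ?thesis using \<eta>(1) False unfolding has_derivative_within_alt by auto
      next
        case False
        then show ?thesis using \<open>x \<notin> N\<close> by (intro exI[of _ 1]) auto
      qed
    qed
    then obtain d where d: "\<And>x. d x > 0" "\<And>x. x \<in> N \<Longrightarrow> ball x (d x) \<subseteq> U"
      "\<And>x y. x \<notin> N \<Longrightarrow> x \<in> {a..b} \<Longrightarrow> y \<in> {a..b} \<Longrightarrow> \<bar>y - x\<bar> < d x \<Longrightarrow>
         \<bar>F y - F x - (y - x) * h x\<bar> \<le> \<eta> * \<bar>y - x\<bar>" by metis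
    define \<gamma> where "\<gamma> x = ball x (d x)" for x
    have "gauge \<gamma>" unfolding gauge_def \<gamma>_def using d(1) by auto
    moreover have "norm ((\<Sum>(x, K)\<in>p. measure lborel K *\<^sub>R h' x) - (F b - F a)) < e"
      if p: "p tagged_division_of cbox a b" and fine: "\<gamma> fine p" for p
    proof -
      have fin: "finite p" using p by blast
      have pK: "x \<in> K \<and> K \<subseteq> {a..b} \<and> K = {Inf K..Sup K} \<and> Inf K \<le> Sup K \<and> K \<subseteq> ball x (d x)"
        if xK: "(x, K) \<in> p" for x K
      proof -
        obtain u v where uv: "K = {u..v}" using tagged_division_ofD(4)[OF p xK] box_real(2) by metis
        have "x \<in> K" "K \<subseteq> {a..b}" using tagged_division_ofD(2,3)[OF p xK] by auto
        then show ?thesis using uv fineD[OF fine xK] unfolding \<gamma>_def by auto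
      qed
      define p1 where "p1 = {(x, K) \<in> p. x \<in> N}"
      define p2 where "p2 = {(x, K) \<in> p. x \<notin> N}"
      have pp: "p = p1 \<union> p2" "p1 \<inter> p2 = {}" "finite p1" "finite p2"
        using fin unfolding p1_def p2_def by (auto intro: finite_subset)
      have "F b - F a = (\<Sum>(x, K)\<in>p. F (Sup K) - F (Inf K))"
        using additive_tagged_division_1[OF ab, of p F] p by simp
      then have "(\<Sum>(x, K)\<in>p. measure lborel K *\<^sub>R h' x) - (F b - F a)
          = (\<Sum>(x, K)\<in>p. measure lborel K * h' x - (F (Sup K) - F (Inf K)))"
        by (simp add: sum_subtractf case_prod_unfold)
      also have "\<dots> = (\<Sum>(x, K)\<in>p1. measure lborel K * h' x - (F (Sup K) - F (Inf K)))
          + (\<Sum>(x, K)\<in>p2. measure lborel K * h' x - (F (Sup K) - F (Inf K)))"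
        using pp by (subst pp(1)) (rule sum.union_disjoint)
      finally have split: "norm ((\<Sum>(x, K)\<in>p. measure lborel K *\<^sub>R h' x) - (F b - F a))
          \<le> \<bar>\<Sum>(x, K)\<in>p1. measure lborel K * h' x - (F (Sup K) - F (Inf K))\<bar>
          + \<bar>\<Sum>(x, K)\<in>p2. measure lborel K * h' x - (F (Sup K) - F (Inf K))\<bar>"
        by (simp del: sum_subtractf)
      have tp: "p1 tagged_partial_division_of cbox a b"
        using p pp(1) unfolding tagged_division_of_def by (blast intro: tagged_partial_division_subset)
      have "\<bar>\<Sum>(x, K)\<in>p1. measure lborel K * h' x - (F (Sup K) - F (Inf K))\<bar>
          \<le> (\<Sum>(x, K)\<in>p1. \<bar>F (Sup K) - F (Inf K)\<bar>)"
        by (rule order_trans[OF sum_abs]) (auto intro!: sum_mono simp: p1_def h'_def)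
      also have "\<dots> = (\<Sum>K\<in>snd ` p1. \<bar>F (Sup K) - F (Inf K)\<bar>)"
      proof -
        \<comment> \<open>Two tags can share a piece only if the piece is degenerate, where the
          increment is 0. The explicit 0 at the empty set replaces the unspecified
          \<open>Sup {}\<close> and \<open>Inf {}\<close>.\<close>
        define \<phi> where "\<phi> K = (if K = {} then 0 else \<bar>F (Sup K) - F (Inf K)\<bar>)" for K
        have "\<phi> (cbox u v) = 0" if "box u v = {}" for u v
          using that by (cases "u < v") (auto simp: \<phi>_def)
        from sum.over_tagged_division_lemma[OF tagged_partial_division_of_Union_self[OF tp], of \<phi>, OF this]
        have "(\<Sum>(x, K)\<in>p1. \<phi> K) = (\<Sum>K\<in>snd ` p1. \<phi> K)" .
        moreover have \<phi>: "\<phi> (snd z) = \<bar>F (Sup (snd z)) - F (Inf (snd z))\<bar>" if "z \<in> p1" for z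
          using pK[of "fst z" "snd z"] that unfolding p1_def \<phi>_def by auto
        moreover have "(\<Sum>(x, K)\<in>p1. \<phi> K) = (\<Sum>(x, K)\<in>p1. \<bar>F (Sup K) - F (Inf K)\<bar>)"
          by (rule sum.cong) (auto simp: \<phi>[of "(_, _)", simplified])
        moreover have "(\<Sum>K\<in>snd ` p1. \<phi> K) = (\<Sum>K\<in>snd ` p1. \<bar>F (Sup K) - F (Inf K)\<bar>)"
          by (rule sum.cong) (auto simp: \<phi>[of "(_, _)", simplified])
        ultimately show ?thesis by simp
      qed
      also have "\<dots> < e / 2"
      proof (rule \<delta>(2))
        show dv: "(snd ` p1) division_of \<Union>(snd ` p1)"
          using partial_division_of_tagged_division[OF tp] .
        show "\<Union>(snd ` p1) \<subseteq> {a..b}" using pK unfolding p1_def by fastforce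
        have "\<Union>(snd ` p1) \<subseteq> U" using pK d(2) unfolding p1_def by fastforce
        then have "measure lebesgue (\<Union>(snd ` p1)) \<le> measure lebesgue U"
          using fmeasurableD[OF lmeasurable_division[OF dv]] Um by (intro measure_mono_fmeasurable) auto
        then show "measure lebesgue (\<Union>(snd ` p1)) < \<delta>" using Umeas by linarith
      qed
      finally have 1: "\<bar>\<Sum>(x, K)\<in>p1. measure lborel K * h' x - (F (Sup K) - F (Inf K))\<bar> < e / 2" .
      have "\<bar>\<Sum>(x, K)\<in>p2. measure lborel K * h' x - (F (Sup K) - F (Inf K))\<bar>
          \<le> (\<Sum>(x, K)\<in>p2. \<eta> * measure lborel K)"
      proof (rule order_trans[OF sum_abs sum_mono])
        fix z assume z: "z \<in> p2"
        obtain x K where xK: "z = (x, K)" by (cases z)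
        then have "(x, K) \<in> p" "x \<notin> N" using z unfolding p2_def by auto
        note k = pK[OF this(1)]
        define u v where "u = Inf K" and "v = Sup K"
        have K: "K = {u..v}" "u \<le> v" using k unfolding u_def v_def by auto
        have "u \<in> K" "v \<in> K" using K by auto
        then have "u \<in> ball x (d x)" "v \<in> ball x (d x)" using k by blast+
        then have "\<bar>u - x\<bar> < d x" "\<bar>v - x\<bar> < d x" by (auto simp: dist_real_def)
        then have m: "u \<le> x" "x \<le> v" "x \<in> {a..b}" "u \<in> {a..b}" "v \<in> {a..b}"  "\<bar>u - x\<bar> < d x" "\<bar>v - x\<bar> < d x"
          using k K by auto
        have "\<bar>F u - F x - (u - x) * h x\<bar> \<le> \<eta> * \<bar>u - x\<bar>" "\<bar>F v - F x - (v - x) * h x\<bar> \<le> \<eta> * \<bar>v - x\<bar>"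
          using d(3)[OF \<open>x \<notin> N\<close> m(3)] m by blast+
        then have "\<bar>(F u - F x - (u - x) * h x) - (F v - F x - (v - x) * h x)\<bar> \<le> \<eta> * (x - u) + \<eta> * (v - x)"
          using m by simp
        moreover have "(F u - F x - (u - x) * h x) - (F v - F x - (v - x) * h x) = (v - u) * h x - (F v - F u)"
          by (simp add: algebra_simps)
        moreover have "\<eta> * (x - u) + \<eta> * (v - x) = \<eta> * (v - u)" by (simp add: algebra_simps)
        ultimately have "\<bar>(v - u) * h x - (F v - F u)\<bar> \<le> \<eta> * (v - u)" by simp
        moreover have "measure lborel K = v - u" using K by simp
        ultimately show "\<bar>case z of (x, K) \<Rightarrow> measure lborel K * h' x - (F (Sup K) - F (Inf K))\<bar>
            \<le> (case z of (x, K) \<Rightarrow> \<eta> * measure lborel K)"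
          unfolding xK h'_def using \<open>x \<notin> N\<close> unfolding u_def v_def by simp
      qed
      also have "\<dots> \<le> (\<Sum>(x, K)\<in>p. \<eta> * measure lborel K)"
        using \<eta>(1) pp by (intro sum_mono2[OF fin]) auto
      also have "\<dots> = \<eta> * (\<Sum>(x, K)\<in>p. measure lborel K)" by (simp add: sum_distrib_left case_prod_unfold)
      also have "\<dots> = \<eta> * (b - a)" using additive_content_tagged_division[OF p] ab by simp
      also have "\<dots> < e / 2" by (rule \<eta>(2))
      finally show ?thesis using split 1 by linarith
    qed
    ultimately show "\<exists>\<gamma>. gauge \<gamma> \<and> (\<forall>p. p tagged_division_of cbox a b \<and> \<gamma> fine p \<longrightarrow>
      norm ((\<Sum>(x, K)\<in>p. measure lborel K *\<^sub>R h' x) - (F b - F a)) < e)" by (intro exI[of _ \<gamma>]) simp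
  qed
  then have "(h' has_integral (F b - F a)) {a..b}" by simp
  then show ?thesis by (rule has_integral_spike[OF N, rotated]) (simp add: h'_def)
qed

section \<open>The equation with constant coefficients\<close>

text \<open>Injectivity makes the determinant nonzero, and the adjugate divided by the determinant
  gives a solution. Coefficients are functions on \<open>nat\<close> so that matrix carriers stay
  inside this proof.\<close>

lemma square_system_solvable:
  fixes M :: "nat \<Rightarrow> nat \<Rightarrow> real" and b :: "nat \<Rightarrow> real"
  assumes inj: "\<And>a i. (\<And>s. s < n \<Longrightarrow> (\<Sum>i<n. M s i * a i) = 0) \<Longrightarrow> i < n \<Longrightarrow> a i = 0"
  obtains a where "\<And>s. s < n \<Longrightarrow> (\<Sum>i<n. M s i * a i) = b s"
proof -
  define A where "A = Matrix.mat n n (\<lambda>(s, i). M s i)"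
  have A: "A \<in> carrier_mat n n" unfolding A_def by simp
  have Av: "vec_index (A *\<^sub>v v) s = (\<Sum>i<n. M s i * vec_index v i)" if "v \<in> carrier_vec n" "s < n" for v s
    using that unfolding A_def by (simp add: scalar_prod_def atLeast0LessThan)
  have "Determinant.det A \<noteq> 0"
  proof
    assume "Determinant.det A = 0"
    then obtain v where v: "v \<in> carrier_vec n" "v \<noteq> 0\<^sub>v n" "A *\<^sub>v v = 0\<^sub>v n"
      unfolding det_0_iff_vec_prod_zero_field[OF A] by blast
    have "vec_index v i = 0" if "i < n" for i
    proof (rule inj[OF _ that])
      fix s assume "s < n"
      then show "(\<Sum>i<n. M s i * vec_index v i) = 0" using Av[OF v(1)] v(3) by simp
    qed
    then have "v = 0\<^sub>v n" using v(1) by (intro eq_vecI) auto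
    then show False using v(2) by simp
  qed
  define w where "w = (1 / Determinant.det A) \<cdot>\<^sub>v (adj_mat A *\<^sub>v Matrix.vec n b)"
  have w: "w \<in> carrier_vec n" using adj_mat(1)[OF A] unfolding w_def by simp
  have "A *\<^sub>v w = (1 / Determinant.det A) \<cdot>\<^sub>v ((A * adj_mat A) *\<^sub>v Matrix.vec n b)"
    unfolding w_def using A adj_mat(1)[OF A] by (simp add: mult_mat_vec assoc_mult_mat_vec[OF A adj_mat(1)[OF A]])
  also have "\<dots> = Matrix.vec n b" unfolding adj_mat(2)[OF A] using \<open>Determinant.det A \<noteq> 0\<close> 
    by (intro eq_vecI) (auto simp: smult_smult_assoc)
  finally have "(\<Sum>i<n. M s i * vec_index w i) = b s" if "s < n" for s
    using Av[OF w that] that by simp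
  then show ?thesis using that by blast
qed

section \<open>Smooth functions carried together with all their derivatives\<close>

text \<open>Here \<open>y j\<close> is the j-th derivative of \<open>y 0\<close> on the whole line.
  Carrying the entire sequence makes linear combinations, translations and index shifts immediate,
  without \<open>nth_deriv\<close> and its unspecified values.\<close>

definition deriv_chain :: "(nat \<Rightarrow> real \<Rightarrow> real) \<Rightarrow> bool" where
  "deriv_chain y \<longleftrightarrow> (\<forall>j x. (y j has_real_derivative y (Suc j) x) (at x))"

lemma deriv_chainD: "deriv_chain y \<Longrightarrow> (y j has_real_derivative y (Suc j) x) (at x within S)"
  unfolding deriv_chain_def by (simp add: has_field_derivative_at_within)

lemma deriv_chain_continuous_on: "deriv_chain y \<Longrightarrow> continuous_on S (y j)"
  by (rule DERIV_continuous_on, rule deriv_chainD)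

lemma deriv_chain_shift: "deriv_chain y \<Longrightarrow> deriv_chain (\<lambda>j. y (j + m))"
  unfolding deriv_chain_def by simp

lemma deriv_chain_translate:
  assumes "deriv_chain y" shows "deriv_chain (\<lambda>j x. y j (x - c))"
  unfolding deriv_chain_def
proof (intro allI)
  fix j x
  have "(y j has_real_derivative y (Suc j) (x - c)) (at (x - c))" using assms deriv_chain_def by blast
  then show "((\<lambda>x. y j (x - c)) has_real_derivative y (Suc j) (x - c)) (at x)"
    using DERIV_shift[of "\<lambda>x. y j x" "y (Suc j) (x - c)" x "- c"] by simp
qed

lemma deriv_chain_add: "deriv_chain y \<Longrightarrow> deriv_chain z \<Longrightarrow> deriv_chain (\<lambda>j x. y j x + z j x)"
  unfolding deriv_chain_def by (simp add: DERIV_add)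

lemma deriv_chain_diff: "deriv_chain y \<Longrightarrow> deriv_chain z \<Longrightarrow> deriv_chain (\<lambda>j x. y j x - z j x)"
  unfolding deriv_chain_def by (simp add: DERIV_diff)

lemma deriv_chain_cmult: "deriv_chain y \<Longrightarrow> deriv_chain (\<lambda>j x. c * y j x)"
  unfolding deriv_chain_def by (simp add: DERIV_cmult)

lemma deriv_chain_sum: "(\<And>i. i \<in> I \<Longrightarrow> deriv_chain (y i)) \<Longrightarrow> deriv_chain (\<lambda>j x. \<Sum>i\<in>I. y i j x)"
  unfolding deriv_chain_def by (simp add: DERIV_sum)

lemma deriv_chain_zero: "deriv_chain (\<lambda>j x. 0)"
  unfolding deriv_chain_def by auto

text \<open>The equation y^(n) = \<kappa> y together with all its derivatives. For n = 2r and
  \<kappa> = (-1)^(r+1) \<lambda> it is the equation of the boundary value problem solved for the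
  top derivative.\<close>

definition ode_chain :: "nat \<Rightarrow> real \<Rightarrow> (nat \<Rightarrow> real \<Rightarrow> real) \<Rightarrow> bool" where
  "ode_chain n \<kappa> y \<longleftrightarrow> deriv_chain y \<and> (\<forall>j x. y (j + n) x = \<kappa> * y j x)"

lemma ode_chainD:
  assumes "ode_chain n \<kappa> y"
  shows "(y j has_real_derivative y (Suc j) x) (at x)" "y n x = \<kappa> * y 0 x"
proof -
  show "(y j has_real_derivative y (Suc j) x) (at x)"
    using assms unfolding ode_chain_def deriv_chain_def by blast
  have "y (0 + n) x = \<kappa> * y 0 x" using assms unfolding ode_chain_def by blast
  then show "y n x = \<kappa> * y 0 x" by simp
qed

lemma ode_chain_translate: "ode_chain n \<kappa> y \<Longrightarrow> ode_chain n \<kappa> (\<lambda>j x. y j (x - c))"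
  unfolding ode_chain_def by (simp add: deriv_chain_translate)

lemma ode_chain_add: "ode_chain n \<kappa> y \<Longrightarrow> ode_chain n \<kappa> z \<Longrightarrow> ode_chain n \<kappa> (\<lambda>j x. y j x + z j x)"
  unfolding ode_chain_def by (simp add: deriv_chain_add distrib_left)

lemma ode_chain_diff: "ode_chain n \<kappa> y \<Longrightarrow> ode_chain n \<kappa> z \<Longrightarrow> ode_chain n \<kappa> (\<lambda>j x. y j x - z j x)"
  unfolding ode_chain_def by (simp add: deriv_chain_diff right_diff_distrib)

lemma ode_chain_cmult: "ode_chain n \<kappa> y \<Longrightarrow> ode_chain n \<kappa> (\<lambda>j x. c * y j x)"
  unfolding ode_chain_def by (simp add: deriv_chain_cmult)

lemma ode_chain_sum:
  "(\<And>i. i \<in> I \<Longrightarrow> ode_chain n \<kappa> (y i)) \<Longrightarrow> ode_chain n \<kappa> (\<lambda>j x. \<Sum>i\<in>I. y i j x)"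
  unfolding ode_chain_def by (simp add: deriv_chain_sum sum_distrib_left)

section \<open>Power series solutions and the initial value problem\<close>

lemma exponential_series_summable:
  fixes c :: "nat \<Rightarrow> real"
  assumes c: "\<And>i. \<bar>c i\<bar> \<le> C * K ^ i"
  shows "summable (\<lambda>i. c i / fact i * y ^ i)"
proof (rule summable_comparison_test')
  show "summable (\<lambda>i. C * ((K * \<bar>y\<bar>) ^ i /\<^sub>R fact i))" by (intro summable_mult summable_exp_generic)
  fix i :: nat
  have "norm (c i / fact i * y ^ i) = \<bar>c i\<bar> * \<bar>y\<bar> ^ i / fact i" by (simp add: abs_mult power_abs)
  also have "\<dots> \<le> (C * K ^ i) * \<bar>y\<bar> ^ i / fact i"
    using c by (intro divide_right_mono mult_right_mono) auto
  finally show "norm (c i / fact i * y ^ i) \<le> C * ((K * \<bar>y\<bar>) ^ i /\<^sub>R fact i)"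
    by (simp add: power_mult_distrib field_simps)
qed

lemma exponential_series_derivative:
  fixes c :: "nat \<Rightarrow> real"
  assumes c: "\<And>i. \<bar>c i\<bar> \<le> C * K ^ i"
  shows "((\<lambda>x. \<Sum>i. c i / fact i * x ^ i) has_real_derivative (\<Sum>i. c (Suc i) / fact i * x ^ i)) (at x)"
proof -
  from termdiffs_strong_converges_everywhere[of "\<lambda>i. c i / fact i",
      OF exponential_series_summable[OF c]]
  have "((\<lambda>x. \<Sum>i. c i / fact i * x ^ i) has_real_derivative (\<Sum>i. diffs (\<lambda>i. c i / fact i) i * x ^ i)) (at x)" .
  moreover have "diffs (\<lambda>i. c i / fact i) = (\<lambda>i. c (Suc i) / fact i)"
    unfolding diffs_def by (auto simp: fun_eq_iff field_simps simp del: of_nat_Suc)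
  ultimately show ?thesis by simp
qed

text \<open>The Taylor coefficients at 0 are forced: the first n are the initial values, and a shift
  of the index by n multiplies by \<kappa>. They grow at most geometrically, so the series is
  dominated by an exponential one.\<close>

lemma ode_chain_exists:
  assumes n: "0 < n"
  obtains y where "ode_chain n \<kappa> y" "\<And>j. j < n \<Longrightarrow> y j 0 = a j"
proof -
  define c where "c i = \<kappa> ^ (i div n) * a (i mod n)" for i
  define y where "y j x = (\<Sum>i. c (i + j) / fact i * x ^ i)" for j x
  define M where "M = (\<Sum>i<n. \<bar>a i\<bar>)"
  \<comment> \<open>At least 1, because the power of \<kappa> with exponent \<open>i div n\<close>
    is to be bounded by the i-th power of \<open>K\<close>.\<close>
  define K where "K = max 1 \<bar>\<kappa>\<bar>"
  have K: "K \<ge> 1" "\<bar>\<kappa>\<bar> \<le> K" unfolding K_def by auto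
  have c: "\<bar>c i\<bar> \<le> M * K ^ i" for i
  proof -
    have "\<bar>a (i mod n)\<bar> \<le> M" unfolding M_def
      using n by (intro member_le_sum) auto
    moreover have "\<bar>\<kappa>\<bar> ^ (i div n) \<le> K ^ (i div n)" using K by (intro power_mono) auto
    moreover have "K ^ (i div n) \<le> K ^ i" using K by (intro power_increasing) auto
    ultimately have "\<bar>\<kappa>\<bar> ^ (i div n) * \<bar>a (i mod n)\<bar> \<le> K ^ i * M" using K by (intro mult_mono) auto
    then show ?thesis unfolding c_def by (simp add: abs_mult power_abs mult.commute)
  qed
  have cj: "\<bar>c (i + j)\<bar> \<le> (M * K ^ j) * K ^ i" for i j using c[of "i + j"] by (simp add: power_add mult_ac)
  have "(y j has_real_derivative y (Suc j) x) (at x)" for j x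
    using exponential_series_derivative[of "\<lambda>i. c (i + j)", OF cj, of x] unfolding y_def by simp
  then have "deriv_chain y" unfolding deriv_chain_def by blast
  moreover have "y (j + n) x = \<kappa> * y j x" for j x
  proof -
    have "c (i + (j + n)) = \<kappa> * c (i + j)" for i
      using n unfolding c_def by (simp add: add.assoc[symmetric])
    then have "y (j + n) x = (\<Sum>i. \<kappa> * (c (i + j) / fact i * x ^ i))" unfolding y_def by (simp add: mult.assoc)
    also have "\<dots> = \<kappa> * y j x"
      unfolding y_def by (rule suminf_mult[OF exponential_series_summable[of "\<lambda>i. c (i + j)", OF cj]])
    finally show ?thesis .
  qed
  ultimately have "ode_chain n \<kappa> y" unfolding ode_chain_def by blast
  moreover have "y j 0 = a j" if "j < n" for j
  proof -
    have "y j 0 = (\<Sum>i. c (i + j) / fact i * 0 ^ i)" unfolding y_def ..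
    also have "\<dots> = c j" using powser_zero[of "\<lambda>i. c (i + j) / fact i"] by simp
    finally show ?thesis unfolding c_def using that by simp
  qed
  ultimately show ?thesis using that by blast
qed

text \<open>With \<open>Z\<close> the solution whose only nonzero initial value is \<open>Z\<^bsup>(n-1)\<^esup>(0) = 1\<close>, the sum
  \<open>\<Sum>\<^sub>i y\<^bsup>(i)\<^esup>(x) Z\<^bsup>(n-1-i)\<^esup>(p - x)\<close> is constant in \<open>x\<close> and equals \<open>y p\<close> at \<open>x = p\<close>.\<close>

lemma ode_initial_value_unique:
  assumes n: "0 < n" and S: "open S" "convex S" "c \<in> S" "p \<in> S"
    and y: "\<And>j x. j < n \<Longrightarrow> x \<in> S \<Longrightarrow> (y j has_real_derivative y (Suc j) x) (at x)"
      "\<And>x. x \<in> S \<Longrightarrow> y n x = \<kappa> * y 0 x"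
    and z: "\<And>j x. j < n \<Longrightarrow> x \<in> S \<Longrightarrow> (z j has_real_derivative z (Suc j) x) (at x)"
      "\<And>x. x \<in> S \<Longrightarrow> z n x = \<kappa> * z 0 x"
    and yz: "\<And>j. j < n \<Longrightarrow> y j c = z j c"
  shows "y 0 p = z 0 p"
proof -
  obtain Z where Z: "ode_chain n \<kappa> Z" "\<And>j. j < n \<Longrightarrow> Z j 0 = (if j = n - 1 then 1 else 0)"
    using ode_chain_exists[OF n, of \<kappa> "\<lambda>j. if j = n - 1 then 1 else 0"] by blast
  note Zd = ode_chainD(1)[OF Z(1)] and Zn = ode_chainD(2)[OF Z(1)]
  have rep: "y 0 p = (\<Sum>i<n. y i c * Z (n - 1 - i) (p - c))"
    if y: "\<And>j x. j < n \<Longrightarrow> x \<in> S \<Longrightarrow> (y j has_real_derivative y (Suc j) x) (at x)"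
      "\<And>x. x \<in> S \<Longrightarrow> y n x = \<kappa> * y 0 x" for y :: "nat \<Rightarrow> real \<Rightarrow> real"
  proof -
    define G where "G x = (\<Sum>i<n. y i x * Z (n - 1 - i) (p - x))" for x
    have "(G has_real_derivative 0) (at x within S)" if x: "x \<in> S" for x
    proof -
      \<comment> \<open>The derivative of the i-th summand is \<open>T (Suc i) - T i\<close>. After
        telescoping, \<open>T n\<close> and \<open>T 0\<close> cancel because the equation for y and
        the one for \<open>Z\<close> put the same factor \<kappa> into both.\<close>
      define T where "T i = y i x * Z (n - i) (p - x)" for i
      have "(G has_real_derivative (\<Sum>i<n. T (Suc i) - T i)) (at x)"
        unfolding G_def
      proof (rule DERIV_sum)
        fix i assume i: "i \<in> {..<n}"
        have "((\<lambda>x. Z (n - 1 - i) (p - x)) has_real_derivative Z (Suc (n - 1 - i)) (p - x) * (0 - 1)) (at x)"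
          by (rule DERIV_chain'[where f="\<lambda>x. p - x" and g="Z (n - 1 - i)", OF _ Zd]) (auto intro!: derivative_eq_intros)
        from DERIV_mult[OF y(1)[of i x] this] i x
        show "((\<lambda>x. y i x * Z (n - 1 - i) (p - x)) has_real_derivative T (Suc i) - T i) (at x)"
          unfolding T_def by (simp add: Suc_diff_Suc algebra_simps)
      qed
      also have "(\<Sum>i<n. T (Suc i) - T i) = T n - T 0" by (rule sum_lessThan_telescope)
      also have "\<dots> = 0" unfolding T_def using y(2)[OF x] Zn by simp
      finally show ?thesis by (rule has_field_derivative_at_within)
    qed
    from has_field_derivative_zero_constant[OF S(2) this] have "G p = G c" using S(3,4) by metis
    moreover have "G p = (\<Sum>i<n. if i = 0 then y 0 p else 0)"
      unfolding G_def using Z(2) n by (intro sum.cong) auto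
    ultimately show ?thesis unfolding G_def using n by simp
  qed
  show ?thesis using rep[of y, OF y] rep[of z, OF z] yz by simp
qed

lemma ode_chain_unique:
  assumes "0 < n" "ode_chain n \<kappa> y" "ode_chain n \<kappa> z" "\<And>j. j < n \<Longrightarrow> y j c = z j c"
  shows "y j x = z j x"
proof -
  have y0: "y 0 x = z 0 x" for x
    by (rule ode_initial_value_unique[of n UNIV c x y \<kappa> z])
      (use assms in \<open>auto intro: ode_chainD\<close>)
  have "\<forall>x. y j x = z j x" for j
  proof (induction j)
    case (Suc j)
    then have "y j = z j" by auto
    then show ?case using assms(2,3) DERIV_unique unfolding ode_chain_def deriv_chain_def by metis
  qed (simp add: y0)
  then show ?thesis by blast
qed

text \<open>Take the global solution with the same initial values at a point of \<open>S\<close>;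
  uniqueness gives equality at order 0, and differentiation on the open set carries it up to order
  n. This is how a function known only on (-1,t) or (t,1) acquires values at the ends.\<close>

lemma ode_local_solution_extends:
  assumes n: "0 < n" and S: "open S" "convex S"
    and y: "\<And>j x. j < n \<Longrightarrow> x \<in> S \<Longrightarrow> (y j has_real_derivative y (Suc j) x) (at x)"
      "\<And>x. x \<in> S \<Longrightarrow> y n x = \<kappa> * y 0 x"
  obtains w where "ode_chain n \<kappa> w" "\<And>j x. j \<le> n \<Longrightarrow> x \<in> S \<Longrightarrow> y j x = w j x"
proof (cases "S = {}")
  case True
  obtain w where "ode_chain n \<kappa> w" using ode_chain_exists[OF n] by blast
  then show ?thesis using that True by blast
next
  case False
  then obtain c where c: "c \<in> S" by blast
  obtain w' where w': "ode_chain n \<kappa> w'" "\<And>j. j < n \<Longrightarrow> w' j 0 = y j c"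
    using ode_chain_exists[OF n, of \<kappa> "\<lambda>j. y j c"] by blast
  define w where "w j x = w' j (x - c)" for j x
  have w: "ode_chain n \<kappa> w" unfolding w_def using ode_chain_translate[OF w'(1)] .
  note wd = ode_chainD[OF w]
  have y0: "y 0 x = w 0 x" if "x \<in> S" for x
    by (rule ode_initial_value_unique[OF n S c that y wd]) (use w'(2) in \<open>auto simp: w_def\<close>)
  have "j \<le> n \<longrightarrow> (\<forall>x\<in>S. y j x = w j x)" for j
  proof (induction j)
    case (Suc j)
    show ?case
    proof (intro impI ballI)
      fix x assume j: "Suc j \<le> n" and x: "x \<in> S"
      have "(y j has_real_derivative y (Suc j) x) (at x)" using y(1) j x by simp
      moreover have "y j x' = w j x'" if "x' \<in> S" for x' using Suc j that by simp
      ultimately have "(w j has_real_derivative y (Suc j) x) (at x)"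
        by (rule has_field_derivative_transform_within_open[OF _ S(1) x])
      then show "y (Suc j) x = w (Suc j) x" using wd(1) DERIV_unique by blast
    qed
  qed (simp add: y0)
  then show ?thesis using w by (intro that[of w]) auto
qed

section \<open>Integration by parts and the boundary value problem\<close>

lemma abs_continuous_on_C1:
  assumes "\<And>x. x \<in> {a..b} \<Longrightarrow> (f has_vector_derivative f' x) (at x within {a..b})"
    and "continuous_on {a..b} f'"
  shows "abs_continuous_on {a..b} f"
proof -
  have "bounded (f' ` {a..b})" using assms(2) by (intro compact_imp_bounded compact_continuous_image) auto
  then obtain B where B: "\<And>x. x \<in> {a..b} \<Longrightarrow> norm (f' x) \<le> B" unfolding bounded_iff by blast
  show ?thesis
  proof (rule abs_continuous_on_lipschitz)
    fix x y assume xy: "x \<in> {a..b}" "y \<in> {a..b}"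
    have "norm (f x - f y) \<le> B * norm (x - y)"
    proof (rule field_differentiable_bound[where S="{a..b}" and f'=f'])
      show "(f has_field_derivative f' z) (at z within {a..b})" if "z \<in> {a..b}" for z
        using assms(1)[OF that] by (simp add: has_real_derivative_iff_has_vector_derivative)
    qed (use B xy in auto)
    then show "\<bar>f x - f y\<bar> \<le> B * \<bar>x - y\<bar>" by simp
  qed
qed

lemma deriv_chain_vector: "deriv_chain W \<Longrightarrow> (W j has_vector_derivative W (Suc j) x) (at x within S)"
  using deriv_chainD has_real_derivative_iff_has_vector_derivative by blast

lemma deriv_chain_abs_continuous: "deriv_chain W \<Longrightarrow> abs_continuous_on {a..b} (W j)"
  by (rule abs_continuous_on_C1[OF deriv_chain_vector deriv_chain_continuous_on])

lemma abs_continuous_on_sum: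
  fixes n :: nat
  assumes "\<And>i. i < n \<Longrightarrow> abs_continuous_on S (f i)"
  shows "abs_continuous_on S (\<lambda>x. \<Sum>i<n. f i x)"
  using assms
proof (induction n)
  case 0
  show ?case by (rule abs_continuous_on_lipschitz[where C=0]) simp
next
  case (Suc n)
  have "abs_continuous_on S (\<lambda>x. \<Sum>i<n. f i x)" "abs_continuous_on S (f n)" using Suc by simp_all
  then show ?case by (rule abs_continuous_on_combine[where C=1]) simp
qed

text \<open>The alternating sum of F^(r-1-j) W^(j) is absolutely continuous and its derivative
  telescopes, leaving only the first and the last product. \<open>F (r - 1)\<close>, the one factor
  without a classical derivative everywhere, occurs only for j = 0, so the formula fails at most on
  \<open>N\<close>.\<close>

lemma repeated_integration_by_parts:
  assumes r: "0 < r" and ab: "a \<le> b" and N: "negligible N" and W: "deriv_chain W"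
    and F: "\<And>j x. j < r - 1 \<Longrightarrow> x \<in> {a..b} \<Longrightarrow> (F j has_vector_derivative F (Suc j) x) (at x within {a..b})"
    and ac: "abs_continuous_on {a..b} (F (r - 1))"
    and Fr: "\<And>x. x \<in> {a..b} - N \<Longrightarrow> (F (r - 1) has_vector_derivative F r x) (at x within {a..b})"
  shows "((\<lambda>x. F r x * W 0 x - (-1) ^ r * (F 0 x * W r x)) has_integral
    ((\<Sum>j<r. (-1) ^ j * (F (r - 1 - j) b * W j b)) - (\<Sum>j<r. (-1) ^ j * (F (r - 1 - j) a * W j a)))) {a..b}"
proof (rule abs_continuous_on_has_integral[OF _ ab N])
  have "continuous_on {a..b} (F j)" if "j < r" for j
  proof (cases "j = r - 1")
    case True
    then show ?thesis using abs_continuous_on_imp_continuous_on[OF ac] by simp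
  next
    case False
    then have "j < r - 1" using that by simp
    from F[OF this] show ?thesis by (rule continuous_on_vector_derivative)
  qed
  then have acF: "abs_continuous_on {a..b} (F j)" if "j < r" for j
  proof (cases "j = r - 1")
    case True
    then show ?thesis using ac by simp
  next
    case False
    then have "j < r - 1" "Suc j < r" using that by simp_all
    then show ?thesis using \<open>\<And>j. j < r \<Longrightarrow> continuous_on {a..b} (F j)\<close>
      by (intro abs_continuous_on_C1[OF F]) auto
  qed
  show "abs_continuous_on {a..b} (\<lambda>x. \<Sum>j<r. (-1) ^ j * (F (r - 1 - j) x * W j x))"
  proof (rule abs_continuous_on_sum)
    fix j assume "j < r"
    have "abs_continuous_on {a..b} (\<lambda>x. F (r - 1 - j) x * W j x)"
      using r by (intro abs_continuous_on_mult acF deriv_chain_abs_continuous[OF W]) simp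
    then show "abs_continuous_on {a..b} (\<lambda>x. (-1) ^ j * (F (r - 1 - j) x * W j x))"
      by (rule abs_continuous_on_combine[where C=1, OF _ ac])
        (simp add: right_diff_distrib[symmetric] abs_mult)
  qed
next
  fix x assume x: "x \<in> {a..b} - N"
  define T where "T j = (-1) ^ j * (F (r - j) x * W j x)" for j
  have "((\<lambda>x. \<Sum>j<r. (-1) ^ j * (F (r - 1 - j) x * W j x)) has_vector_derivative (\<Sum>j<r. T j - T (Suc j)))
      (at x within {a..b})"
  proof (rule has_vector_derivative_sum)
    fix j assume j: "j \<in> {..<r}"
    have "(F (r - 1 - j) has_vector_derivative F (Suc (r - 1 - j)) x) (at x within {a..b})"
    proof (cases "j = 0")
      case True
      then show ?thesis using Fr[OF x] r by simp
    next
      case False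
      then show ?thesis using F[of "r - 1 - j" x] j x by simp
    qed
    from has_vector_derivative_mult[OF this deriv_chain_vector[OF W, of j x]]
    have "((\<lambda>x. F (r - 1 - j) x * W j x) has_vector_derivative
        F (r - 1 - j) x * W (Suc j) x + F (Suc (r - 1 - j)) x * W j x) (at x within {a..b})" .
    from has_vector_derivative_mult_right[OF this, of "(-1) ^ j"]
    show "((\<lambda>x. (-1) ^ j * (F (r - 1 - j) x * W j x)) has_vector_derivative T j - T (Suc j)) (at x within {a..b})"
      using j unfolding T_def by (simp add: Suc_diff_Suc algebra_simps)
  qed
  also have "(\<Sum>j<r. T j - T (Suc j)) = T 0 - T r" by (rule sum_lessThan_telescope')
  finally show "((\<lambda>x. \<Sum>j<r. (-1) ^ j * (F (r - 1 - j) x * W j x)) has_vector_derivative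
      F r x * W 0 x - (-1) ^ r * (F 0 x * W r x)) (at x within {a..b})"
    unfolding T_def by simp
qed

section \<open>Two-point boundary conditions with a prescribed jump\<close>

text \<open>Energy argument: multiply the equation by d and integrate by parts r times. Every
  boundary term contains some d^(j) with j < r and vanishes, so the integral of \<lambda> d^2 +
  (d^(r))^2 is 0. This forces d^(r) = 0 even for \<lambda> = 0, and the zeros at -1 propagate the
  vanishing down to d.\<close>

lemma homogeneous_bvp_trivial:
  assumes r: "0 < r" and l: "0 \<le> l" and d: "ode_chain (2 * r) ((-1) ^ (r + 1) * l) d"
    and bc: "\<And>j. j < r \<Longrightarrow> d j (-1) = 0" "\<And>j. j < r \<Longrightarrow> d j 1 = 0"
  shows "d j x = 0"
proof -
  have dc: "deriv_chain d" using d unfolding ode_chain_def by blast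
  have d2r: "d (r + r) x = (-1) ^ (r + 1) * l * d 0 x" for x
    using ode_chainD(2)[OF d] by (simp add: mult_2)
  have int: "((\<lambda>x. d (r + r) x * d 0 x - (-1) ^ r * (d (0 + r) x * d r x)) has_integral
    ((\<Sum>j<r. (-1) ^ j * (d (r - 1 - j + r) 1 * d j 1)) - (\<Sum>j<r. (-1) ^ j * (d (r - 1 - j + r) (-1) * d j (-1))))) {-1..1}"
  proof (rule repeated_integration_by_parts[where F="\<lambda>j. d (j + r)" and N="{}" and a="-1" and b=1, OF r _ _ dc])
    have dv: "(d i has_vector_derivative d (Suc i) x) (at x within {- 1..1})" for i x
      by (rule deriv_chain_vector[OF dc])
    show "(d (j + r) has_vector_derivative d (Suc j + r) x) (at x within {- 1..1})" for j x
      using dv by simp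
    show "(d (r - 1 + r) has_vector_derivative d (r + r) x) (at x within {- 1..1})" for x
      using dv[of "r - 1 + r" x] r by simp
    show "abs_continuous_on {-1..1} (d (r - 1 + r))" by (rule deriv_chain_abs_continuous[OF dc])
  qed auto
  \<comment> \<open>The factor (-1)^(r+1) turns the integrand into a sum of nonnegative
    terms.\<close>
  then have "((\<lambda>x. (-1) ^ (r + 1) * (d (r + r) x * d 0 x - (-1) ^ r * (d (0 + r) x * d r x))) has_integral
      (-1) ^ (r + 1) * 0) {-1..1}"
    using bc by (intro has_integral_mult_right) simp
  moreover have "(-1) ^ (r + 1) * (d (r + r) x * d 0 x - (-1) ^ r * (d (0 + r) x * d r x)) = l * (d 0 x)\<^sup>2 + (d r x)\<^sup>2" for x
  proof -
    have s: "(-1) ^ r * (-1) ^ r = (1::real)" by (simp flip: power_mult_distrib)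
    have "(-1) ^ (r + 1) * (d (r + r) x * d 0 x - (-1) ^ r * (d (0 + r) x * d r x))
        = ((-1) ^ r * (-1) ^ r) * (l * (d 0 x * d 0 x) + d r x * d r x)"
      unfolding d2r by (simp add: algebra_simps)
    then show ?thesis unfolding s by (simp add: power2_eq_square)
  qed
  ultimately have I: "((\<lambda>x. l * (d 0 x)\<^sup>2 + (d r x)\<^sup>2) has_integral 0) (cbox (-1) 1)" by simp
  have dr: "d r x = 0" if "x \<in> {-1..1}" for x
  proof -
    have "l * (d 0 x)\<^sup>2 + (d r x)\<^sup>2 = 0"
      by (rule has_integral_0_cbox_imp_0[OF _ _ I])
        (use l that in \<open>auto intro!: continuous_intros deriv_chain_continuous_on[OF dc]\<close>)
    then show ?thesis using l by (simp add: add_nonneg_eq_0_iff)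
  qed
  have "\<forall>x\<in>{-1..1}. d (r - i) x = 0" if "i \<le> r" for i
    using that
  proof (induction i)
    case 0
    then show ?case using dr by simp
  next
    case (Suc i)
    have S: "Suc (r - Suc i) = r - i" using Suc by simp
    have "(d (r - Suc i) has_field_derivative 0) (at x within {-1..1})" if "x \<in> {-1..1}" for x
      using deriv_chainD[OF dc, of "r - Suc i" x "{-1..1}"] Suc that unfolding S by simp
    from has_field_derivative_zero_constant[OF _ this]
    obtain c where "\<forall>x\<in>{-1..1}. d (r - Suc i) x = c" by auto
    moreover have "d (r - Suc i) (-1) = 0" using bc(1) Suc by simp
    ultimately show ?case by force
  qed
  from this[of r] have d0: "\<forall>x\<in>{-1..1}. d 0 x = 0" by simp
  have dj: "\<forall>x\<in>{-1<..<1}. d j x = 0" for j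
  proof (induction j)
    case 0
    then show ?case using d0 by auto
  next
    case (Suc j)
    show ?case
    proof
      fix x :: real assume x: "x \<in> {-1<..<1}"
      have "((\<lambda>x. 0) has_real_derivative d (Suc j) x) (at x)"
        by (rule has_field_derivative_transform_within_open[OF deriv_chainD[OF dc, of j x UNIV] _ x]) (use Suc in auto)
      then show "d (Suc j) x = 0" using DERIV_unique DERIV_const by blast
    qed
  qed
  \<comment> \<open>Vanishing on (-1,1) is carried to the whole line and to all orders by uniqueness
    of the initial value problem at 0.\<close>
  have "ode_chain (2 * r) ((-1) ^ (r + 1) * l) (\<lambda>j x. 0)" unfolding ode_chain_def by (simp add: deriv_chain_zero)
  from ode_chain_unique[OF _ d this, of 0] show ?thesis using dj r by auto
qed

text \<open>With a fundamental system \<open>e\<close> normalised at t, the jump conditions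
  determine the right branch from the left one: add \<sigma> times the member of index r-k-1. There
  remain 2r boundary conditions for the 2r coefficients of the left branch. A kernel vector would be
  one solution on the whole line with all boundary zeros.\<close>

lemma jump_bvp_exists:
  assumes r: "0 < r" and k: "k < r" and l: "0 \<le> l"
  obtains wL wR where "ode_chain (2 * r) ((-1) ^ (r + 1) * l) wL" "ode_chain (2 * r) ((-1) ^ (r + 1) * l) wR"
    "\<And>j. j < r \<Longrightarrow> wL j (-1) = 0" "\<And>j. j < r \<Longrightarrow> wR j 1 = 0"
    "\<And>j. j < 2 * r \<Longrightarrow> wR j t - wL j t = (-1) ^ (k + 1) * (if j = r - k - 1 then 1 else 0)"
proof -
  let ?n = "2 * r" and ?\<kappa> = "(-1) ^ (r + 1) * l"
  have n: "0 < ?n" using r by simp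
  have "\<forall>i. \<exists>y. ode_chain ?n ?\<kappa> y \<and> (\<forall>j<?n. y j 0 = (if i = j then 1 else 0))"
  proof
    fix i
    show "\<exists>y. ode_chain ?n ?\<kappa> y \<and> (\<forall>j<?n. y j 0 = (if i = j then 1 else 0))"
      using ode_chain_exists[OF n, of ?\<kappa> "\<lambda>j. if i = j then 1 else 0"] by metis
  qed
  then obtain e where e: "\<And>i. ode_chain ?n ?\<kappa> (e i)" "\<And>i j. j < ?n \<Longrightarrow> e i j 0 = (if i = j then 1 else 0)" by metis
  define y where "y a j x = (\<Sum>i<?n. a i * e i j (x - t))" for a :: "nat \<Rightarrow> real" and j x
  have y: "ode_chain ?n ?\<kappa> (y a)" for a
    unfolding y_def by (intro ode_chain_sum ode_chain_cmult ode_chain_translate e)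
  have yt: "y a j t = a j" if "j < ?n" for a j
  proof -
    have "y a j t = (\<Sum>i<?n. if i = j then a i else 0)"
      unfolding y_def by (rule sum.cong) (use that e(2) in auto)
    then show ?thesis using that by simp
  qed
  \<comment> \<open>The first r rows express the conditions at -1, the last r those at 1.\<close>
  define M where "M s i = (if s < r then e i s (-1 - t) else e i (s - r) (1 - t))" for s i
  define \<sigma> :: real where "\<sigma> = (-1) ^ (k + 1)"
  have M: "(\<Sum>i<?n. M s i * a i) = (if s < r then y a s (-1) else y a (s - r) 1)" for s a
    unfolding M_def y_def by (simp add: mult.commute)
  obtain a where a: "\<And>s. s < ?n \<Longrightarrow> (\<Sum>i<?n. M s i * a i) = (if s < r then 0 else - \<sigma> * e (r - k - 1) (s - r) (1 - t))"
  proof (rule square_system_solvable[of ?n M "\<lambda>s. if s < r then 0 else - \<sigma> * e (r - k - 1) (s - r) (1 - t)"])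
    fix a i assume z: "\<And>s. s < ?n \<Longrightarrow> (\<Sum>i<?n. M s i * a i) = 0" and i: "i < ?n"
    have "y a i t = 0"
    proof (rule homogeneous_bvp_trivial[OF r l y])
      show "y a j (-1) = 0" if "j < r" for j using z[of j] that unfolding M by simp
      show "y a j 1 = 0" if "j < r" for j using z[of "j + r"] that unfolding M by simp
    qed
    then show "a i = 0" using yt[OF i] by simp
  qed blast
  define wR where "wR j x = y a j x + \<sigma> * e (r - k - 1) j (x - t)" for j x
  show ?thesis
  proof (rule that[of "y a" wR])
    show "ode_chain ?n ?\<kappa> (y a)" by (rule y)
    show "ode_chain ?n ?\<kappa> wR"
      unfolding wR_def by (intro ode_chain_add y ode_chain_cmult ode_chain_translate e)
    show "y a j (-1) = 0" if "j < r" for j using a[of j] that unfolding M by simp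
    show "wR j 1 = 0" if "j < r" for j using a[of "j + r"] that unfolding M wR_def by simp
    show "wR j t - y a j t = (-1) ^ (k + 1) * (if j = r - k - 1 then 1 else 0)" if "j < 2 * r" for j
      using e(2)[OF that, of "r - k - 1"] unfolding wR_def \<sigma>_def by auto
  qed
qed

text \<open>The difference of two solutions has no jump at t, so its two branches share their
  initial values there and are one global solution with homogeneous boundary values.\<close>

lemma jump_bvp_unique:
  assumes r: "0 < r" and l: "0 \<le> l"
    and w: "ode_chain (2 * r) ((-1) ^ (r + 1) * l) wL" "ode_chain (2 * r) ((-1) ^ (r + 1) * l) wR"
    and v: "ode_chain (2 * r) ((-1) ^ (r + 1) * l) vL" "ode_chain (2 * r) ((-1) ^ (r + 1) * l) vR"
    and bc: "\<And>j. j < r \<Longrightarrow> wL j (-1) = vL j (-1)" "\<And>j. j < r \<Longrightarrow> wR j 1 = vR j 1"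
    and jump: "\<And>j. j < 2 * r \<Longrightarrow> wR j t - wL j t = vR j t - vL j t"
  shows "wL j x = vL j x" "wR j x = vR j x"
proof -
  define dL where "dL j x = wL j x - vL j x" for j x
  define dR where "dR j x = wR j x - vR j x" for j x
  have c: "ode_chain (2 * r) ((-1) ^ (r + 1) * l) dL" "ode_chain (2 * r) ((-1) ^ (r + 1) * l) dR"
    unfolding dL_def dR_def by (intro ode_chain_diff w v)+
  have eq: "dL j x = dR j x" for j x
    by (rule ode_chain_unique[OF _ c, of t]) (use r jump in \<open>auto simp: dL_def dR_def algebra_simps\<close>)
  have "dL j x = 0" for j x
  proof (rule homogeneous_bvp_trivial[OF r l c(1)])
    show "dL j (-1) = 0" if "j < r" for j using bc(1)[OF that] unfolding dL_def by simp
    show "dL j 1 = 0" if "j < r" for j unfolding eq using bc(2)[OF that] unfolding dR_def by simp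
  qed
  then show "wL j x = vL j x" "wR j x = vR j x" using eq unfolding dL_def dR_def by (metis eq_iff_diff_eq_0)+
qed

section \<open>Square-integrable functions\<close>

definition L2_inner :: "real set \<Rightarrow> (real \<Rightarrow> real) \<Rightarrow> (real \<Rightarrow> real) \<Rightarrow> real" where
  "L2_inner S f g = (LINT x|lebesgue_on S. f x * g x)"

lemma L2_fun_mult_integrable:
  assumes "f \<in> L2_fun S" "g \<in> L2_fun S"
  shows "integrable (lebesgue_on S) (\<lambda>x. f x * g x)"
proof (rule Bochner_Integration.integrable_bound)
  show "integrable (lebesgue_on S) (\<lambda>x. \<bar>f x\<bar>\<^sup>2 + \<bar>g x\<bar>\<^sup>2)" using assms unfolding L2_fun_def by auto
  show "(\<lambda>x. f x * g x) \<in> borel_measurable (lebesgue_on S)" using assms unfolding L2_fun_def by auto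
  have "\<bar>a * b\<bar> \<le> a\<^sup>2 + b\<^sup>2" for a b :: real
  proof -
    have "2 * (\<bar>a\<bar> * \<bar>b\<bar>) \<le> a\<^sup>2 + b\<^sup>2" using sum_squares_bound[of "\<bar>a\<bar>" "\<bar>b\<bar>"] by (simp add: mult.assoc)
    moreover have "0 \<le> \<bar>a\<bar> * \<bar>b\<bar>" by simp
    ultimately show ?thesis unfolding abs_mult by linarith
  qed
  then show "AE x in lebesgue_on S. norm (f x * g x) \<le> norm (\<bar>f x\<bar>\<^sup>2 + \<bar>g x\<bar>\<^sup>2)" by simp
qed

lemma L2_fun_add: "f \<in> L2_fun S \<Longrightarrow> g \<in> L2_fun S \<Longrightarrow> (\<lambda>x. f x + g x) \<in> L2_fun S"
  using L2_fun_mult_integrable[of f S g]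
  unfolding L2_fun_def by (auto simp: power2_sum mult.assoc)

lemma L2_fun_cmult: "f \<in> L2_fun S \<Longrightarrow> (\<lambda>x. c * f x) \<in> L2_fun S"
  unfolding L2_fun_def by (auto simp: power_mult_distrib)

lemma L2_fun_diff: "f \<in> L2_fun S \<Longrightarrow> g \<in> L2_fun S \<Longrightarrow> (\<lambda>x. f x - g x) \<in> L2_fun S"
  using L2_fun_add[of f S "\<lambda>x. (-1) * g x"] L2_fun_cmult[of g S "-1"] by simp

lemma L2_inner_commute: "L2_inner S f g = L2_inner S g f"
  unfolding L2_inner_def by (simp add: mult.commute)

lemma L2_inner_add_left:
  "f \<in> L2_fun S \<Longrightarrow> g \<in> L2_fun S \<Longrightarrow> h \<in> L2_fun S \<Longrightarrow>
    L2_inner S (\<lambda>x. f x + g x) h = L2_inner S f h + L2_inner S g h"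
  unfolding L2_inner_def by (simp add: distrib_right L2_fun_mult_integrable)

lemma L2_inner_diff_left:
  "f \<in> L2_fun S \<Longrightarrow> g \<in> L2_fun S \<Longrightarrow> h \<in> L2_fun S \<Longrightarrow>
    L2_inner S (\<lambda>x. f x - g x) h = L2_inner S f h - L2_inner S g h"
  unfolding L2_inner_def by (simp add: left_diff_distrib L2_fun_mult_integrable)

lemma L2_inner_cmult_left: "L2_inner S (\<lambda>x. c * f x) h = c * L2_inner S f h"
  unfolding L2_inner_def by (simp add: mult.assoc)

lemma L2_inner_add_right:
  "f \<in> L2_fun S \<Longrightarrow> g \<in> L2_fun S \<Longrightarrow> h \<in> L2_fun S \<Longrightarrow>
    L2_inner S h (\<lambda>x. f x + g x) = L2_inner S h f + L2_inner S h g"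
  unfolding L2_inner_def by (simp add: distrib_left L2_fun_mult_integrable)

lemma L2_inner_diff_right:
  "f \<in> L2_fun S \<Longrightarrow> g \<in> L2_fun S \<Longrightarrow> h \<in> L2_fun S \<Longrightarrow>
    L2_inner S h (\<lambda>x. f x - g x) = L2_inner S h f - L2_inner S h g"
  unfolding L2_inner_def by (simp add: right_diff_distrib L2_fun_mult_integrable)

lemma L2_inner_cmult_right: "L2_inner S h (\<lambda>x. c * f x) = c * L2_inner S h f"
  unfolding L2_inner_commute[of S h] by (rule L2_inner_cmult_left)

lemma L2_inner_self_nonneg: "0 \<le> L2_inner S f f"
  unfolding L2_inner_def by (simp add: integral_nonneg_AE)

lemma L2_norm_power2: "(L2_norm S f)\<^sup>2 = L2_inner S f f"
  using L2_inner_self_nonneg[of S f] unfolding L2_norm_def L2_inner_def by (simp add: power2_eq_square)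

lemma L2_norm_nonneg: "0 \<le> L2_norm S f"
  unfolding L2_norm_def by (simp add: integral_nonneg_AE)

lemma L2_norm_cmult: "L2_norm S (\<lambda>x. c * f x) = \<bar>c\<bar> * L2_norm S f"
proof -
  have "(L2_norm S (\<lambda>x. c * f x))\<^sup>2 = (\<bar>c\<bar> * L2_norm S f)\<^sup>2"
    unfolding L2_norm_power2 power_mult_distrib
    by (simp add: L2_inner_cmult_left L2_inner_cmult_right power2_eq_square)
  then show ?thesis using L2_norm_nonneg by (simp add: power2_eq_iff_nonneg)
qed

text \<open>The squared norm of f + s g is a nonnegative polynomial in s. For c > 0 it is evaluated
  at its minimum s = -b/c; for c = 0 it is linear, and a nonzero slope would allow the value
  -1.\<close>

lemma L2_inner_Cauchy_Schwarz:
  assumes f: "f \<in> L2_fun S" and g: "g \<in> L2_fun S"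
  shows "\<bar>L2_inner S f g\<bar> \<le> L2_norm S f * L2_norm S g"
proof -
  define a b c where "a = L2_inner S f f" and "b = L2_inner S f g" and "c = L2_inner S g g"
  have quad: "0 \<le> a + 2 * s * b + s\<^sup>2 * c" for s
  proof -
    have sg: "(\<lambda>x. s * g x) \<in> L2_fun S" by (rule L2_fun_cmult[OF g])
    have fs: "(\<lambda>x. f x + s * g x) \<in> L2_fun S" by (rule L2_fun_add[OF f sg])
    have "L2_inner S (\<lambda>x. f x + s * g x) (\<lambda>x. f x + s * g x) = a + 2 * s * b + s\<^sup>2 * c"
      unfolding L2_inner_add_left[OF f sg fs] L2_inner_add_right[OF f sg f] L2_inner_add_right[OF f sg g] L2_inner_add_right[OF f sg sg]
        L2_inner_cmult_left L2_inner_cmult_right a_def b_def c_def L2_inner_commute[of S g f]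
      by (simp add: power2_eq_square algebra_simps)
    then show ?thesis using L2_inner_self_nonneg by metis
  qed
  have nn: "0 \<le> a" "0 \<le> c" unfolding a_def c_def by (rule L2_inner_self_nonneg)+
  have "b\<^sup>2 \<le> a * c"
  proof (cases "c = 0")
    case True
    have "b = 0"
    proof (rule ccontr)
      assume "b \<noteq> 0"
      then have "a + 2 * (- (a + 1) / (2 * b)) * b = -1" by (simp add: field_simps)
      then show False using quad[of "- (a + 1) / (2 * b)"] True by simp
    qed
    then show ?thesis using nn by simp
  next
    case False
    then have "a + 2 * (- b / c) * b + (- b / c)\<^sup>2 * c = a - b\<^sup>2 / c" by (simp add: field_simps power2_eq_square)
    then have "b\<^sup>2 / c \<le> a" using quad[of "- b / c"] by simp
    then show ?thesis using False nn by (simp add: pos_divide_le_eq)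
  qed
  then have "\<bar>b\<bar>\<^sup>2 \<le> (L2_norm S f * L2_norm S g)\<^sup>2"
    unfolding power_mult_distrib L2_norm_power2 a_def c_def by simp
  then show ?thesis unfolding b_def using L2_norm_nonneg
    by (meson mult_nonneg_nonneg power2_le_imp_le)
qed

section \<open>Changes on null sets and piecewise functions\<close>

lemma lebesgue_on_spike:
  fixes f g :: "real \<Rightarrow> real"
  assumes S: "S \<in> sets lebesgue" and N: "negligible N" and fg: "\<And>x. x \<in> S - N \<Longrightarrow> g x = f x"
  shows "AE x in lebesgue_on S. f x = g x"
    and "f \<in> borel_measurable (lebesgue_on S) \<Longrightarrow> g \<in> borel_measurable (lebesgue_on S)"
proof -
  have N0: "N \<in> null_sets lebesgue" using N negligible_iff_null_sets by blast
  have 1: "AE x in lebesgue. x \<in> S \<longrightarrow> f x = g x"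
    using AE_not_in[OF N0] by eventually_elim (use fg in auto)
  then show "AE x in lebesgue_on S. f x = g x"
    using S by (simp add: AE_restrict_space_iff)
  assume f: "f \<in> borel_measurable (lebesgue_on S)"
  have "(\<lambda>x. if x \<in> S then f x else 0) \<in> borel_measurable lebesgue"
    using f S by (simp add: borel_measurable_if)
  moreover have "AE x in lebesgue. (if x \<in> S then f x else 0) = (if x \<in> S then g x else 0)"
    using 1 by eventually_elim simp
  ultimately have "(\<lambda>x. if x \<in> S then g x else 0) \<in> borel_measurable lebesgue"
    by (rule borel_measurable_AE)
  then show "g \<in> borel_measurable (lebesgue_on S)" using S by (simp add: borel_measurable_if)
qed

lemma L2_fun_spike:
  assumes S: "S \<in> sets lebesgue" and N: "negligible N" and fg: "\<And>x. x \<in> S - N \<Longrightarrow> g x = f x"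
    and f: "f \<in> L2_fun S"
  shows "g \<in> L2_fun S" "L2_inner S g h = L2_inner S f h" "L2_norm S g = L2_norm S f"
proof -
  have ae: "AE x in lebesgue_on S. f x = g x" by (rule lebesgue_on_spike(1)[OF S N]) (rule fg)
  have fm: "f \<in> borel_measurable (lebesgue_on S)" using f unfolding L2_fun_def by blast
  have gm: "g \<in> borel_measurable (lebesgue_on S)" by (rule lebesgue_on_spike(2)[OF S N _ fm]) (rule fg)
  have ae2: "AE x in lebesgue_on S. \<bar>f x\<bar>\<^sup>2 = \<bar>g x\<bar>\<^sup>2" using ae by eventually_elim simp
  have "integrable (lebesgue_on S) (\<lambda>x. \<bar>g x\<bar>\<^sup>2)"
    using f unfolding L2_fun_def by (intro integrable_cong_AE_imp[OF _ _ ae2]) (use gm in auto)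
  then show "g \<in> L2_fun S" using gm unfolding L2_fun_def by blast
  show "L2_norm S g = L2_norm S f"
    unfolding L2_norm_def using integral_cong_AE[OF _ _ ae2] fm gm by simp
  have aeh: "AE x in lebesgue_on S. g x * h x = f x * h x" using ae by eventually_elim simp
  show "L2_inner S g h = L2_inner S f h"
  proof (cases "(\<lambda>x. f x * h x) \<in> borel_measurable (lebesgue_on S)")
    case True
    have "(\<lambda>x. g x * h x) \<in> borel_measurable (lebesgue_on S)"
      by (rule lebesgue_on_spike(2)[OF S N _ True]) (use fg in auto)
    then show ?thesis unfolding L2_inner_def by (rule integral_cong_AE[OF _ True aeh])
  next
    \<comment> \<open>As \<open>h\<close> is arbitrary, the product may fail to be measurable. It
      then fails for both functions, and both integrals have the default value 0.\<close>
    case False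
    have "(\<lambda>x. g x * h x) \<notin> borel_measurable (lebesgue_on S)"
    proof
      assume "(\<lambda>x. g x * h x) \<in> borel_measurable (lebesgue_on S)"
      from lebesgue_on_spike(2)[OF S N _ this, of "\<lambda>x. f x * h x"] have "(\<lambda>x. f x * h x) \<in> borel_measurable (lebesgue_on S)"
        using fg by simp
      then show False using False by blast
    qed
    then have "\<not> integrable (lebesgue_on S) (\<lambda>x. g x * h x)" "\<not> integrable (lebesgue_on S) (\<lambda>x. f x * h x)"
      using False borel_measurable_integrable by auto
    then show ?thesis unfolding L2_inner_def by (simp add: not_integrable_integral_eq)
  qed
qed

text \<open>Both branches live on the whole line, so the one-sided limits at t are simply
  \<open>p t\<close> and \<open>q t\<close>. The value at t itself is taken from the right
  branch.\<close>

definition glue :: "real \<Rightarrow> (real \<Rightarrow> real) \<Rightarrow> (real \<Rightarrow> real) \<Rightarrow> real \<Rightarrow> real" where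
  "glue t p q x = (if x < t then p x else q x)"

lemma glue_bounded:
  assumes "continuous_on UNIV p" "continuous_on UNIV q"
  shows "\<exists>B. \<forall>x\<in>{a..b}. \<bar>glue t p q x\<bar> \<le> B"
proof -
  have "bounded (p ` {a..b})" "bounded (q ` {a..b})"
    using assms by (auto intro!: compact_imp_bounded compact_continuous_image intro: continuous_on_subset)
  then obtain A B where A: "\<And>x. x \<in> {a..b} \<Longrightarrow> \<bar>p x\<bar> \<le> A" and B: "\<And>x. x \<in> {a..b} \<Longrightarrow> \<bar>q x\<bar> \<le> B"
    unfolding bounded_real by blast
  have "\<bar>glue t p q x\<bar> \<le> max A B" if "x \<in> {a..b}" for x
    using A[OF that] B[OF that] unfolding glue_def by auto
  then show ?thesis by blast
qed

lemma glue_L2_fun: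
  assumes p: "continuous_on UNIV p" and q: "continuous_on UNIV q"
    and S: "S \<in> sets lebesgue" "S \<subseteq> {a..b}"
  shows "glue t p q \<in> L2_fun S"
proof -
  have "p \<in> borel_measurable borel" "q \<in> borel_measurable borel"
    using p q by (auto intro: borel_measurable_continuous_onI)
  then have "glue t p q \<in> borel_measurable borel" unfolding glue_def by measurable
  then have "glue t p q \<in> borel_measurable lborel" by simp
  then have m: "glue t p q \<in> borel_measurable (lebesgue_on S)"
    by (intro measurable_restrict_space1 measurable_completion)
  obtain B where "\<forall>x\<in>{a..b}. \<bar>glue t p q x\<bar> \<le> B" using glue_bounded[OF p q, of a b t] by blast
  then have B: "\<And>x. x \<in> S \<Longrightarrow> \<bar>glue t p q x\<bar> \<le> B" using S(2) by auto
  interpret finite_measure "lebesgue_on S"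
  proof (rule finite_measureI)
    have "S \<in> lmeasurable" using fmeasurableI2[OF lmeasurable_cbox[of a b], of S] S by simp
    then have "emeasure lebesgue S \<noteq> \<infinity>" using fmeasurableD2 by fastforce
    then show "emeasure (lebesgue_on S) (space (lebesgue_on S)) \<noteq> \<infinity>"
      using S(1) by (simp add: emeasure_restrict_space space_restrict_space)
  qed
  have "integrable (lebesgue_on S) (\<lambda>x. \<bar>glue t p q x\<bar>\<^sup>2)"
  proof (rule integrable_const_bound[where B="B\<^sup>2"])
    show "AE x in lebesgue_on S. norm (\<bar>glue t p q x\<bar>\<^sup>2) \<le> B\<^sup>2"
    proof (rule AE_I2)
      fix x assume "x \<in> space (lebesgue_on S)"
      then have "\<bar>glue t p q x\<bar> \<le> B" using B by (simp add: space_restrict_space)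
      then have "\<bar>glue t p q x\<bar>\<^sup>2 \<le> B\<^sup>2" by (intro power_mono) auto
      then show "norm (\<bar>glue t p q x\<bar>\<^sup>2) \<le> B\<^sup>2" by simp
    qed
  qed (use m in measurable)
  then show ?thesis using m unfolding L2_fun_def by blast
qed

section \<open>Functions glued at a point\<close>

lemma nth_deriv_0 [simp]: "nth_deriv S 0 f = f"
  unfolding nth_deriv_def by simp

lemma nth_deriv_Suc: "nth_deriv S (Suc n) f x = vector_derivative (nth_deriv S n f) (at x within S)"
  unfolding nth_deriv_def by simp

text \<open>Links chains to the iterated \<open>vector_derivative\<close>: since no point of
  \<open>S\<close> is isolated in it, derivatives within \<open>S\<close> are unique, and the
  iteration must follow the chain as long as the chain differentiates.\<close>

lemma nth_deriv_chain:
  assumes G: "\<And>j x. j < m \<Longrightarrow> x \<in> S \<Longrightarrow> (G j has_vector_derivative G (Suc j) x) (at x within S)"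
    and S: "\<And>x. x \<in> S \<Longrightarrow> at x within S \<noteq> bot" and f: "\<And>x. x \<in> S \<Longrightarrow> f x = G 0 x"
    and j: "j \<le> m" and x: "x \<in> S"
  shows "nth_deriv S j f x = G j x"
  using j x
proof (induction j arbitrary: x)
  case 0
  then show ?case using f by simp
next
  case (Suc j)
  have "(nth_deriv S j f has_vector_derivative G (Suc j) x) (at x within S)"
    by (rule has_vector_derivative_transform[OF Suc.prems(2) _ G]) (use Suc in auto)
  then show ?case unfolding nth_deriv_Suc using S Suc.prems vector_derivative_within by blast
qed

lemma at_within_open_interval_nontrivial: "x \<in> {a<..<b::real} \<Longrightarrow> at x within {a<..<b} \<noteq> bot"
proof -
  assume "x \<in> {a<..<b}"
  then have "at x within {a<..<b} = at x" by (intro at_within_open) auto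
  then show ?thesis by simp
qed

lemma at_within_II_nontrivial: "x \<in> II \<Longrightarrow> at x within II \<noteq> bot"
proof -
  assume x: "x \<in> II"
  have "1 \<in> II" "-1 \<in> II" by auto
  then have "II \<noteq> {x}" by (metis equal_neg_zero one_neq_zero singletonD)
  then have "x islimpt II" using x by (intro connected_imp_perfect) auto
  then show ?thesis by (simp add: trivial_limit_within)
qed

lemma glue_has_derivative_off:
  assumes "deriv_chain p" "deriv_chain q" "x \<noteq> t"
  shows "(glue t (p j) (q j) has_real_derivative glue t (p (Suc j)) (q (Suc j)) x) (at x)"
proof (cases "x < t")
  case True
  have "(glue t (p j) (q j) has_real_derivative p (Suc j) x) (at x)"
    by (rule has_field_derivative_transform_within_open[of "p j" _ x "{..<t}"])
      (use True deriv_chainD[OF assms(1)] in \<open>auto simp: glue_def\<close>)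
  then show ?thesis using True by (simp add: glue_def)
next
  case False
  then have "t < x" using assms(3) by simp
  have "(glue t (p j) (q j) has_real_derivative q (Suc j) x) (at x)"
    by (rule has_field_derivative_transform_within_open[of "q j" _ x "{t<..}"])
      (use \<open>t < x\<close> deriv_chainD[OF assms(2)] in \<open>auto simp: glue_def\<close>)
  then show ?thesis using False by (simp add: glue_def)
qed

text \<open>At t the left and right difference quotients are those of the two branches. Agreement at
  order j gives them a common base value, agreement at order j+1 a common limit.\<close>

lemma glue_has_derivative:
  assumes p: "deriv_chain p" and q: "deriv_chain q"
    and "p j t = q j t" "p (Suc j) t = q (Suc j) t"
  shows "(glue t (p j) (q j) has_real_derivative glue t (p (Suc j)) (q (Suc j)) x) (at x)"
proof (cases "x = t")
  case True
  have "((\<lambda>y. (p j y - p j t) / (y - t)) \<longlongrightarrow> p (Suc j) t) (at_left t)"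
    using deriv_chainD[OF p, of j t] unfolding has_field_derivative_iff .
  then have "((\<lambda>y. (p j y - q j t) / (y - t)) \<longlongrightarrow> q (Suc j) t) (at_left t)"
    unfolding assms(3,4) .
  then have 1: "((\<lambda>y. (glue t (p j) (q j) y - q j t) / (y - t)) \<longlongrightarrow> q (Suc j) t) (at_left t)"
    by (rule Lim_transform_eventually) (auto simp: eventually_at_filter glue_def)
  have "((\<lambda>y. (q j y - q j t) / (y - t)) \<longlongrightarrow> q (Suc j) t) (at_right t)"
    using deriv_chainD[OF q, of j t] unfolding has_field_derivative_iff .
  then have 2: "((\<lambda>y. (glue t (p j) (q j) y - q j t) / (y - t)) \<longlongrightarrow> q (Suc j) t) (at_right t)"
    by (rule Lim_transform_eventually) (auto simp: eventually_at_filter glue_def)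
  have "((\<lambda>y. (glue t (p j) (q j) y - q j t) / (y - t)) \<longlongrightarrow> q (Suc j) t) (at t)"
    by (rule filterlim_split_at_real[OF 1 2])
  then show ?thesis unfolding True has_field_derivative_iff by (simp add: glue_def)
qed (rule glue_has_derivative_off[OF p q])

text \<open>Each branch is frozen at its value at t beyond t, which makes it Lipschitz on [a,b]. The
  glued function is the sum of the two frozen branches minus the common value, so intervals that
  straddle t need no separate treatment.\<close>

lemma glue_abs_continuous:
  assumes p: "deriv_chain p" and q: "deriv_chain q" and eq: "p j t = q j t"
  shows "abs_continuous_on {a..b} (glue t (p j) (q j))"
proof -
  let ?P = "\<lambda>x. p j (min x t)" and ?Q = "\<lambda>x. q j (max x t)"
  have L: "\<exists>C. \<forall>x\<in>{u..v}. \<forall>y\<in>{u..v}. \<bar>w j x - w j y\<bar> \<le> C * \<bar>x - y\<bar>" if w: "deriv_chain w" for w u v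
  proof -
    have "bounded (w (Suc j) ` {u..v})"
      using deriv_chain_continuous_on[OF w] by (intro compact_imp_bounded compact_continuous_image) auto
    then obtain B where B: "\<And>x. x \<in> {u..v} \<Longrightarrow> norm (w (Suc j) x) \<le> B" unfolding bounded_iff by blast
    have "norm (w j x - w j y) \<le> B * norm (x - y)" if "x \<in> {u..v}" "y \<in> {u..v}" for x y
      by (rule field_differentiable_bound[where S="{u..v}" and f'="w (Suc j)"])
        (use deriv_chainD[OF w] B that in auto)
    then show ?thesis unfolding real_norm_def by blast
  qed
  obtain C where C: "\<And>x y. x \<in> {min a t..max b t} \<Longrightarrow> y \<in> {min a t..max b t} \<Longrightarrow> \<bar>p j x - p j y\<bar> \<le> C * \<bar>x - y\<bar>"
    using L[OF p, of "min a t" "max b t"] by blast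
  obtain D where D: "\<And>x y. x \<in> {min a t..max b t} \<Longrightarrow> y \<in> {min a t..max b t} \<Longrightarrow> \<bar>q j x - q j y\<bar> \<le> D * \<bar>x - y\<bar>"
    using L[OF q, of "min a t" "max b t"] by blast
  have P: "abs_continuous_on {a..b} ?P"
  proof (rule abs_continuous_on_lipschitz[where C="\<bar>C\<bar>"])
    fix x y assume "x \<in> {a..b}" "y \<in> {a..b}"
    then have "\<bar>p j (min x t) - p j (min y t)\<bar> \<le> C * \<bar>min x t - min y t\<bar>" by (intro C) auto
    also have "\<dots> \<le> \<bar>C\<bar> * \<bar>x - y\<bar>" by (intro mult_mono) auto
    finally show "\<bar>p j (min x t) - p j (min y t)\<bar> \<le> \<bar>C\<bar> * \<bar>x - y\<bar>" .
  qed
  have Q: "abs_continuous_on {a..b} ?Q"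
  proof (rule abs_continuous_on_lipschitz[where C="\<bar>D\<bar>"])
    fix x y assume "x \<in> {a..b}" "y \<in> {a..b}"
    then have "\<bar>q j (max x t) - q j (max y t)\<bar> \<le> D * \<bar>max x t - max y t\<bar>" by (intro D) auto
    also have "\<dots> \<le> \<bar>D\<bar> * \<bar>x - y\<bar>" by (intro mult_mono) auto
    finally show "\<bar>q j (max x t) - q j (max y t)\<bar> \<le> \<bar>D\<bar> * \<bar>x - y\<bar>" .
  qed
  have g: "glue t (p j) (q j) x = ?P x + ?Q x - q j t" for x
    using eq by (cases "x < t") (auto simp: glue_def min_def max_def)
  show ?thesis
  proof (rule abs_continuous_on_combine[OF P Q, where C=1])
    show "\<bar>glue t (p j) (q j) x - glue t (p j) (q j) y\<bar> \<le> 1 * \<bar>?P x - ?P y\<bar> + 1 * \<bar>?Q x - ?Q y\<bar>" for x y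
    proof -
      have "glue t (p j) (q j) x - glue t (p j) (q j) y = (?P x - ?P y) + (?Q x - ?Q y)" by (simp add: g)
      then show ?thesis using abs_triangle_ineq[of "?P x - ?P y" "?Q x - ?Q y"] by simp
    qed
  qed
qed

lemma abs_continuous_on_cong:
  assumes "abs_continuous_on S f" "\<And>x. x \<in> S \<Longrightarrow> g x = f x"
  shows "abs_continuous_on S g"
  by (rule abs_continuous_on_combine[OF assms(1) assms(1), where C=1]) (simp add: assms(2))

text \<open>Agreement at t at all orders below r makes order r-1 absolutely continuous. Order r may
  still jump at t; a single point does not matter in the square-integrable sense, which is why the
  last claim omits it.\<close>

lemma glue_sobolev:
  assumes r: "0 < r" and t: "-1 < t" "t < 1" and p: "deriv_chain p" and q: "deriv_chain q"
    and eq: "\<And>j. j < r \<Longrightarrow> p j t = q j t"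
  shows "glue t (p 0) (q 0) \<in> L2_sobolev II r"
    and "\<And>j x. j < r \<Longrightarrow> x \<in> II \<Longrightarrow> nth_deriv II j (glue t (p 0) (q 0)) x = glue t (p j) (q j) x"
    and "\<And>x. x \<in> II - {t} \<Longrightarrow> nth_deriv II r (glue t (p 0) (q 0)) x = glue t (p r) (q r) x"
proof -
  let ?f = "glue t (p 0) (q 0)"
  have G: "(glue t (p j) (q j) has_vector_derivative glue t (p (Suc j)) (q (Suc j)) x) (at x within II)"
    if "j < r - 1" for j x
    using glue_has_derivative[OF p q, of j t x] that eq
    by (simp add: has_real_derivative_iff_has_vector_derivative has_vector_derivative_at_within)
  have nd: "nth_deriv II j ?f x = glue t (p j) (q j) x" if "j < r" "x \<in> II" for j x
    by (rule nth_deriv_chain[where m="r - 1" and G="\<lambda>j. glue t (p j) (q j)", OF G at_within_II_nontrivial])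
      (use that in auto)
  then show "\<And>j x. j < r \<Longrightarrow> x \<in> II \<Longrightarrow> nth_deriv II j ?f x = glue t (p j) (q j) x" .
  have ndr: "nth_deriv II r ?f x = glue t (p r) (q r) x" if x: "x \<in> II - {t}" for x
  proof -
    have "(glue t (p (r - 1)) (q (r - 1)) has_vector_derivative glue t (p r) (q r) x) (at x within II)"
      using glue_has_derivative_off[OF p q, of x t "r - 1"] x r
      by (simp add: has_real_derivative_iff_has_vector_derivative has_vector_derivative_at_within)
    then have "(nth_deriv II (r - 1) ?f has_vector_derivative glue t (p r) (q r) x) (at x within II)"
      by (rule has_vector_derivative_transform[rotated 2]) (use x nd r in auto)
    then have "vector_derivative (nth_deriv II (r - 1) ?f) (at x within II) = glue t (p r) (q r) x"
      using x at_within_II_nontrivial vector_derivative_within by blast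
    then show ?thesis using nth_deriv_Suc[of II "r - 1" ?f x] r by simp
  qed
  then show "\<And>x. x \<in> II - {t} \<Longrightarrow> nth_deriv II r ?f x = glue t (p r) (q r) x" .
  show "?f \<in> L2_sobolev II r"
    unfolding L2_sobolev_def mem_Collect_eq
  proof (intro conjI allI impI ballI)
    fix j x assume j: "j < r - 1" and x: "x \<in> II"
    have "(nth_deriv II j ?f has_vector_derivative glue t (p (Suc j)) (q (Suc j)) x) (at x within II)"
      by (rule has_vector_derivative_transform[OF x _ G[OF j]]) (use nd j in auto)
    then show "nth_deriv II j ?f differentiable (at x within II)" by (rule differentiableI_vector)
  next
    show "abs_continuous_on II (nth_deriv II (r - 1) ?f)"
      by (rule abs_continuous_on_cong[OF glue_abs_continuous[OF p q, of "r - 1" t]]) (use nd r eq in auto)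
    show "nth_deriv II r ?f \<in> L2_fun II"
      by (rule L2_fun_spike(1)[where N="{t}" and f="glue t (p r) (q r)"])
        (use ndr glue_L2_fun[OF deriv_chain_continuous_on[OF p] deriv_chain_continuous_on[OF q], of II "-1" 1] in auto)
  qed
qed

section \<open>Representation of the derivative\<close>

text \<open>At order r the definition provides only the value of \<open>vector_derivative\<close>.
  Almost everywhere differentiability of the absolutely continuous order r-1 shows that this value
  is a genuine derivative off a null set, as integration by parts requires.\<close>

lemma sobolev_derivatives:
  assumes r: "0 < r" and f: "f \<in> L2_sobolev II r"
  shows "\<And>j x. j < r - 1 \<Longrightarrow> x \<in> II \<Longrightarrow>
      (nth_deriv II j f has_vector_derivative nth_deriv II (Suc j) f x) (at x within II)"
    and "\<exists>N. negligible N \<and> (\<forall>x\<in>II - N.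
      (nth_deriv II (r - 1) f has_vector_derivative nth_deriv II r f x) (at x within II))"
    and "abs_continuous_on II (nth_deriv II (r - 1) f)"
    and "nth_deriv II r f \<in> L2_fun II" and "f \<in> L2_fun II"
proof -
  show d: "\<And>j x. j < r - 1 \<Longrightarrow> x \<in> II \<Longrightarrow>
      (nth_deriv II j f has_vector_derivative nth_deriv II (Suc j) f x) (at x within II)"
    using f unfolding L2_sobolev_def nth_deriv_Suc by (simp flip: vector_derivative_works)
  show ac: "abs_continuous_on II (nth_deriv II (r - 1) f)" and "nth_deriv II r f \<in> L2_fun II"
    using f unfolding L2_sobolev_def by blast+
  obtain N where N: "negligible N"
    "\<And>x. x \<in> II - N \<Longrightarrow> -1 < x \<and> x < 1 \<and> nth_deriv II (r - 1) f differentiable (at x)"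
    using abs_continuous_on_differentiable_ae[OF ac] by metis
  have "(nth_deriv II (r - 1) f has_vector_derivative nth_deriv II r f x) (at x within II)" if x: "x \<in> II - N" for x
  proof -
    have "nth_deriv II (r - 1) f differentiable (at x within II)"
      using N(2)[OF x] differentiable_at_withinI by blast
    then show ?thesis using nth_deriv_Suc[of II "r - 1" f x] r by (simp flip: vector_derivative_works)
  qed
  then show "\<exists>N. negligible N \<and> (\<forall>x\<in>II - N.
      (nth_deriv II (r - 1) f has_vector_derivative nth_deriv II r f x) (at x within II))" using N(1) by blast
  have c: "continuous_on II f"
  proof (cases "r = 1")
    case True
    then show ?thesis using abs_continuous_on_imp_continuous_on[OF ac] by simp
  next
    case False
    then have "0 < r - 1" using r by simp
    then have "\<And>x. x \<in> II \<Longrightarrow> (nth_deriv II 0 f has_vector_derivative nth_deriv II (Suc 0) f x) (at x within II)"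
      by (rule d)
    then have "continuous_on II (nth_deriv II 0 f)" by (rule continuous_on_vector_derivative)
    then show ?thesis by simp
  qed
  have m: "f \<in> borel_measurable (lebesgue_on II)"
    using c by (intro continuous_imp_measurable_on_sets_lebesgue) auto
  have "continuous_on II (\<lambda>x. \<bar>f x\<bar>\<^sup>2)" using c by (intro continuous_intros)
  then have "integrable (lebesgue_on II) (\<lambda>x. \<bar>f x\<bar>\<^sup>2)" by (rule continuous_imp_integrable_real)
  then show "f \<in> L2_fun II" using m unfolding L2_fun_def by blast
qed

text \<open>Exactly what the representation formula uses of u: zeros and jumps at orders below r,
  and no equation. Besides the solutions for all \<lambda>, it admits the competitors in the energy
  minimisation.\<close>

definition admissible :: "nat \<Rightarrow> nat \<Rightarrow> real \<Rightarrow> (nat \<Rightarrow> real \<Rightarrow> real) \<Rightarrow> (nat \<Rightarrow> real \<Rightarrow> real) \<Rightarrow> bool" where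
  "admissible r k t wL wR \<longleftrightarrow> deriv_chain wL \<and> deriv_chain wR \<and>
    (\<forall>j<r. wL j (-1) = 0 \<and> wR j 1 = 0 \<and>
      wR j t - wL j t = (-1) ^ (k + 1) * (if j = r - k - 1 then 1 else 0))"

lemma glue_chain_L2: "deriv_chain p \<Longrightarrow> deriv_chain q \<Longrightarrow> glue t (p i) (q j) \<in> L2_fun II"
  by (rule glue_L2_fun[where a="-1" and b=1]) (auto intro: deriv_chain_continuous_on)

text \<open>At t the boundary terms combine into jumps, of which only the one at j = r-k-1 survives,
  paired with f^(k)(t). Its sign (-1)^(r-k-1) (-1)^(k+1) = (-1)^r is free of k; this is the purpose
  of the sign in the jump condition.\<close>

lemma derivative_representation:
  assumes r: "0 < r" and k: "k < r" and t: "-1 < t" "t < 1" and w: "admissible r k t wL wR"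
    and f: "f \<in> L2_sobolev II r"
  shows "nth_deriv II k f t = L2_inner II f (glue t (wL r) (wR r))
    - (-1) ^ r * L2_inner II (nth_deriv II r f) (glue t (wL 0) (wR 0))"
proof -
  define F where "F j = nth_deriv II j f" for j
  have wc: "deriv_chain wL" "deriv_chain wR" and bc: "\<And>j. j < r \<Longrightarrow> wL j (-1) = 0" "\<And>j. j < r \<Longrightarrow> wR j 1 = 0"
    and jump: "\<And>j. j < r \<Longrightarrow> wR j t - wL j t = (-1) ^ (k + 1) * (if j = r - k - 1 then 1 else 0)"
    using w unfolding admissible_def by blast+
  note sd = sobolev_derivatives[OF r f, folded F_def]
  obtain N where N: "negligible N" "\<And>x. x \<in> II - N \<Longrightarrow> (F (r - 1) has_vector_derivative F r x) (at x within II)"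
    using sd(2) by blast
  define H where "H x = F r x * glue t (wL 0) (wR 0) x - (-1) ^ r * (F 0 x * glue t (wL r) (wR r) x)" for x
  have parts: "((\<lambda>x. F r x * W 0 x - (-1) ^ r * (F 0 x * W r x)) has_integral
    ((\<Sum>j<r. (-1) ^ j * (F (r - 1 - j) b * W j b)) - (\<Sum>j<r. (-1) ^ j * (F (r - 1 - j) a * W j a)))) {a..b}"
    if "deriv_chain W" "a \<le> b" "{a..b} \<subseteq> II" for W a b
  proof (rule repeated_integration_by_parts[OF r that(2) N(1) that(1)])
    show "(F j has_vector_derivative F (Suc j) x) (at x within {a..b})" if "j < r - 1" "x \<in> {a..b}" for j x
      by (rule has_vector_derivative_within_subset[OF sd(1)]) (use that \<open>{a..b} \<subseteq> II\<close> in auto)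
    show "abs_continuous_on {a..b} (F (r - 1))" using sd(3) that(3) by (rule abs_continuous_on_subset)
    show "(F (r - 1) has_vector_derivative F r x) (at x within {a..b})" if "x \<in> {a..b} - N" for x
      by (rule has_vector_derivative_within_subset[OF N(2)]) (use that \<open>{a..b} \<subseteq> II\<close> in auto)
  qed
  have "((\<lambda>x. F r x * wL 0 x - (-1) ^ r * (F 0 x * wL r x)) has_integral
      (\<Sum>j<r. (-1) ^ j * (F (r - 1 - j) t * wL j t))) {-1..t}"
    using parts[OF wc(1), of "-1" t] t bc(1) by simp
  then have HL: "(H has_integral (\<Sum>j<r. (-1) ^ j * (F (r - 1 - j) t * wL j t))) {-1..t}"
    by (rule has_integral_spike_finite[of "{t}", rotated 2]) (auto simp: H_def glue_def)
  have "((\<lambda>x. F r x * wR 0 x - (-1) ^ r * (F 0 x * wR r x)) has_integral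
      - (\<Sum>j<r. (-1) ^ j * (F (r - 1 - j) t * wR j t))) {t..1}"
    using parts[OF wc(2), of t 1] t bc(2) by simp
  then have HR: "(H has_integral - (\<Sum>j<r. (-1) ^ j * (F (r - 1 - j) t * wR j t))) {t..1}"
    by (rule has_integral_spike_finite[of "{t}", rotated 2]) (auto simp: H_def glue_def)
  have "(\<Sum>j<r. (-1) ^ j * (F (r - 1 - j) t * wL j t)) + - (\<Sum>j<r. (-1) ^ j * (F (r - 1 - j) t * wR j t))
      = (\<Sum>j<r. - ((-1) ^ j * F (r - 1 - j) t * (wR j t - wL j t)))"
    unfolding sum_negf[symmetric] sum.distrib[symmetric] by (rule sum.cong) (auto simp: algebra_simps)
  also have "\<dots> = (\<Sum>j<r. if j = r - k - 1 then - ((-1) ^ (r - k - 1) * (-1) ^ (k + 1)) * F k t else 0)"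
  proof (rule sum.cong)
    fix j assume "j \<in> {..<r}"
    then show "- ((-1) ^ j * F (r - 1 - j) t * (wR j t - wL j t))
        = (if j = r - k - 1 then - ((-1) ^ (r - k - 1) * (-1) ^ (k + 1)) * F k t else 0)"
      using jump[of j] k by auto
  qed simp
  also have "\<dots> = - ((-1) ^ r) * F k t"
  proof -
    have "(-1) ^ (r - k - 1) * (-1) ^ (k + 1) = ((-1) ^ (r - k - 1 + (k + 1)) :: real)" by (rule power_add[symmetric])
    also have "r - k - 1 + (k + 1) = r" using k by simp
    finally show ?thesis using r k by simp
  qed
  finally have H1: "(H has_integral - ((-1) ^ r) * F k t) II"
    using has_integral_combine[OF _ _ HL HR] t by simp
  have g: "glue t (wL 0) (wR 0) \<in> L2_fun II" "glue t (wL r) (wR r) \<in> L2_fun II" by (intro glue_chain_L2 wc)+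
  have F0: "F 0 = f" unfolding F_def by simp
  note i1 = L2_fun_mult_integrable[OF sd(4) g(1)] and i2 = L2_fun_mult_integrable[OF sd(5) g(2)]
  have Hi: "integrable (lebesgue_on II) H" unfolding H_def F0 by (intro Bochner_Integration.integrable_diff integrable_mult_right i1 i2)
  have "integral\<^sup>L (lebesgue_on II) H = L2_inner II (F r) (glue t (wL 0) (wR 0)) - (-1) ^ r * L2_inner II f (glue t (wL r) (wR r))"
    unfolding H_def L2_inner_def F0 using i1 i2 by simp
  moreover have "integral\<^sup>L (lebesgue_on II) H = - ((-1) ^ r) * F k t"
    using has_integral_unique[OF has_integral_integral_lebesgue_on[OF Hi] H1] by simp
  ultimately have "(-1) ^ r * F k t = (-1) ^ r * L2_inner II f (glue t (wL r) (wR r)) - L2_inner II (F r) (glue t (wL 0) (wR 0))"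
    by simp
  then have "(-1) ^ r * ((-1) ^ r * F k t) = (-1) ^ r * ((-1) ^ r * L2_inner II f (glue t (wL r) (wR r)) - L2_inner II (F r) (glue t (wL 0) (wR 0)))"
    by (rule arg_cong)
  moreover have s: "(-1) ^ r * ((-1) ^ r * y) = y" for y :: real by (simp flip: power_mult_distrib mult.assoc)
  ultimately have "F k t = L2_inner II f (glue t (wL r) (wR r)) - (-1) ^ r * L2_inner II (F r) (glue t (wL 0) (wR 0))"
    unfolding right_diff_distrib s by simp
  then show ?thesis unfolding F_def .
qed

section \<open>From the boundary value problem to pairs of global branches\<close>

text \<open>In \<open>bvp_solution\<close> the Sobolev clauses use derivatives relative to each
  half, the other clauses derivatives relative to the punctured interval. On open sets both are the
  ordinary derivatives.\<close>

lemma nth_deriv_open_subset: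
  assumes "open S" "open T" "S \<subseteq> T" "x \<in> S"
  shows "nth_deriv S j f x = nth_deriv T j f x"
  using assms(4)
proof (induction j arbitrary: x)
  case (Suc j)
  have "x \<in> T" using Suc.prems assms(3) by blast
  have "vector_derivative (nth_deriv S j f) (at x) = vector_derivative (nth_deriv T j f) (at x)"
    by (rule vector_derivative_cong_eq)
      (use Suc assms(1) in \<open>auto simp: eventually_nhds intro!: exI[of _ S]\<close>)
  then show ?case unfolding nth_deriv_Suc
    using at_within_open[OF Suc.prems assms(1)] at_within_open[OF \<open>x \<in> T\<close> assms(2)] by simp
qed simp

lemma deriv_chain_sobolev_open:
  assumes w: "deriv_chain w" and u: "\<And>x. x \<in> {a<..<b} \<Longrightarrow> u x = w 0 x"
  shows "u \<in> L2_sobolev {a<..<b} m"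
proof -
  have nd: "nth_deriv {a<..<b} j u x = w j x" if "x \<in> {a<..<b}" for j x
    by (rule nth_deriv_chain[where m=j and G=w, OF deriv_chain_vector[OF w] at_within_open_interval_nontrivial])
      (use that u in auto)
  show ?thesis
    unfolding L2_sobolev_def mem_Collect_eq
  proof (intro conjI allI impI ballI)
    fix j x assume x: "x \<in> {a<..<b}"
    have "(nth_deriv {a<..<b} j u has_vector_derivative w (Suc j) x) (at x within {a<..<b})"
      by (rule has_vector_derivative_transform[OF x _ deriv_chain_vector[OF w]]) (use nd in auto)
    then show "nth_deriv {a<..<b} j u differentiable (at x within {a<..<b})" by (rule differentiableI_vector)
  next
    have "abs_continuous_on {a<..<b} (w (m - 1))"
      using deriv_chain_abs_continuous[OF w, of a b] by (rule abs_continuous_on_subset) auto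
    then show "abs_continuous_on {a<..<b} (nth_deriv {a<..<b} (m - 1) u)"
      by (rule abs_continuous_on_cong) (use nd in auto)
    have "glue a (w m) (w m) \<in> L2_fun {a<..<b}"
      by (rule glue_L2_fun[where a=a and b=b]) (auto intro: deriv_chain_continuous_on[OF w])
    then show "nth_deriv {a<..<b} m u \<in> L2_fun {a<..<b}"
      by (rule L2_fun_spike(1)[where N="{}", rotated 3]) (use nd in \<open>auto simp: glue_def\<close>)
  qed
qed

lemma punctured_open: "open (punctured t)"
  by (intro open_Un) auto

lemma punctured_glue_derivatives:
  assumes t: "-1 < t" "t < 1" and w: "deriv_chain wL" "deriv_chain wR"
    and u: "\<And>x. x \<in> punctured t \<Longrightarrow> u x = glue t (wL 0) (wR 0) x"
    and x: "x \<in> punctured t"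
  shows "nth_deriv (punctured t) j u x = glue t (wL j) (wR j) x"
    and "(nth_deriv (punctured t) j u has_vector_derivative glue t (wL (Suc j)) (wR (Suc j)) x) (at x)"
proof -
  let ?P = "punctured t"
  have atP: "at x within ?P = at x" if "x \<in> ?P" for x by (rule at_within_open[OF that punctured_open])
  have d: "(glue t (wL j) (wR j) has_vector_derivative glue t (wL (Suc j)) (wR (Suc j)) x) (at x)"
    if "x \<in> ?P" for j x
    using glue_has_derivative_off[OF w, of x t j] that
    by (auto simp: has_real_derivative_iff_has_vector_derivative)
  have nd: "nth_deriv ?P j u x = glue t (wL j) (wR j) x" if "x \<in> ?P" for j x
  proof (rule nth_deriv_chain[where m=j and G="\<lambda>j. glue t (wL j) (wR j)"])
    show "(glue t (wL i) (wR i) has_vector_derivative glue t (wL (Suc i)) (wR (Suc i)) x) (at x within ?P)"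
      if "x \<in> ?P" for i x using d[OF that] atP[OF that] by simp
    show "at x within ?P \<noteq> bot" if "x \<in> ?P" for x using atP[OF that] by simp
  qed (use that u in auto)
  then show "nth_deriv ?P j u x = glue t (wL j) (wR j) x" using x .
  have "(nth_deriv ?P j u has_vector_derivative glue t (wL (Suc j)) (wR (Suc j)) x) (at x within ?P)"
    by (rule has_vector_derivative_transform[OF x nd]) (use d[OF x] atP[OF x] in auto)
  then show "(nth_deriv ?P j u has_vector_derivative glue t (wL (Suc j)) (wR (Suc j)) x) (at x)"
    using atP[OF x] by simp
qed

lemma glue_tendsto:
  assumes t: "-1 < t" "t < 1" and w: "deriv_chain wL" "deriv_chain wR"
    and v: "\<And>x. x \<in> punctured t \<Longrightarrow> v x = glue t (wL j) (wR j) x"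
  shows "(v \<longlongrightarrow> wL j (-1)) (at_right (-1))" "(v \<longlongrightarrow> wL j t) (at_left t)"
    "(v \<longlongrightarrow> wR j t) (at_right t)" "(v \<longlongrightarrow> wR j 1) (at_left 1)"
proof -
  have c: "(wL j \<longlongrightarrow> wL j x) (at x within S)" "(wR j \<longlongrightarrow> wR j x) (at x within S)" for x S
    using DERIV_continuous[OF deriv_chainD[OF w(1)]] DERIV_continuous[OF deriv_chainD[OF w(2)]]
    unfolding continuous_within by blast+
  have "\<forall>\<^sub>F x in at_right (-1). wL j x = v x"
    using eventually_at_right_real[OF t(1)] by eventually_elim (use v in \<open>auto simp: glue_def\<close>)
  then show "(v \<longlongrightarrow> wL j (-1)) (at_right (-1))" by (rule Lim_transform_eventually[OF c(1)])
  have "\<forall>\<^sub>F x in at_left t. wL j x = v x"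
    using eventually_at_left_real[OF t(1)] by eventually_elim (use v in \<open>auto simp: glue_def\<close>)
  then show "(v \<longlongrightarrow> wL j t) (at_left t)" by (rule Lim_transform_eventually[OF c(1)])
  have "\<forall>\<^sub>F x in at_right t. wR j x = v x"
    using eventually_at_right_real[OF t(2)] by eventually_elim (use v in \<open>auto simp: glue_def\<close>)
  then show "(v \<longlongrightarrow> wR j t) (at_right t)" by (rule Lim_transform_eventually[OF c(2)])
  have "\<forall>\<^sub>F x in at_left 1. wR j x = v x"
    using eventually_at_left_real[OF t(2)] by eventually_elim (use v in \<open>auto simp: glue_def\<close>)
  then show "(v \<longlongrightarrow> wR j 1) (at_left 1)" by (rule Lim_transform_eventually[OF c(2)])
qed

text \<open>The problem for two branches continued beyond t to the whole line as solutions, so that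
  the limits in the original conditions are values of the branches.\<close>

definition bvp_chains :: "nat \<Rightarrow> nat \<Rightarrow> real \<Rightarrow> real \<Rightarrow> (nat \<Rightarrow> real \<Rightarrow> real) \<Rightarrow> (nat \<Rightarrow> real \<Rightarrow> real) \<Rightarrow> bool" where
  "bvp_chains r k l t wL wR \<longleftrightarrow>
    ode_chain (2 * r) ((-1) ^ (r + 1) * l) wL \<and> ode_chain (2 * r) ((-1) ^ (r + 1) * l) wR \<and>
    (\<forall>j<r. wL j (-1) = 0 \<and> wR j 1 = 0) \<and>
    (\<forall>j<2 * r. wR j t - wL j t = (-1) ^ (k + 1) * (if j = r - k - 1 then 1 else 0))"

lemma bvp_chains_solution:
  assumes r: "0 < r" and t: "-1 < t" "t < 1" and w: "bvp_chains r k l t wL wR"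
    and u: "\<And>x. x \<in> punctured t \<Longrightarrow> u x = glue t (wL 0) (wR 0) x"
  shows "bvp_solution r k l t u"
proof -
  let ?P = "punctured t"
  have o: "ode_chain (2 * r) ((-1) ^ (r + 1) * l) wL" "ode_chain (2 * r) ((-1) ^ (r + 1) * l) wR"
    and bc: "\<And>j. j < r \<Longrightarrow> wL j (-1) = 0" "\<And>j. j < r \<Longrightarrow> wR j 1 = 0"
    and jump: "\<And>j. j < 2 * r \<Longrightarrow> wR j t - wL j t = (-1) ^ (k + 1) * (if j = r - k - 1 then 1 else 0)"
    using w unfolding bvp_chains_def by blast+
  have c: "deriv_chain wL" "deriv_chain wR" using o unfolding ode_chain_def by blast+
  note nd = punctured_glue_derivatives[OF t c u]
  note lim = glue_tendsto[OF t c nd(1)]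
  show ?thesis
    unfolding bvp_solution_def
  proof (intro conjI ballI allI impI)
    show "u \<in> L2_sobolev {-1<..<t} (2 * r)"
      by (rule deriv_chain_sobolev_open[OF c(1)]) (use u in \<open>auto simp: glue_def\<close>)
    show "u \<in> L2_sobolev {t<..<1} (2 * r)"
      by (rule deriv_chain_sobolev_open[OF c(2)]) (use u in \<open>auto simp: glue_def\<close>)
  next
    fix x assume x: "x \<in> ?P"
    show "nth_deriv ?P (2 * r - 1) u differentiable (at x)"
      by (rule differentiableI_vector[OF nd(2)]) (use x in auto)
    have "nth_deriv ?P (2 * r) u x = (-1) ^ (r + 1) * l * glue t (wL 0) (wR 0) x"
      using nd(1)[OF _ x, of "2 * r"] ode_chainD(2)[OF o(1)] ode_chainD(2)[OF o(2)] by (simp add: glue_def)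
    moreover have "u x = glue t (wL 0) (wR 0) x" using u x .
    moreover have "(-1) ^ r * ((-1) ^ (r + 1) * l * y) = - (l * y)" for y :: real
      by (simp flip: power_mult_distrib mult.assoc)
    ultimately show "(-1) ^ r * nth_deriv ?P (2 * r) u x + l * u x = 0" by simp
  next
    fix s assume "s < r"
    then show "(nth_deriv ?P s u \<longlongrightarrow> 0) (at_right (-1))" "(nth_deriv ?P s u \<longlongrightarrow> 0) (at_left 1)"
      using lim(1,4)[of s] bc by simp_all
  next
    fix s assume "s < 2 * r"
    then show "\<exists>p q. (nth_deriv ?P s u \<longlongrightarrow> p) (at_right t) \<and> (nth_deriv ?P s u \<longlongrightarrow> q) (at_left t) \<and>
        p - q = (-1) ^ (k + 1) * (if s = r - k - 1 then 1 else 0)"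
      using lim(2,3)[of s] jump by blast
  qed
qed

lemma bvp_solution_chains:
  assumes r: "0 < r" and t: "-1 < t" "t < 1" and u: "bvp_solution r k l t u"
  obtains wL wR where "bvp_chains r k l t wL wR" "\<And>x. x \<in> punctured t \<Longrightarrow> u x = glue t (wL 0) (wR 0) x"
proof -
  let ?P = "punctured t" and ?\<kappa> = "(-1) ^ (r + 1) * l"
  let ?y = "\<lambda>j. nth_deriv ?P j u"
  have sob: "u \<in> L2_sobolev {-1<..<t} (2 * r)" "u \<in> L2_sobolev {t<..<1} (2 * r)"
    and top: "\<And>x. x \<in> ?P \<Longrightarrow> ?y (2 * r - 1) differentiable (at x)"
    and ode: "\<And>x. x \<in> ?P \<Longrightarrow> (-1) ^ r * ?y (2 * r) x + l * u x = 0"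
    and bl: "\<And>s. s < r \<Longrightarrow> (?y s \<longlongrightarrow> 0) (at_right (-1))" and br: "\<And>s. s < r \<Longrightarrow> (?y s \<longlongrightarrow> 0) (at_left 1)"
    and jump: "\<And>s. s < 2 * r \<Longrightarrow> \<exists>p q. (?y s \<longlongrightarrow> p) (at_right t) \<and> (?y s \<longlongrightarrow> q) (at_left t) \<and>
        p - q = (-1) ^ (k + 1) * (if s = r - k - 1 then 1 else 0)"
    using u unfolding bvp_solution_def by blast+
  have der: "(?y j has_real_derivative ?y (Suc j) x) (at x)"
    if S: "u \<in> L2_sobolev S (2 * r)" "open S" "S \<subseteq> ?P" and j: "j < 2 * r" and x: "x \<in> S" for S j x
  proof -
    have atP: "at x within ?P = at x" using x S(3) by (intro at_within_open[OF _ punctured_open]) auto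
    have "?y j differentiable (at x)"
    \<comment> \<open>The Sobolev clause gives classical derivatives only below order 2r-1. At that
      order it gives absolute continuity, and differentiability comes from the explicit clause of
      \<open>bvp_solution\<close>.\<close>
    proof (cases "j = 2 * r - 1")
      case True
      then show ?thesis using top x S(3) by auto
    next
      case False
      then have "nth_deriv S j u differentiable (at x within S)" using S(1) j x unfolding L2_sobolev_def by simp
      then have "nth_deriv S j u differentiable (at x)" using at_within_open[OF x S(2)] by simp
      then obtain D where D: "(nth_deriv S j u has_vector_derivative D) (at x)"
        using vector_derivative_works by blast
      have "(?y j has_vector_derivative D) (at x)"
        by (rule has_vector_derivative_transform_within_open[OF D S(2) x])
          (rule nth_deriv_open_subset[OF S(2) punctured_open S(3)])
      then show ?thesis by (rule differentiableI_vector)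
    qed
    then show ?thesis unfolding nth_deriv_Suc has_real_derivative_iff_has_vector_derivative atP
      by (simp flip: vector_derivative_works)
  qed
  have yn: "?y (2 * r) x = ?\<kappa> * ?y 0 x" if "x \<in> ?P" for x
  proof -
    have s: "(-1) ^ r * ((-1) ^ r * y) = y" for y :: real by (simp flip: power_mult_distrib mult.assoc)
    have "(-1) ^ r * ?y (2 * r) x = - (l * u x)" using ode[OF that] by linarith
    then have "(-1) ^ r * ((-1) ^ r * ?y (2 * r) x) = (-1) ^ r * (- (l * u x))" by simp
    then show ?thesis unfolding s by simp
  qed
  have n: "0 < 2 * r" using r by simp
  obtain wL where wL: "ode_chain (2 * r) ?\<kappa> wL" "\<And>j x. j \<le> 2 * r \<Longrightarrow> x \<in> {-1<..<t} \<Longrightarrow> ?y j x = wL j x"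
  proof (rule ode_local_solution_extends[OF n, of "{-1<..<t}" ?y ?\<kappa>])
    show "(?y j has_real_derivative ?y (Suc j) x) (at x)" if "j < 2 * r" "x \<in> {-1<..<t}" for j x
      by (rule der[OF sob(1)]) (use that in auto)
    show "?y (2 * r) x = ?\<kappa> * ?y 0 x" if "x \<in> {-1<..<t}" for x by (rule yn) (use that in auto)
  qed auto
  obtain wR where wR: "ode_chain (2 * r) ?\<kappa> wR" "\<And>j x. j \<le> 2 * r \<Longrightarrow> x \<in> {t<..<1} \<Longrightarrow> ?y j x = wR j x"
  proof (rule ode_local_solution_extends[OF n, of "{t<..<1}" ?y ?\<kappa>])
    show "(?y j has_real_derivative ?y (Suc j) x) (at x)" if "j < 2 * r" "x \<in> {t<..<1}" for j x
      by (rule der[OF sob(2)]) (use that in auto)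
    show "?y (2 * r) x = ?\<kappa> * ?y 0 x" if "x \<in> {t<..<1}" for x by (rule yn) (use that in auto)
  qed auto
  have y: "?y j x = glue t (wL j) (wR j) x" if "j \<le> 2 * r" "x \<in> ?P" for j x
    using wL(2)[OF that(1), of x] wR(2)[OF that(1), of x] that(2) by (auto simp: glue_def)
  have c: "deriv_chain wL" "deriv_chain wR" using wL(1) wR(1) unfolding ode_chain_def by blast+
  note lim = glue_tendsto[OF t c y]
  have "wL j (-1) = 0 \<and> wR j 1 = 0" if j: "j < r" for j
  proof -
    have "j \<le> 2 * r" using j by simp
    note l = lim[OF this]
    have "wL j (-1) = 0" by (rule tendsto_unique[OF _ l(1) bl[OF j]]) simp_all
    moreover have "wR j 1 = 0" by (rule tendsto_unique[OF _ l(4) br[OF j]]) simp_all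
    ultimately show ?thesis ..
  qed
  moreover have "wR j t - wL j t = (-1) ^ (k + 1) * (if j = r - k - 1 then 1 else 0)" if j: "j < 2 * r" for j
  proof -
    obtain p q where pq: "(?y j \<longlongrightarrow> p) (at_right t)" "(?y j \<longlongrightarrow> q) (at_left t)"
        "p - q = (-1) ^ (k + 1) * (if j = r - k - 1 then 1 else 0)" using jump[OF j] by blast
    have "j \<le> 2 * r" using j by simp
    note l = lim[OF this]
    have "wL j t = q" by (rule tendsto_unique[OF _ l(2) pq(2)]) simp_all
    moreover have "wR j t = p" by (rule tendsto_unique[OF _ l(3) pq(1)]) simp_all
    ultimately show ?thesis using pq(3) by simp
  qed
  ultimately have "bvp_chains r k l t wL wR" unfolding bvp_chains_def using wL(1) wR(1) by blast
  then show ?thesis using that y[of 0] by simp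
qed

lemma bvp_chains_unique:
  assumes r: "0 < r" and l: "0 \<le> l" and w: "bvp_chains r k l t wL wR" and v: "bvp_chains r k l t vL vR"
  shows "wL = vL \<and> wR = vR"
proof -
  note W = w[unfolded bvp_chains_def] and V = v[unfolded bvp_chains_def]
  have o: "ode_chain (2 * r) ((-1) ^ (r + 1) * l) wL" "ode_chain (2 * r) ((-1) ^ (r + 1) * l) wR"
    "ode_chain (2 * r) ((-1) ^ (r + 1) * l) vL" "ode_chain (2 * r) ((-1) ^ (r + 1) * l) vR"
    using W V by blast+
  have bL: "wL j (-1) = vL j (-1)" and bR: "wR j 1 = vR j 1" if "j < r" for j using W V that by simp_all
  have j: "wR j t - wL j t = vR j t - vL j t" if "j < 2 * r" for j using W V that by simp
  have "wL j x = vL j x" "wR j x = vR j x" for j x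
    by (rule jump_bvp_unique[OF r l o bL bR j]; assumption)+
  then show ?thesis by (simp_all add: fun_eq_iff)
qed

text \<open>Any two solutions come from pairs of branches, which coincide by uniqueness; hence the
  definite description denotes the glued function.\<close>

lemma u_fun_eq:
  assumes r: "0 < r" and l: "0 \<le> l" and t: "-1 < t" "t < 1" and w: "bvp_chains r k l t wL wR"
  shows "u_fun r k l t = (\<lambda>x. if x \<in> punctured t then glue t (wL 0) (wR 0) x else 0)" (is "_ = ?u")
  unfolding u_fun_def
proof (rule the_equality)
  show "bvp_solution r k l t ?u \<and> (\<forall>x. x \<notin> punctured t \<longrightarrow> ?u x = 0)"
    using bvp_chains_solution[OF r t w, of ?u] by simp
next
  fix u assume u: "bvp_solution r k l t u \<and> (\<forall>x. x \<notin> punctured t \<longrightarrow> u x = 0)"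
  obtain vL vR where v: "bvp_chains r k l t vL vR" "\<And>x. x \<in> punctured t \<Longrightarrow> u x = glue t (vL 0) (vR 0) x"
    using bvp_solution_chains[OF r t conjunct1[OF u]] by blast
  have "wL = vL" "wR = vR" using bvp_chains_unique[OF r l w v(1)] by blast+
  then show "u = ?u" using u v(2) by (intro ext) simp
qed

lemma u_fun_norms:
  assumes r: "0 < r" and l: "0 \<le> l" and t: "-1 < t" "t < 1" and w: "bvp_chains r k l t wL wR"
  shows "L2_norm II (u_fun r k l t) = L2_norm II (glue t (wL 0) (wR 0))"
    and "L2_norm II (nth_deriv (punctured t) r (u_fun r k l t)) = L2_norm II (glue t (wL r) (wR r))"
proof -
  note ue = u_fun_eq[OF assms]
  have c: "deriv_chain wL" "deriv_chain wR" using w unfolding bvp_chains_def ode_chain_def by blast+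
  show "L2_norm II (u_fun r k l t) = L2_norm II (glue t (wL 0) (wR 0))"
    by (rule L2_fun_spike(3)[where N="{-1, t, 1}", OF _ _ _ glue_chain_L2[OF c]]) (auto simp: ue)
  have "nth_deriv (punctured t) r (u_fun r k l t) x = glue t (wL r) (wR r) x" if x: "x \<in> II - {-1, t, 1}" for x
  proof -
    have "x \<in> punctured t" using x by auto
    then show ?thesis by (rule punctured_glue_derivatives(1)[OF t c, rotated]) (simp add: ue)
  qed
  then show "L2_norm II (nth_deriv (punctured t) r (u_fun r k l t)) = L2_norm II (glue t (wL r) (wR r))"
    by (intro L2_fun_spike(3)[where N="{-1, t, 1}", OF _ _ _ glue_chain_L2[OF c]]) simp_all
qed

section \<open>Dependence on the parameter\<close>

lemma bvp_chains_exist: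
  assumes "0 < r" "k < r" "0 \<le> l"
  obtains wL wR where "bvp_chains r k l t wL wR"
  using jump_bvp_exists[OF assms, of t] unfolding bvp_chains_def by metis

lemma bvp_chains_admissible:
  assumes "bvp_chains r k l t wL wR"
  shows "admissible r k t wL wR"
  using assms unfolding bvp_chains_def admissible_def ode_chain_def by simp

lemma admissible_L2:
  assumes "admissible r k t wL wR"
  shows "glue t (wL i) (wR j) \<in> L2_fun II"
  using assms unfolding admissible_def by (intro glue_chain_L2) auto

text \<open>The summand \<open>s * glue t (p 0) (q 0)\<close> matters only for \<open>\<lambda> = 0\<close>, where the \<open>r\<close>-th derivative of \<open>u\<^bsup>(r)\<^esup>\<close>
  vanishes.\<close>

lemma extremal_family:
  assumes r: "0 < r" and k: "k < r" and t: "-1 < t" "t < 1" and w: "bvp_chains r k l t wL wR"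
    and p: "deriv_chain p" "\<And>j. p (j + r) = wL j" "\<And>j. j < r \<Longrightarrow> p j t = 0"
    and q: "deriv_chain q" "\<And>j. q (j + r) = wR j" "\<And>j. j < r \<Longrightarrow> q j t = 0"
  defines "f \<equiv> \<lambda>c s x. c * glue t (wL r) (wR r) x + s * glue t (p 0) (q 0) x"
    and "\<kappa> \<equiv> (-1) ^ (r + 1) * l"
  shows "f c s \<in> L2_sobolev II r"
    and "x \<in> II - {t} \<Longrightarrow> nth_deriv II r (f c s) x = (c * \<kappa> + s) * glue t (wL 0) (wR 0) x"
proof -
  note W = w[unfolded bvp_chains_def, folded \<kappa>_def]
  have o: "ode_chain (2 * r) \<kappa> wL" "ode_chain (2 * r) \<kappa> wR" using W by blast+
  have wc: "deriv_chain wL" "deriv_chain wR" using o unfolding ode_chain_def by blast+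
  define P where "P j x = c * wL (j + r) x + s * p j x" for j x
  define Q where "Q j x = c * wR (j + r) x + s * q j x" for j x
  have fe: "f c s = glue t (P 0) (Q 0)" unfolding f_def P_def Q_def glue_def by auto
  have PQ: "deriv_chain P" "deriv_chain Q" unfolding P_def Q_def
    by (intro deriv_chain_add deriv_chain_cmult deriv_chain_shift[of _ r] wc p q)+
  have eq: "P j t = Q j t" if "j < r" for j
  proof -
    \<comment> \<open>The order j + r is above r-k-1, where the jump sits, and below 2r.\<close>
    have "wR (j + r) t - wL (j + r) t = 0" using W that by auto
    then show ?thesis unfolding P_def Q_def using p(3)[OF that] q(3)[OF that] by simp
  qed
  note gs = glue_sobolev[OF r t PQ]
  show "f c s \<in> L2_sobolev II r" unfolding fe by (rule gs(1)) (rule eq)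
  show "nth_deriv II r (f c s) x = (c * \<kappa> + s) * glue t (wL 0) (wR 0) x" if "x \<in> II - {t}"
  proof -
    have "wL (r + r) x = \<kappa> * wL 0 x" "wR (r + r) x = \<kappa> * wR 0 x"
      using ode_chainD(2)[OF o(1)] ode_chainD(2)[OF o(2)] by (simp_all add: mult_2)
    moreover have "p r = wL 0" "q r = wR 0" using p(2)[of 0] q(2)[of 0] by simp_all
    moreover have "nth_deriv II r (glue t (P 0) (Q 0)) x = glue t (P r) (Q r) x"
      by (rule gs(3)[OF _ that]) (rule eq)
    ultimately show ?thesis unfolding fe by (simp add: P_def Q_def glue_def algebra_simps)
  qed
qed

text \<open>Each integration is normalised to vanish at t, so antiderivatives of the left and of the
  right branch match there at all orders below m and can be glued inside the space.\<close>

lemma deriv_chain_antiderivative: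
  assumes "deriv_chain y"
  obtains h where "deriv_chain h" "\<And>j. h (j + m) = y j" "\<And>j. j < m \<Longrightarrow> h j t = 0"
proof -
  have "\<exists>h. deriv_chain h \<and> (\<forall>j. h (j + m) = y j) \<and> (\<forall>j<m. h j t = 0)"
  proof (induction m)
    case 0
    then show ?case using assms by auto
  next
    case (Suc m)
    then obtain h where h: "deriv_chain h" "\<And>j. h (j + m) = y j" "\<And>j. j < m \<Longrightarrow> h j t = 0" by blast
    have "isCont (h 0) x" for x using DERIV_isCont[OF deriv_chainD[OF h(1), of 0 x UNIV]] .
    then obtain H where H: "\<And>x. (H has_vector_derivative h 0 x) (at x)"
      using einterval_antiderivative[of "-\<infinity>" "\<infinity>" "h 0"] by auto
    define g where "g j = (case j of 0 \<Rightarrow> (\<lambda>x. H x - H t) | Suc i \<Rightarrow> h i)" for j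
    have "deriv_chain g"
      unfolding deriv_chain_def
    proof (intro allI)
      fix j x
      have "((\<lambda>x. H x - H t) has_real_derivative h 0 x - 0) (at x)"
        using H by (intro DERIV_diff DERIV_const) (simp add: has_real_derivative_iff_has_vector_derivative)
      then show "(g j has_real_derivative g (Suc j) x) (at x)"
        using deriv_chainD[OF h(1), of _ x UNIV] unfolding g_def by (cases j) auto
    qed
    moreover have "g (j + Suc m) = y j" for j unfolding g_def using h(2) by simp
    moreover have "g j t = 0" if "j < Suc m" for j using h(3) that unfolding g_def by (cases j) auto
    ultimately show ?case by blast
  qed
  then show ?thesis using that by blast
qed

lemma solution_derivative_sobolev:
  assumes r: "0 < r" and k: "k < r" and t: "-1 < t" "t < 1" and w: "bvp_chains r k l t wL wR"
  shows "glue t (wL r) (wR r) \<in> L2_sobolev II r"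
    and "\<And>x. x \<in> II - {t} \<Longrightarrow>
      nth_deriv II r (glue t (wL r) (wR r)) x = (-1) ^ (r + 1) * l * glue t (wL 0) (wR 0) x"
proof -
  have wc: "deriv_chain wL" "deriv_chain wR" using w unfolding bvp_chains_def ode_chain_def by blast+
  obtain p where p: "deriv_chain p" "\<And>j. p (j + r) = wL j" "\<And>j. j < r \<Longrightarrow> p j t = 0"
    using deriv_chain_antiderivative[OF wc(1)] by metis
  obtain q where q: "deriv_chain q" "\<And>j. q (j + r) = wR j" "\<And>j. j < r \<Longrightarrow> q j t = 0"
    using deriv_chain_antiderivative[OF wc(2)] by metis
  show "glue t (wL r) (wR r) \<in> L2_sobolev II r"
    using extremal_family(1)[OF r k t w p q, where c=1 and s=0] by simp
  show "nth_deriv II r (glue t (wL r) (wR r)) x = (-1) ^ (r + 1) * l * glue t (wL 0) (wR 0) x"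
    if "x \<in> II - {t}" for x
    using extremal_family(2)[OF r k t w p q that, where c=1 and s=0] by simp
qed

section \<open>Energy identities and continuity in the parameter\<close>

text \<open>The representation formula for f = u^(r), tested with an arbitrary admissible pair v.
  The r-th derivative of f is (-1)^(r+1) l u, and the two signs combine to + l. The left side does
  not depend on v.\<close>

lemma extremal_pairing:
  assumes r: "0 < r" and k: "k < r" and t: "-1 < t" "t < 1" and w: "bvp_chains r k l t wL wR"
    and v: "admissible r k t vL vR"
  shows "nth_deriv II k (glue t (wL r) (wR r)) t =
    L2_inner II (glue t (wL r) (wR r)) (glue t (vL r) (vR r)) + l * L2_inner II (glue t (wL 0) (wR 0)) (glue t (vL 0) (vR 0))"
proof -
  have wc: "deriv_chain wL" "deriv_chain wR" using w unfolding bvp_chains_def ode_chain_def by blast+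
  let ?f = "glue t (wL r) (wR r)"
  note f = solution_derivative_sobolev(1)[OF r k t w] and fr = solution_derivative_sobolev(2)[OF r k t w]
  have "L2_inner II (nth_deriv II r ?f) (glue t (vL 0) (vR 0))
      = L2_inner II (\<lambda>x. (-1) ^ (r + 1) * l * glue t (wL 0) (wR 0) x) (glue t (vL 0) (vR 0))"
    by (rule L2_fun_spike(2)[where N="{t}"]) (use fr in \<open>simp_all add: L2_fun_cmult[OF glue_chain_L2[OF wc]] del: power_Suc\<close>)
  also have "\<dots> = (-1) ^ (r + 1) * l * L2_inner II (glue t (wL 0) (wR 0)) (glue t (vL 0) (vR 0))"
    by (rule L2_inner_cmult_left)
  finally have "(-1) ^ r * L2_inner II (nth_deriv II r ?f) (glue t (vL 0) (vR 0))
      = - (l * L2_inner II (glue t (wL 0) (wR 0)) (glue t (vL 0) (vR 0)))"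
    by (simp flip: power_mult_distrib mult.assoc)
  then show ?thesis using derivative_representation[OF r k t v f] by simp
qed

text \<open>Comparing the pairing for v with that for w itself: w is orthogonal to v - w in the
  energy form, the Euler equation of the minimum problem.\<close>

lemma energy_orthogonality:
  assumes r: "0 < r" and k: "k < r" and t: "-1 < t" "t < 1" and w: "bvp_chains r k l t wL wR"
    and v: "admissible r k t vL vR"
  shows "(L2_norm II (glue t (wL r) (wR r)))\<^sup>2 + l * (L2_norm II (glue t (wL 0) (wR 0)))\<^sup>2 =
    L2_inner II (glue t (wL r) (wR r)) (glue t (vL r) (vR r)) + l * L2_inner II (glue t (wL 0) (wR 0)) (glue t (vL 0) (vR 0))"
  using extremal_pairing[OF r k t w v] extremal_pairing[OF r k t w bvp_chains_admissible[OF w]]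
  unfolding L2_norm_power2 by simp

text \<open>Writing E for the energy form, orthogonality gives E(w,w) = E(w,v), and Cauchy-Schwarz
  with 2xy \<le> x^2 + y^2 bounds this by half of E(w,w) + E(v,v).\<close>

lemma energy_minimal:
  assumes r: "0 < r" and k: "k < r" and t: "-1 < t" "t < 1" and w: "bvp_chains r k l t wL wR"
    and v: "admissible r k t vL vR" and l: "0 \<le> l"
  shows "(L2_norm II (glue t (wL r) (wR r)))\<^sup>2 + l * (L2_norm II (glue t (wL 0) (wR 0)))\<^sup>2 \<le>
    (L2_norm II (glue t (vL r) (vR r)))\<^sup>2 + l * (L2_norm II (glue t (vL 0) (vR 0)))\<^sup>2"
proof -
  define a b a' b' where "a = L2_norm II (glue t (wL r) (wR r))" and "b = L2_norm II (glue t (wL 0) (wR 0))"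
    and "a' = L2_norm II (glue t (vL r) (vR r))" and "b' = L2_norm II (glue t (vL 0) (vR 0))"
  note W = admissible_L2[OF bvp_chains_admissible[OF w]] and V = admissible_L2[OF v]
  have "L2_inner II (glue t (wL r) (wR r)) (glue t (vL r) (vR r)) \<le> a * a'"
    using L2_inner_Cauchy_Schwarz[OF W V] unfolding a_def a'_def by (meson abs_le_D1)
  moreover have "L2_inner II (glue t (wL 0) (wR 0)) (glue t (vL 0) (vR 0)) \<le> b * b'"
    using L2_inner_Cauchy_Schwarz[OF W V] unfolding b_def b'_def by (meson abs_le_D1)
  then have "l * L2_inner II (glue t (wL 0) (wR 0)) (glue t (vL 0) (vR 0)) \<le> l * (b * b')"
    using l by (rule mult_left_mono)
  ultimately have 1: "a\<^sup>2 + l * b\<^sup>2 \<le> a * a' + l * (b * b')"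
    using energy_orthogonality[OF r k t w v] unfolding a_def b_def by linarith
  have 2: "2 * (a * a') \<le> a\<^sup>2 + a'\<^sup>2" "2 * (b * b') \<le> b\<^sup>2 + b'\<^sup>2" 
    using sum_squares_bound[of a a'] sum_squares_bound[of b b'] by (simp_all add: mult.assoc)
  have "l * (2 * (b * b')) \<le> l * (b\<^sup>2 + b'\<^sup>2)" using 2(2) l by (rule mult_left_mono)
  then have "2 * (l * (b * b')) \<le> l * b\<^sup>2 + l * b'\<^sup>2" by (simp add: algebra_simps)
  then show ?thesis using 1 2(1) unfolding a_def b_def a'_def b'_def by linarith
qed

lemma L2_norm_triangle_diff:
  assumes f: "f \<in> L2_fun S" and g: "g \<in> L2_fun S"
  shows "\<bar>L2_norm S f - L2_norm S g\<bar> \<le> L2_norm S (\<lambda>x. f x - g x)"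
proof -
  have "(L2_norm S f - L2_norm S g)\<^sup>2 \<le> (L2_norm S (\<lambda>x. f x - g x))\<^sup>2"
  proof -
    have d: "(\<lambda>x. f x - g x) \<in> L2_fun S" by (rule L2_fun_diff[OF f g])
    have "L2_inner S (\<lambda>x. f x - g x) (\<lambda>x. f x - g x) = L2_inner S f f - 2 * L2_inner S f g + L2_inner S g g"
      unfolding L2_inner_diff_left[OF f g d] L2_inner_diff_right[OF f g f] L2_inner_diff_right[OF f g g]
        L2_inner_commute[of S g f] by simp
    moreover have "L2_inner S f g \<le> L2_norm S f * L2_norm S g"
      using L2_inner_Cauchy_Schwarz[OF f g] by (meson abs_le_D1)
    ultimately show ?thesis unfolding power2_diff L2_norm_power2 by simp
  qed
  then show ?thesis using L2_norm_nonneg by (metis abs_le_square_iff abs_of_nonneg)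
qed

text \<open>Both solutions are orthogonal to their difference d, each in the energy form of its own
  parameter. Subtracting the two relations leaves the energy of d and the mismatch m - l of the
  parameters.\<close>

lemma energy_difference:
  assumes r: "0 < r" and k: "k < r" and t: "-1 < t" "t < 1" and w: "bvp_chains r k l t wL wR"
    and v: "bvp_chains r k m t vL vR"
  defines "d \<equiv> \<lambda>j x. glue t (vL j) (vR j) x - glue t (wL j) (wR j) x"
  shows "(L2_norm II (d r))\<^sup>2 + m * (L2_norm II (d 0))\<^sup>2 + (m - l) * L2_inner II (glue t (wL 0) (wR 0)) (d 0) = 0"
proof -
  note W = admissible_L2[OF bvp_chains_admissible[OF w]] and V = admissible_L2[OF bvp_chains_admissible[OF v]]
  have D: "d j \<in> L2_fun II" for j unfolding d_def by (rule L2_fun_diff[OF V W])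
  have 1: "L2_inner II (glue t (wL r) (wR r)) (d r) + l * L2_inner II (glue t (wL 0) (wR 0)) (d 0) = 0"
    using energy_orthogonality[OF r k t w bvp_chains_admissible[OF v]]
    unfolding d_def L2_inner_diff_right[OF V W W] L2_norm_power2 by (simp add: algebra_simps)
  have 2: "L2_inner II (glue t (vL r) (vR r)) (d r) + m * L2_inner II (glue t (vL 0) (vR 0)) (d 0) = 0"
    using energy_orthogonality[OF r k t v bvp_chains_admissible[OF w]]
    unfolding d_def L2_inner_diff_right[OF V W V] L2_norm_power2 by (simp add: algebra_simps)
  have 3: "L2_inner II (d j) (d j) = L2_inner II (glue t (vL j) (vR j)) (d j) - L2_inner II (glue t (wL j) (wR j)) (d j)" for j
  proof -
    have "L2_inner II (\<lambda>x. glue t (vL j) (vR j) x - glue t (wL j) (wR j) x) (d j)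
      = L2_inner II (glue t (vL j) (vR j)) (d j) - L2_inner II (glue t (wL j) (wR j)) (d j)"
      by (rule L2_inner_diff_left[OF V W D])
    then show ?thesis unfolding d_def .
  qed
  show ?thesis using 1 2 unfolding L2_norm_power2 3 by (simp add: algebra_simps)
qed

text \<open>With l = 0 the difference identity makes the inner product of v and v - w nonpositive,
  and Cauchy-Schwarz finishes. The norm of the solution at \<lambda> = 0 thus bounds all others, a
  bound uniform in the parameter.\<close>

lemma solution_norm_le:
  assumes r: "0 < r" and k: "k < r" and t: "-1 < t" "t < 1" and w: "bvp_chains r k 0 t wL wR"
    and v: "bvp_chains r k m t vL vR" and m: "0 \<le> m"
  shows "L2_norm II (glue t (vL 0) (vR 0)) \<le> L2_norm II (glue t (wL 0) (wR 0))"
proof (cases "m = 0")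
  case True
  then show ?thesis using bvp_chains_unique[OF r order_refl w, of vL vR] v by simp
next
  case False
  note W = admissible_L2[OF bvp_chains_admissible[OF w]] and V = admissible_L2[OF bvp_chains_admissible[OF v]]
  let ?v = "glue t (vL 0) (vR 0)" and ?w = "glue t (wL 0) (wR 0)"
  let ?d = "\<lambda>x. ?v x - ?w x"
  have "m * ((L2_norm II ?d)\<^sup>2 + L2_inner II ?w ?d)
      = - (L2_norm II (\<lambda>x. glue t (vL r) (vR r) x - glue t (wL r) (wR r) x))\<^sup>2"
    using energy_difference[OF r k t w v] unfolding distrib_left diff_zero by linarith
  then have "m * ((L2_norm II ?d)\<^sup>2 + L2_inner II ?w ?d) \<le> 0" by simp
  then have "(L2_norm II ?d)\<^sup>2 + L2_inner II ?w ?d \<le> 0" using False m by (simp add: mult_le_0_iff)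
  moreover have "(L2_norm II ?d)\<^sup>2 = L2_inner II ?v ?d - L2_inner II ?w ?d"
    unfolding L2_norm_power2 by (rule L2_inner_diff_left[OF V W L2_fun_diff[OF V W]])
  ultimately have "L2_inner II ?v ?v \<le> L2_inner II ?v ?w"
    by (simp add: L2_inner_diff_right[OF V W V])
  also have "\<dots> \<le> L2_norm II ?v * L2_norm II ?w" using L2_inner_Cauchy_Schwarz[OF V W] by (meson abs_le_D1)
  finally have "L2_norm II ?v * L2_norm II ?v \<le> L2_norm II ?v * L2_norm II ?w"
    unfolding L2_norm_power2[symmetric] power2_eq_square .
  then show ?thesis using L2_norm_nonneg[of II ?v] L2_norm_nonneg[of II ?w]
    by (cases "L2_norm II ?v = 0") (auto simp: mult_le_cancel_left)
qed

text \<open>With D0 the norm of d and B that of the solution at \<lambda> = 0, the difference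
  identity bounds the squared norm of d^(r) by (m - l)(B D0 - D0^2), at most (m - l) B^2. Hoelder
  exponent 1/2 is enough for the intermediate value theorem.\<close>

lemma derivative_norm_Hoelder:
  assumes r: "0 < r" and k: "k < r" and t: "-1 < t" "t < 1" and u: "bvp_chains r k 0 t uL uR"
    and w: "bvp_chains r k l t wL wR" and v: "bvp_chains r k m t vL vR" and l: "0 \<le> l" "l \<le> m"
  shows "\<bar>L2_norm II (glue t (vL r) (vR r)) - L2_norm II (glue t (wL r) (wR r))\<bar>
    \<le> sqrt (m - l) * L2_norm II (glue t (uL 0) (uR 0))"
proof -
  note W = admissible_L2[OF bvp_chains_admissible[OF w]] and V = admissible_L2[OF bvp_chains_admissible[OF v]]
  define d where "d j x = glue t (vL j) (vR j) x - glue t (wL j) (wR j) x" for j x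
  have D: "d j \<in> L2_fun II" for j unfolding d_def by (rule L2_fun_diff[OF V W])
  define B D0 where "B = L2_norm II (glue t (uL 0) (uR 0))" and "D0 = L2_norm II (d 0)"
  have nn: "0 \<le> B" "0 \<le> D0" unfolding B_def D0_def by (rule L2_norm_nonneg)+
  have "- L2_inner II (glue t (wL 0) (wR 0)) (d 0) \<le> L2_norm II (glue t (wL 0) (wR 0)) * D0"
    using L2_inner_Cauchy_Schwarz[OF W[of 0 0] D[of 0]] unfolding D0_def by linarith
  also have "\<dots> \<le> B * D0" using solution_norm_le[OF r k t u w l(1)] nn unfolding B_def by (intro mult_right_mono)
  finally have "(m - l) * (- L2_inner II (glue t (wL 0) (wR 0)) (d 0)) \<le> (m - l) * (B * D0)"
    using l by (intro mult_left_mono) auto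
  then have "(L2_norm II (d r))\<^sup>2 \<le> (m - l) * (B * D0) - m * D0\<^sup>2"
    using energy_difference[OF r k t w v] unfolding d_def[symmetric] D0_def by (simp add: algebra_simps)
  also have "\<dots> \<le> (m - l) * (B * D0) - (m - l) * D0\<^sup>2" using l by (simp add: mult_right_mono)
  also have "\<dots> = (m - l) * (B * D0 - D0\<^sup>2)" by (simp add: algebra_simps)
  also have "\<dots> \<le> (m - l) * B\<^sup>2"
  proof (rule mult_left_mono)
    have "0 \<le> (B - D0)\<^sup>2 + B * D0" using nn by simp
    then show "B * D0 - D0\<^sup>2 \<le> B\<^sup>2" by (simp add: power2_diff)
  qed (use l in simp)
  also have "\<dots> = (sqrt (m - l) * B)\<^sup>2" using l by (simp add: power_mult_distrib)
  finally have "L2_norm II (d r) \<le> sqrt (m - l) * B"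
    by (rule power2_le_imp_le) (use nn l in simp)
  then show ?thesis using L2_norm_triangle_diff[OF V[of r r] W[of r r]] unfolding d_def B_def by linarith
qed

section \<open>Concentrated test functions\<close>

lemma deriv_chain_poly: "deriv_chain (\<lambda>j. poly ((pderiv ^^ j) p))"
  unfolding deriv_chain_def by (auto intro: poly_DERIV)

lemma poly_higher_pderiv_0: "poly ((pderiv ^^ j) p) 0 = fact j * coeff p j" for p :: "real poly"
  by (simp add: poly_0_coeff_0 coeff_higher_pderiv pochhammer_fact)

lemma higher_pderiv_root:
  fixes p :: "real poly"
  assumes "[:-c, 1:] ^ m dvd p" "j < m"
  shows "poly ((pderiv ^^ j) p) c = 0"
  using assms
proof (induction j arbitrary: m p)
  case 0
  then have "[:-c, 1:] dvd p" by (meson dvd_power dvd_trans)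
  then show ?case by (simp add: poly_eq_0_iff_dvd)
next
  case (Suc j)
  then obtain n where m: "m = Suc n" by (cases m) auto
  obtain q where q: "p = [:-c, 1:] ^ m * q" using Suc.prems(1) by blast
  define L :: "real poly" where "L = [:-c, 1:]"
  have "pderiv L = 1" unfolding L_def by (simp add: pderiv_pCons)
  then have "pderiv (L ^ Suc n * q) = L ^ n * (L * pderiv q + Polynomial.smult (of_nat (Suc n)) q)"
    unfolding pderiv_mult pderiv_power_Suc by (simp add: algebra_simps)
  then have "pderiv p = [:-c, 1:] ^ n * ([:-c, 1:] * pderiv q + Polynomial.smult (of_nat (Suc n)) q)"
    unfolding q m L_def .
  then have "[:-c, 1:] ^ n dvd pderiv p" by simp
  then have "poly ((pderiv ^^ j) (pderiv p)) c = 0" using Suc.IH Suc.prems(2) m by auto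
  then show ?case by (simp add: funpow_swap1)
qed

text \<open>The second factor is 1 up to order m at 0, so the derivatives below order m there are
  those of y^i/i!. It vanishes to order n at b, and for 0 < (y/b)^m \<le> 1 it tends to 0 as n
  grows. One formula thus serves both for test functions f and for admissible branches.\<close>

definition bump_poly :: "nat \<Rightarrow> nat \<Rightarrow> real \<Rightarrow> nat \<Rightarrow> real poly" where
  "bump_poly i m b n = monom (1 / fact i) i * (1 - monom (1 / b ^ m) m) ^ n"

lemma poly_bump_poly: "poly (bump_poly i m b n) y = y ^ i / fact i * (1 - (y / b) ^ m) ^ n"
  by (simp add: bump_poly_def poly_monom power_divide)

lemma bump_poly_higher_pderiv_0:
  assumes "j < m"
  shows "poly ((pderiv ^^ j) (bump_poly i m b n)) 0 = (if j = i then 1 else 0)"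
proof -
  have c: "coeff ((1 - monom (1 / b ^ m) m) ^ n) j = (if j = 0 then 1 else 0)" if "j < m" for j
  proof (induction n)
    case 0
    then show ?case by simp
  next
    case (Suc n)
    have "(1 - monom (1 / b ^ m) m) ^ Suc n
        = (1 - monom (1 / b ^ m) m) ^ n - monom (1 / b ^ m) m * (1 - monom (1 / b ^ m) m) ^ n"
      by (simp add: algebra_simps)
    then show ?case using Suc that by (simp add: coeff_monom_mult)
  qed
  show ?thesis unfolding poly_higher_pderiv_0 bump_poly_def using c[of "j - i"] assms
    by (auto simp: coeff_monom_mult)
qed

lemma bump_poly_higher_pderiv_end:
  assumes "j < n" "b \<noteq> 0" "0 < m"
  shows "poly ((pderiv ^^ j) (bump_poly i m b n)) b = 0"
proof (rule higher_pderiv_root[OF _ assms(1)])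
  have "poly (1 - monom (1 / b ^ m) m) b = 0" using assms by (simp add: poly_monom)
  then have "[:-b, 1:] dvd 1 - monom (1 / b ^ m) m" by (simp only: poly_eq_0_iff_dvd)
  then show "[:-b, 1:] ^ n dvd bump_poly i m b n" unfolding bump_poly_def
    by (intro dvd_mult dvd_power_same)
qed

lemma L2_norm_tendsto_0:
  assumes g: "\<And>n. g n \<in> L2_fun II" and C: "\<And>n x. x \<in> II \<Longrightarrow> \<bar>g n x\<bar> \<le> C" and N: "finite N"
    and lim: "\<And>x. x \<in> II - N \<Longrightarrow> (\<lambda>n. g n x) \<longlonglongrightarrow> 0"
  shows "(\<lambda>n. L2_norm II (g n)) \<longlonglongrightarrow> 0"
proof -
  have "(\<lambda>n. LINT x|lebesgue_on II. \<bar>g n x\<bar>\<^sup>2) \<longlonglongrightarrow> (LINT x|lebesgue_on II. 0)"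
  proof (rule integral_dominated_convergence[where w="\<lambda>_. C\<^sup>2"])
    show "integrable (lebesgue_on II) (\<lambda>_. C\<^sup>2)" by (rule continuous_imp_integrable_real) simp
    have "N \<in> null_sets lebesgue" using N negligible_finite negligible_iff_null_sets by blast
    from AE_not_in[OF this] have "AE x in lebesgue. x \<in> II \<longrightarrow> (\<lambda>n. \<bar>g n x\<bar>\<^sup>2) \<longlonglongrightarrow> 0"
    proof eventually_elim
      case (elim x)
      show ?case
      proof
        assume "x \<in> II"
        then have "(\<lambda>n. g n x) \<longlonglongrightarrow> 0" using lim elim by blast
        then have "(\<lambda>n. \<bar>g n x\<bar>\<^sup>2) \<longlonglongrightarrow> \<bar>0\<bar>\<^sup>2" by (intro tendsto_intros)
        then show "(\<lambda>n. \<bar>g n x\<bar>\<^sup>2) \<longlonglongrightarrow> 0" by simp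
      qed
    qed
    then show "AE x in lebesgue_on II. (\<lambda>n. \<bar>g n x\<bar>\<^sup>2) \<longlonglongrightarrow> 0" by (simp add: AE_restrict_space_iff)
    show "AE x in lebesgue_on II. norm (\<bar>g n x\<bar>\<^sup>2) \<le> C\<^sup>2" for n
    proof (rule AE_I2)
      fix x assume "x \<in> space (lebesgue_on II)"
      then have "\<bar>g n x\<bar> \<le> C" using C by (simp add: space_restrict_space)
      then have "\<bar>g n x\<bar>\<^sup>2 \<le> C\<^sup>2" by (intro power_mono) auto
      then show "norm (\<bar>g n x\<bar>\<^sup>2) \<le> C\<^sup>2" by simp
    qed
  qed (use g in \<open>auto simp: L2_fun_def\<close>)
  then have "(\<lambda>n. sqrt (LINT x|lebesgue_on II. \<bar>g n x\<bar>\<^sup>2)) \<longlonglongrightarrow> sqrt 0" by (intro tendsto_real_sqrt) simp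
  then show ?thesis unfolding L2_norm_def by simp
qed

text \<open>Concentrated test functions \<open>(x-t)\<^sup>k/k! (1-((x-t)/2)\<^bsup>2k+2\<^esup>)\<^sup>n\<close>: evaluating the \<open>k\<close>-th derivative
  at \<open>t\<close> is not bounded by the \<open>L\<^sub>2\<close>-norm.\<close>

lemma concentrated_function:
  assumes r: "0 < r" and k: "k < r" and t: "-1 < t" "t < 1" and \<epsilon>: "0 < \<epsilon>"
  obtains f where "f \<in> L2_sobolev II r" "nth_deriv II k f t = 1" "L2_norm II f < \<epsilon>"
proof -
  \<comment> \<open>Above k, so that the k-th derivative at t is still 1; even, so that with scale
    2, which exceeds |x - t| on the interval, the base 1 - ((x-t)/2)^m lies in [0,1] on both sides
    of t.\<close>
  define m where "m = 2 * (k + 1)"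
  have m: "even m" "k < m" "0 < m" unfolding m_def by simp_all
  define p where "p n = (\<lambda>j x. poly ((pderiv ^^ j) (bump_poly k m 2 n)) (x - t))" for n
  have pc: "deriv_chain (p n)" for n unfolding p_def by (rule deriv_chain_translate[OF deriv_chain_poly])
  define f where "f n = glue t (p n 0) (p n 0)" for n
  have f0: "f n x = (x - t) ^ k / fact k * (1 - ((x - t) / 2) ^ m) ^ n" for n x
    unfolding f_def glue_def p_def by (simp add: poly_bump_poly)
  have sob: "f n \<in> L2_sobolev II r" for n unfolding f_def by (rule glue_sobolev(1)[OF r t pc pc]) simp
  have "nth_deriv II k (f n) t = glue t (p n k) (p n k) t" for n
    unfolding f_def by (rule glue_sobolev(2)[OF r t pc pc]) (use k t in auto)
  then have ev: "nth_deriv II k (f n) t = 1" for n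
    unfolding glue_def p_def using bump_poly_higher_pderiv_0[OF m(2), of k 2 n] by simp
  have q: "0 \<le> ((x - t) / 2) ^ m \<and> ((x - t) / 2) ^ m \<le> 1" if "x \<in> II" for x
  proof -
    have "\<bar>(x - t) / 2\<bar> \<le> 1" using that t by auto
    then have "\<bar>(x - t) / 2\<bar> ^ m \<le> 1" by (intro power_le_one) auto
    moreover have "\<bar>(x - t) / 2\<bar> ^ m = ((x - t) / 2) ^ m"
      using m(1) by (rule power_even_abs)
    moreover have "0 \<le> ((x - t) / 2) ^ m" using m(1) by (rule zero_le_even_power)
    ultimately show ?thesis by simp
  qed
  have "(\<lambda>n. L2_norm II (f n)) \<longlonglongrightarrow> 0"
  proof (rule L2_norm_tendsto_0[where N="{t}" and C="2 ^ k"])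
    show "f n \<in> L2_fun II" for n unfolding f_def by (rule glue_chain_L2[OF pc pc])
  next
    fix n x assume x: "x \<in> II"
    have "\<bar>x - t\<bar> ^ k \<le> 2 ^ k" using x t by (intro power_mono) auto
    moreover have "\<bar>1 - ((x - t) / 2) ^ m\<bar> ^ n \<le> 1" using q[OF x] by (intro power_le_one) auto
    moreover have "\<bar>x - t\<bar> ^ k / fact k \<le> \<bar>x - t\<bar> ^ k" by (simp add: divide_le_eq mult_left_le fact_ge_1 mult_le_cancel_left1)
    ultimately have "\<bar>x - t\<bar> ^ k / fact k * \<bar>1 - ((x - t) / 2) ^ m\<bar> ^ n \<le> 2 ^ k * 1"
      by (intro mult_mono) auto
    then show "\<bar>f n x\<bar> \<le> 2 ^ k" unfolding f0 abs_mult abs_divide power_abs by simp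
  next
    fix x assume x: "x \<in> II - {t}"
    have "0 < ((x - t) / 2) ^ m" using x m by (simp add: zero_less_power_eq)
    then have "\<bar>1 - ((x - t) / 2) ^ m\<bar> < 1" using q[of x] x by auto
    then have "(\<lambda>n. (x - t) ^ k / fact k * (1 - ((x - t) / 2) ^ m) ^ n) \<longlonglongrightarrow> (x - t) ^ k / fact k * 0"
      by (intro tendsto_mult tendsto_const LIMSEQ_power_zero) simp
    then show "(\<lambda>n. f n x) \<longlonglongrightarrow> 0" unfolding f0 by simp
  qed simp
  then have "\<forall>\<^sub>F n in sequentially. L2_norm II (f n) < \<epsilon>" using \<epsilon> by (rule order_tendstoD)
  then obtain n where "L2_norm II (f n) < \<epsilon>" by (auto simp: eventually_sequentially)
  then show ?thesis using that[OF sob ev] by blast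
qed

text \<open>The left branch is 0 and the right branch alone carries the jump, as a bump with i =
  r-k-1 and m = r. The scale b = 1 - t places its second zero at the end point 1.\<close>

lemma concentrated_admissible:
  assumes r: "0 < r" and k: "k < r" and t: "-1 < t" "t < 1" and \<epsilon>: "0 < \<epsilon>"
  obtains vL vR where "admissible r k t vL vR" "L2_norm II (glue t (vL 0) (vR 0)) < \<epsilon>"
proof -
  define b where "b = 1 - t"
  have b: "0 < b" using t unfolding b_def by simp
  define i where "i = r - k - 1"
  \<comment> \<open>The exponent n + r keeps the zero at 1 of order at least r for every n.\<close>
  define vR where "vR n = (\<lambda>j x. (-1) ^ (k + 1) * poly ((pderiv ^^ j) (bump_poly i r b (n + r))) (x - t))" for n
  define vL where "vL = (\<lambda>(j::nat) (x::real). 0::real)"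
  have vLc: "deriv_chain vL" unfolding vL_def by (rule deriv_chain_zero)
  have vRc: "deriv_chain (vR n)" for n unfolding vR_def
    by (rule deriv_chain_cmult[OF deriv_chain_translate[OF deriv_chain_poly]])
  have adm: "admissible r k t vL (vR n)" for n
    unfolding admissible_def
  proof (intro conjI allI impI vLc vRc)
    fix j assume j: "j < r"
    show "vL j (-1) = 0" unfolding vL_def ..
    show "vR n j 1 = 0" unfolding vR_def using bump_poly_higher_pderiv_end[of j "n + r" b r i] j b r by (simp flip: b_def)
    show "vR n j t - vL j t = (-1) ^ (k + 1) * (if j = r - k - 1 then 1 else 0)"
      unfolding vR_def vL_def using bump_poly_higher_pderiv_0[OF j, of i b "n + r"] by (simp add: i_def)
  qed
  have v0: "glue t (vL 0) (vR n 0) x = (if x < t then 0 else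
      (-1) ^ (k + 1) * ((x - t) ^ i / fact i * (1 - ((x - t) / b) ^ r) ^ (n + r)))" for n x
    unfolding glue_def vL_def vR_def by (simp add: poly_bump_poly)
  have q: "0 \<le> ((x - t) / b) ^ r \<and> ((x - t) / b) ^ r \<le> 1" if "x \<in> II" "\<not> x < t" for x
    using that b unfolding b_def by (auto intro!: power_le_one simp: divide_le_eq)
  have "(\<lambda>n. L2_norm II (glue t (vL 0) (vR n 0))) \<longlonglongrightarrow> 0"
  proof (rule L2_norm_tendsto_0[where N="{t}" and C="2 ^ i"])
    show "glue t (vL 0) (vR n 0) \<in> L2_fun II" for n by (rule glue_chain_L2[OF vLc vRc])
  next
    fix n x assume x: "x \<in> II"
    show "\<bar>glue t (vL 0) (vR n 0) x\<bar> \<le> 2 ^ i"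
    proof (cases "x < t")
      case False
      have "\<bar>x - t\<bar> ^ i \<le> 2 ^ i" using x t by (intro power_mono) auto
      moreover have "\<bar>1 - ((x - t) / b) ^ r\<bar> ^ (n + r) \<le> 1" using q[OF x False] by (intro power_le_one) auto
      moreover have "\<bar>x - t\<bar> ^ i / fact i \<le> \<bar>x - t\<bar> ^ i" by (simp add: divide_le_eq mult_left_le fact_ge_1 mult_le_cancel_left1)
      ultimately have "\<bar>x - t\<bar> ^ i / fact i * \<bar>1 - ((x - t) / b) ^ r\<bar> ^ (n + r) \<le> 2 ^ i * 1"
        by (intro mult_mono) auto
      then show ?thesis using False unfolding v0 abs_mult by (simp add: abs_mult abs_divide power_abs)
    qed (simp add: v0)
  next
    fix x assume x: "x \<in> II - {t}"
    show "(\<lambda>n. glue t (vL 0) (vR n 0) x) \<longlonglongrightarrow> 0"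
    proof (cases "x < t")
      case False
      then have "0 < ((x - t) / b) ^ r" using x b by simp
      then have "\<bar>1 - ((x - t) / b) ^ r\<bar> < 1" using q[of x] x False by auto
      then have "(\<lambda>n. (1 - ((x - t) / b) ^ r) ^ (n + r)) \<longlonglongrightarrow> 0"
        by (intro LIMSEQ_ignore_initial_segment LIMSEQ_power_zero) simp
      then have "(\<lambda>n. (-1) ^ (k + 1) * ((x - t) ^ i / fact i * (1 - ((x - t) / b) ^ r) ^ (n + r)))
          \<longlonglongrightarrow> (-1) ^ (k + 1) * ((x - t) ^ i / fact i * 0)"
        by (intro tendsto_mult tendsto_const)
      then show ?thesis using False unfolding v0 by simp
    qed (simp add: v0)
  qed simp
  then have "\<forall>\<^sub>F n in sequentially. L2_norm II (glue t (vL 0) (vR n 0)) < \<epsilon>" using \<epsilon> by (rule order_tendstoD)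
  then obtain n where "L2_norm II (glue t (vL 0) (vR n 0)) < \<epsilon>" by (auto simp: eventually_sequentially)
  then show ?thesis using that[OF adm] by blast
qed

section \<open>Sharpness\<close>

lemma sharp_inequality:
  assumes r: "0 < r" and k: "k < r" and t: "-1 < t" "t < 1" and w: "admissible r k t wL wR"
    and f: "f \<in> L2_sobolev II r"
  shows "\<bar>nth_deriv II k f t\<bar> \<le> L2_norm II (glue t (wL r) (wR r)) * L2_norm II f
    + L2_norm II (glue t (wL 0) (wR 0)) * L2_norm II (nth_deriv II r f)"
proof -
  note W = admissible_L2[OF w] and sd = sobolev_derivatives(4,5)[OF r f]
  have "\<bar>nth_deriv II k f t\<bar> \<le> \<bar>L2_inner II f (glue t (wL r) (wR r))\<bar>
      + \<bar>(-1) ^ r * L2_inner II (nth_deriv II r f) (glue t (wL 0) (wR 0))\<bar>"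
    unfolding derivative_representation[OF r k t w f] by (rule abs_triangle_ineq4)
  also have "\<dots> = \<bar>L2_inner II f (glue t (wL r) (wR r))\<bar> + \<bar>L2_inner II (nth_deriv II r f) (glue t (wL 0) (wR 0))\<bar>"
    by (simp add: abs_mult)
  also have "\<dots> \<le> L2_norm II f * L2_norm II (glue t (wL r) (wR r))
      + L2_norm II (nth_deriv II r f) * L2_norm II (glue t (wL 0) (wR 0))"
    by (intro add_mono L2_inner_Cauchy_Schwarz W sd)
  finally show ?thesis by (simp add: mult.commute)
qed

text \<open>The test function is c u^(r) + s h, where h glues r-fold antiderivatives of the branches
  of u. Its r-th derivative is (c \<kappa> + s) u off t, so all quantities in the sharpness problem
  become explicit polynomials, or absolute values of such, in c and s.\<close>

lemma extremal_values:
  assumes r: "0 < r" and k: "k < r" and t: "-1 < t" "t < 1" and w: "bvp_chains r k l t wL wR"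
  defines "A \<equiv> L2_norm II (glue t (wL r) (wR r))" and "B \<equiv> L2_norm II (glue t (wL 0) (wR 0))"
    and "\<kappa> \<equiv> (-1) ^ (r + 1) * l"
  obtains h where "h \<in> L2_fun II"
    "\<And>c s. \<exists>f\<in>L2_sobolev II r. L2_norm II (nth_deriv II r f) = \<bar>c * \<kappa> + s\<bar> * B \<and>
      (L2_norm II f)\<^sup>2 = c\<^sup>2 * A\<^sup>2 + 2 * c * s * L2_inner II h (glue t (wL r) (wR r)) + s\<^sup>2 * (L2_norm II h)\<^sup>2 \<and>
      nth_deriv II k f t = c * A\<^sup>2 + s * L2_inner II h (glue t (wL r) (wR r)) - (-1) ^ r * ((c * \<kappa> + s) * B\<^sup>2)"
proof -
  have wc: "deriv_chain wL" "deriv_chain wR" using w unfolding bvp_chains_def ode_chain_def by blast+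
  obtain p where p: "deriv_chain p" "\<And>j. p (j + r) = wL j" "\<And>j. j < r \<Longrightarrow> p j t = 0"
    using deriv_chain_antiderivative[OF wc(1)] by metis
  obtain q where q: "deriv_chain q" "\<And>j. q (j + r) = wR j" "\<And>j. j < r \<Longrightarrow> q j t = 0"
    using deriv_chain_antiderivative[OF wc(2)] by metis
  define h where "h = glue t (p 0) (q 0)"
  define g where "g = glue t (wL r) (wR r)"
  define u where "u = glue t (wL 0) (wR 0)"
  have L2: "h \<in> L2_fun II" "g \<in> L2_fun II" "u \<in> L2_fun II"
    unfolding h_def g_def u_def by (rule glue_chain_L2[OF p(1) q(1)] glue_chain_L2[OF wc])+
  show ?thesis
  proof (rule that[of h])
    show "h \<in> L2_fun II" by (rule L2(1))
    fix c s
    define f where "f x = c * g x + s * h x" for x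
    have f: "f \<in> L2_sobolev II r"
      using extremal_family(1)[OF r k t w p q, of c s] unfolding f_def g_def h_def .
    have fr: "nth_deriv II r f x = (c * \<kappa> + s) * u x" if "x \<in> II - {t}" for x
      using extremal_family(2)[OF r k t w p q that, of c s] unfolding f_def g_def h_def u_def \<kappa>_def .
    have su: "(\<lambda>x. (c * \<kappa> + s) * u x) \<in> L2_fun II" by (rule L2_fun_cmult[OF L2(3)])
    have "L2_norm II (nth_deriv II r f) = L2_norm II (\<lambda>x. (c * \<kappa> + s) * u x)"
      by (rule L2_fun_spike(3)[where N="{t}", OF _ _ fr su]) simp_all
    then have 1: "L2_norm II (nth_deriv II r f) = \<bar>c * \<kappa> + s\<bar> * B" unfolding L2_norm_cmult B_def u_def .
    have "L2_inner II (nth_deriv II r f) u = L2_inner II (\<lambda>x. (c * \<kappa> + s) * u x) u"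
      by (rule L2_fun_spike(2)[where N="{t}", OF _ _ fr su]) simp_all
    then have ip: "L2_inner II (nth_deriv II r f) u = (c * \<kappa> + s) * B\<^sup>2"
      unfolding L2_inner_cmult_left B_def L2_norm_power2 u_def .
    have cg: "(\<lambda>x. c * g x) \<in> L2_fun II" "(\<lambda>x. s * h x) \<in> L2_fun II" by (rule L2_fun_cmult L2)+
    have fg: "L2_inner II f y = c * L2_inner II g y + s * L2_inner II h y" if "y \<in> L2_fun II" for y
      unfolding f_def L2_inner_add_left[OF cg that] L2_inner_cmult_left ..
    have fL: "f \<in> L2_fun II" unfolding f_def by (rule L2_fun_add[OF cg])
    have "(L2_norm II f)\<^sup>2 = c * L2_inner II f g + s * L2_inner II f h"
      unfolding L2_norm_power2 fg[OF fL] by (simp add: L2_inner_commute[of II g f] L2_inner_commute[of II h f])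
    then have 2: "(L2_norm II f)\<^sup>2 = c\<^sup>2 * A\<^sup>2 + 2 * c * s * L2_inner II h g + s\<^sup>2 * (L2_norm II h)\<^sup>2"
      unfolding fg[OF L2(1)] fg[OF L2(2)] A_def L2_norm_power2 g_def[symmetric] L2_inner_commute[of II g h]
      by (simp add: power2_eq_square algebra_simps)
    have "nth_deriv II k f t = L2_inner II f g - (-1) ^ r * L2_inner II (nth_deriv II r f) u"
      using derivative_representation[OF r k t bvp_chains_admissible[OF w] f] unfolding g_def u_def .
    then have 3: "nth_deriv II k f t = c * A\<^sup>2 + s * L2_inner II h g - (-1) ^ r * ((c * \<kappa> + s) * B\<^sup>2)"
      unfolding ip fg[OF L2(2)] A_def L2_norm_power2 g_def[symmetric] by simp
    show "\<exists>f\<in>L2_sobolev II r. L2_norm II (nth_deriv II r f) = \<bar>c * \<kappa> + s\<bar> * B \<and>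
      (L2_norm II f)\<^sup>2 = c\<^sup>2 * A\<^sup>2 + 2 * c * s * L2_inner II h (glue t (wL r) (wR r)) + s\<^sup>2 * (L2_norm II h)\<^sup>2 \<and>
      nth_deriv II k f t = c * A\<^sup>2 + s * L2_inner II h (glue t (wL r) (wR r)) - (-1) ^ r * ((c * \<kappa> + s) * B\<^sup>2)"
      unfolding g_def[symmetric] using f 1 2 3 by blast
  qed
qed

text \<open>For \<open>\<lambda> > 0\<close> a multiple of \<open>u\<^bsup>(r)\<^esup>\<close> is extremal. For \<open>\<lambda> = 0\<close> the supremum is only approached, by
  \<open>c u\<^bsup>(r)\<^esup> + h\<close> with \<open>h\<^bsup>(r)\<^esup>\<close> proportional to \<open>u\<close> and \<open>c \<rightarrow> \<infinity>\<close>.\<close>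

lemma near_extremal:
  assumes r: "0 < r" and k: "k < r" and t: "-1 < t" "t < 1" and l: "0 \<le> l" and w: "bvp_chains r k l t wL wR"
    and \<epsilon>: "0 < \<epsilon>"
  defines "A \<equiv> L2_norm II (glue t (wL r) (wR r))" and "B \<equiv> L2_norm II (glue t (wL 0) (wR 0))"
  obtains f where "f \<in> W2 r" "B - \<epsilon> \<le> \<bar>nth_deriv II k f t\<bar> - A * L2_norm II f"
proof -
  define \<kappa> where "\<kappa> = (-1) ^ (r + 1) * l"
  define g where "g = glue t (wL r) (wR r)"
  have nn: "0 \<le> A" "0 \<le> B" unfolding A_def B_def by (rule L2_norm_nonneg)+
  have sg: "(-1) ^ r * (-1) ^ r = (1::real)" by (simp flip: power_mult_distrib)
  have s\<kappa>: "(-1) ^ r * \<kappa> = - l" unfolding \<kappa>_def by (simp flip: power_mult_distrib mult.assoc)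
  obtain h where h: "h \<in> L2_fun II"
    and ex: "\<And>c s. \<exists>f\<in>L2_sobolev II r. L2_norm II (nth_deriv II r f) = \<bar>c * \<kappa> + s\<bar> * B \<and>
      (L2_norm II f)\<^sup>2 = c\<^sup>2 * A\<^sup>2 + 2 * c * s * L2_inner II h g + s\<^sup>2 * (L2_norm II h)\<^sup>2 \<and>
      nth_deriv II k f t = c * A\<^sup>2 + s * L2_inner II h g - (-1) ^ r * ((c * \<kappa> + s) * B\<^sup>2)"
    using extremal_values[OF r k t w] unfolding A_def B_def \<kappa>_def g_def by metis
  consider "B = 0" | "B \<noteq> 0" "l = 0" | "B \<noteq> 0" "0 < l" using l by fastforce
  then show ?thesis
  proof cases
    case 1
    obtain f where f: "f \<in> L2_sobolev II r" "L2_norm II (nth_deriv II r f) = 0" "(L2_norm II f)\<^sup>2 = 0"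
      using ex[of 0 0] by auto
    then have "f \<in> W2 r" unfolding W2_def by simp
    then show ?thesis using that[of f] f(3) 1 \<epsilon> by simp
  next
    case 3
    \<comment> \<open>Normalises the norm of f^(r), which is c l B, to 1.\<close>
    define c where "c = 1 / (l * B)"
    have B: "0 < B" using 3 nn by simp
    obtain f where f: "f \<in> L2_sobolev II r" "L2_norm II (nth_deriv II r f) = \<bar>c * \<kappa>\<bar> * B"
        "(L2_norm II f)\<^sup>2 = c\<^sup>2 * A\<^sup>2" "nth_deriv II k f t = c * A\<^sup>2 - (-1) ^ r * ((c * \<kappa>) * B\<^sup>2)"
      using ex[of c 0] by auto
    have c: "0 < c" unfolding c_def using B 3 by simp
    have "\<bar>\<kappa>\<bar> = l" unfolding \<kappa>_def using 3 by (simp add: abs_mult)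
    then have "L2_norm II (nth_deriv II r f) = 1" using f(2) c B 3 unfolding abs_mult c_def by simp
    then have fW: "f \<in> W2 r" using f(1) unfolding W2_def by simp
    have fn: "L2_norm II f = c * A"
      using f(3) c nn L2_norm_nonneg[of II f] by (simp add: power_mult_distrib[symmetric] power2_eq_iff_nonneg)
    have "nth_deriv II k f t = c * A\<^sup>2 - c * ((-1) ^ r * \<kappa>) * B\<^sup>2" using f(4) by (simp add: algebra_simps)
    also have "\<dots> = c * A\<^sup>2 + (c * l * B) * B" unfolding s\<kappa> by (simp add: power2_eq_square)
    also have "c * l * B = 1" unfolding c_def using B 3 by simp
    finally have "\<bar>nth_deriv II k f t\<bar> - A * L2_norm II f = B"
      using c nn unfolding fn by (simp add: power2_eq_square)
    then show ?thesis using that[OF fW] \<epsilon> by simp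
  next
    case 2
    have B: "0 < B" using 2 nn by simp
    \<comment> \<open>The modulus normalises the norm of f^(r) to 1; the sign makes the last term of
      f^(k)(t) equal to + B.\<close>
    define s where "s = - ((-1) ^ r) / B"
    define S where "S = s * L2_inner II h g"
    define H where "H = s\<^sup>2 * (L2_norm II h)\<^sup>2"
    \<comment> \<open>The first bound gives H \<le> 2 c \<epsilon> and absorbs the quadratic
      remainder. The second makes c A^2 + S + \<epsilon> nonnegative, so that squares may be
      compared. If A = 0, Cauchy-Schwarz gives S = 0 and no large c is called for.\<close>
    define c where "c = (if A = 0 then 0 else max (H / (2 * \<epsilon>)) (\<bar>S\<bar> / A\<^sup>2))"
    have H: "0 \<le> H" unfolding H_def by simp
    have \<kappa>0: "\<kappa> = 0" unfolding \<kappa>_def using 2 by simp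
    obtain f where f: "f \<in> L2_sobolev II r" "L2_norm II (nth_deriv II r f) = \<bar>s\<bar> * B"
        "(L2_norm II f)\<^sup>2 = c\<^sup>2 * A\<^sup>2 + 2 * c * s * L2_inner II h g + H"
        "nth_deriv II k f t = c * A\<^sup>2 + S - (-1) ^ r * (s * B\<^sup>2)"
      using ex[of c s] unfolding \<kappa>0 S_def H_def by auto
    have "\<bar>s\<bar> * B = 1" unfolding s_def using B by (simp add: abs_mult)
    then have fW: "f \<in> W2 r" using f(1,2) unfolding W2_def by simp
    have "(-1) ^ r * (s * B\<^sup>2) = - (((-1) ^ r * (-1) ^ r) * B)" unfolding s_def using B by (simp add: power2_eq_square)
    then have fk: "nth_deriv II k f t = c * A\<^sup>2 + S + B" using f(4) unfolding sg by simp
    have "A * L2_norm II f \<le> c * A\<^sup>2 + S + \<epsilon>"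
    proof (cases "A = 0")
      case True
      have "g \<in> L2_fun II" unfolding g_def by (rule admissible_L2[OF bvp_chains_admissible[OF w]])
      from L2_inner_Cauchy_Schwarz[OF h this] have "L2_inner II h g = 0" using True unfolding A_def g_def by simp
      then show ?thesis using True \<epsilon> unfolding S_def by simp
    next
      case False
      then have A: "0 < A" using nn by simp
      have c: "H / (2 * \<epsilon>) \<le> c" "\<bar>S\<bar> / A\<^sup>2 \<le> c" unfolding c_def using False by auto
      have cH: "H \<le> 2 * c * \<epsilon>" using c(1) \<epsilon> by (simp add: field_simps)
      have cS: "\<bar>S\<bar> \<le> c * A\<^sup>2" using c(2) A by (simp add: pos_divide_le_eq)
      have "(A * L2_norm II f)\<^sup>2 = A\<^sup>2 * (c\<^sup>2 * A\<^sup>2 + 2 * c * S + H)"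
        unfolding power_mult_distrib f(3) S_def by (simp add: mult.assoc)
      also have "\<dots> \<le> A\<^sup>2 * (c\<^sup>2 * A\<^sup>2 + 2 * c * S + 2 * c * \<epsilon>)" using cH by (intro mult_left_mono) auto
      \<comment> \<open>Completes the square.\<close>
      also have "\<dots> \<le> A\<^sup>2 * (c\<^sup>2 * A\<^sup>2 + 2 * c * S + 2 * c * \<epsilon>) + (S + \<epsilon>)\<^sup>2" by simp
      also have "\<dots> = (c * A\<^sup>2 + S + \<epsilon>)\<^sup>2" by (simp add: power2_eq_square algebra_simps)
      finally show ?thesis by (rule power2_le_imp_le) (use cS \<epsilon> in linarith)
    qed
    then have "B - \<epsilon> \<le> nth_deriv II k f t - A * L2_norm II f" unfolding fk by linarith
    then show ?thesis using that[OF fW] by linarith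
  qed
qed

lemma solution_pair_in_Gamma:
  assumes r: "0 < r" and k: "k < r" and t: "-1 < t" "t < 1" and l: "0 \<le> l" and w: "bvp_chains r k l t wL wR"
  shows "(L2_norm II (glue t (wL r) (wR r)), L2_norm II (glue t (wL 0) (wR 0))) \<in> Gamma_set r k t"
proof -
  define A B where "A = L2_norm II (glue t (wL r) (wR r))" and "B = L2_norm II (glue t (wL 0) (wR 0))"
  have nn: "0 \<le> A" "0 \<le> B" unfolding A_def B_def by (rule L2_norm_nonneg)+
  let ?\<phi> = "\<lambda>f. \<bar>nth_deriv II k f t\<bar> - A * L2_norm II f"
  have ineq: "\<bar>nth_deriv II k f t\<bar> \<le> A * L2_norm II f + B * L2_norm II (nth_deriv II r f)"
    if "f \<in> L2_sobolev II r" for f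
    unfolding A_def B_def by (rule sharp_inequality[OF r k t bvp_chains_admissible[OF w] that])
  have up: "?\<phi> f \<le> B" if "f \<in> W2 r" for f
  proof -
    have f: "f \<in> L2_sobolev II r" "L2_norm II (nth_deriv II r f) \<le> 1" using that unfolding W2_def by auto
    have "B * L2_norm II (nth_deriv II r f) \<le> B * 1" using f(2) nn by (intro mult_left_mono)
    then show ?thesis using ineq[OF f(1)] by linarith
  qed
  have "(0::real) < 1" by simp
  from near_extremal[OF r k t l w this] have ne: "W2 r \<noteq> {}" by blast
  have bdd: "bdd_above (?\<phi> ` W2 r)" using up by (auto intro!: bdd_aboveI)
  have "(SUP f\<in>W2 r. ?\<phi> f) = B"
  proof (rule antisym)
    show "(SUP f\<in>W2 r. ?\<phi> f) \<le> B" using up by (intro cSUP_least[OF ne])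
    show "B \<le> (SUP f\<in>W2 r. ?\<phi> f)"
    proof (rule field_le_epsilon)
      fix e :: real assume "0 < e"
      from near_extremal[OF r k t l w this]
      obtain f where f: "f \<in> W2 r" "B - e \<le> ?\<phi> f" unfolding A_def B_def by blast
      then show "B \<le> (SUP f\<in>W2 r. ?\<phi> f) + e" using cSUP_upper[OF f(1) bdd] by linarith
    qed
  qed
  then show ?thesis using nn ineq bdd unfolding Gamma_set_def A_def B_def by auto
qed

text \<open>For large \<lambda>, energy minimality against one fixed concentrated competitor forces
  the norm of u below \<eta>. The inequality for a concentrated f with f^(k)(t) = 1 then reads 1
  \<le> A |f| + 1/2, so a small norm |f| makes A large.\<close>

lemma derivative_norm_unbounded:
  assumes r: "0 < r" and k: "k < r" and t: "-1 < t" "t < 1" and M: "0 < M"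
  obtains l where "0 \<le> l" "\<And>wL wR. bvp_chains r k l t wL wR \<Longrightarrow> M \<le> L2_norm II (glue t (wL r) (wR r))"
proof -
  have "0 < 1 / (2 * M)" using M by simp
  from concentrated_function[OF r k t this]
  obtain f where f: "f \<in> L2_sobolev II r" "nth_deriv II k f t = 1" "L2_norm II f < 1 / (2 * M)" by blast
  define F where "F = L2_norm II (nth_deriv II r f) + 1"
  have F: "1 \<le> F" "L2_norm II (nth_deriv II r f) \<le> F" unfolding F_def using L2_norm_nonneg[of II] by simp_all
  define \<eta> where "\<eta> = 1 / (2 * F)"
  have \<eta>: "0 < \<eta>" unfolding \<eta>_def using F by simp
  then have "0 < \<eta> / 2" by simp
  from concentrated_admissible[OF r k t this]
  obtain vL vR where v: "admissible r k t vL vR" "L2_norm II (glue t (vL 0) (vR 0)) < \<eta> / 2" by blast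
  \<comment> \<open>Chosen so that the fixed r-th derivative energy of v is at most l \<eta>^2/2;
    the summand 1 keeps l positive.\<close>
  define l where "l = 2 * (L2_norm II (glue t (vL r) (vR r)))\<^sup>2 / \<eta>\<^sup>2 + 1"
  have l: "0 < l" unfolding l_def by (simp add: add_nonneg_pos)
  have "M \<le> L2_norm II (glue t (wL r) (wR r))" if w: "bvp_chains r k l t wL wR" for wL wR
  proof -
    define A B where "A = L2_norm II (glue t (wL r) (wR r))" and "B = L2_norm II (glue t (wL 0) (wR 0))"
    have nn: "0 \<le> A" "0 \<le> B" unfolding A_def B_def by (rule L2_norm_nonneg)+
    have "A\<^sup>2 + l * B\<^sup>2 \<le> (L2_norm II (glue t (vL r) (vR r)))\<^sup>2 + l * (L2_norm II (glue t (vL 0) (vR 0)))\<^sup>2"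
      unfolding A_def B_def using energy_minimal[OF r k t w v(1)] l by simp
    also have "\<dots> \<le> l * \<eta>\<^sup>2 / 2 + l * (\<eta>\<^sup>2 / 4)"
    proof (rule add_mono)
      show "(L2_norm II (glue t (vL r) (vR r)))\<^sup>2 \<le> l * \<eta>\<^sup>2 / 2"
        unfolding l_def using \<eta> by (simp add: field_simps)
      have "(L2_norm II (glue t (vL 0) (vR 0)))\<^sup>2 \<le> (\<eta> / 2)\<^sup>2"
        using v(2) L2_norm_nonneg by (intro power_mono) auto
      then show "l * (L2_norm II (glue t (vL 0) (vR 0)))\<^sup>2 \<le> l * (\<eta>\<^sup>2 / 4)"
        using l by (intro mult_left_mono) (auto simp: power_divide)
    qed
    also have "\<dots> \<le> l * \<eta>\<^sup>2" using l by (simp add: field_simps)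
    finally have "l * B\<^sup>2 \<le> l * \<eta>\<^sup>2" using zero_le_power2[of A] by linarith
    then have "B\<^sup>2 \<le> \<eta>\<^sup>2" using l by simp
    then have "B \<le> \<eta>" by (rule power2_le_imp_le) (use \<eta> in simp)
    then have "B * L2_norm II (nth_deriv II r f) \<le> \<eta> * F"
      using F(2) nn \<eta> L2_norm_nonneg by (intro mult_mono) auto
    also have "\<dots> = 1 / 2" unfolding \<eta>_def using F by simp
    finally have 1: "1 / 2 \<le> A * L2_norm II f"
      using sharp_inequality[OF r k t bvp_chains_admissible[OF w] f(1)] f(2) unfolding A_def B_def by simp
    have "A * L2_norm II f \<le> A * (1 / (2 * M))" using f(3) nn by (intro mult_left_mono) auto
    then have "1 / 2 \<le> A * (1 / (2 * M))" using 1 by linarith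
    then show ?thesis using M unfolding A_def[symmetric] by (simp add: field_simps)
  qed
  then show ?thesis using that l by (meson less_imp_le)
qed

theorem theorem5:
  fixes r k :: nat and t :: real
  assumes "1 \<le> r" and "k \<le> r - 1" and "-1 < t" and "t < 1"
  shows "Gamma_set r k t =
    {(L2_norm II (nth_deriv (punctured t) r (u_fun r k l t)), L2_norm II (u_fun r k l t)) | l. 0 \<le> l}"
proof -
  have r: "0 < r" and k: "k < r" and t: "-1 < t" "t < 1" using assms by auto
  define a b where "a l = L2_norm II (nth_deriv (punctured t) r (u_fun r k l t))"
    and "b l = L2_norm II (u_fun r k l t)" for l
  have ab: "a l = L2_norm II (glue t (wL r) (wR r))" "b l = L2_norm II (glue t (wL 0) (wR 0))"
    if "0 \<le> l" "bvp_chains r k l t wL wR" for l wL wR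
    unfolding a_def b_def by (rule u_fun_norms[OF r that(1) t that(2)])+
  have G: "(a l, b l) \<in> Gamma_set r k t" if l: "0 \<le> l" for l
  proof -
    obtain wL wR where w: "bvp_chains r k l t wL wR" using bvp_chains_exist[OF r k l] .
    show ?thesis using solution_pair_in_Gamma[OF r k t l w] unfolding ab[OF l w] .
  qed
  have step: "\<bar>a m - a l\<bar> \<le> sqrt (m - l) * b 0" if l: "0 \<le> l" "l \<le> m" for l m
  proof -
    have m: "0 \<le> m" using l by simp
    obtain uL uR where u: "bvp_chains r k 0 t uL uR" using bvp_chains_exist[OF r k order_refl] .
    obtain wL wR where w: "bvp_chains r k l t wL wR" using bvp_chains_exist[OF r k l(1)] .
    obtain vL vR where v: "bvp_chains r k m t vL vR" using bvp_chains_exist[OF r k m] .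
    show ?thesis using derivative_norm_Hoelder[OF r k t u w v l]
      unfolding ab(1)[OF l(1) w] ab(1)[OF m v] ab(2)[OF order_refl u] .
  qed
  then have step': "\<bar>a m - a l\<bar> \<le> sqrt \<bar>m - l\<bar> * b 0" if "0 \<le> l" "0 \<le> m" for l m
    using step[of l m] step[of m l] that by (cases "l \<le> m") (auto simp: abs_minus_commute)
  have cont: "continuous_on {0..L} a" for L
    unfolding continuous_on_def
  proof
    fix x assume x: "x \<in> {0..L}"
    have "((\<lambda>y. sqrt \<bar>y - x\<bar> * b 0) \<longlongrightarrow> sqrt \<bar>x - x\<bar> * b 0) (at x within {0..L})"
      by (intro tendsto_intros)
    then have "((\<lambda>y. sqrt \<bar>y - x\<bar> * b 0) \<longlongrightarrow> 0) (at x within {0..L})" by simp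
    then have "((\<lambda>y. a y - a x) \<longlongrightarrow> 0) (at x within {0..L})"
    proof (rule Lim_null_comparison[rotated])
      show "\<forall>\<^sub>F y in at x within {0..L}. norm (a y - a x) \<le> sqrt \<bar>y - x\<bar> * b 0"
        unfolding eventually_at_filter using step'[of x] x by (intro always_eventually) auto
    qed
    then show "(a \<longlongrightarrow> a x) (at x within {0..L})" by (simp only: LIM_zero_iff)
  qed
  have "(A, B) \<in> {(a l, b l) | l. 0 \<le> l}" if AB: "(A, B) \<in> Gamma_set r k t" for A B
  proof -
    have A: "0 \<le> A" "\<And>f. f \<in> L2_sobolev II r \<Longrightarrow>
        \<bar>nth_deriv II k f t\<bar> \<le> A * L2_norm II f + B * L2_norm II (nth_deriv II r f)"
      and B: "B = (SUP f\<in>W2 r. \<bar>nth_deriv II k f t\<bar> - A * L2_norm II f)"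
      using AB unfolding Gamma_set_def by auto
    \<comment> \<open>The derivative of order r of the test function vanishes off t, so B drops out
      of the inequality, which becomes (a 0)^2 \<le> A (a 0).\<close>
    have lower: "a 0 \<le> A"
    proof -
      obtain uL uR where u: "bvp_chains r k 0 t uL uR" using bvp_chains_exist[OF r k order_refl] .
      let ?f = "glue t (uL r) (uR r)"
      have f: "?f \<in> L2_sobolev II r" by (rule solution_derivative_sobolev(1)[OF r k t u])
      have "L2_norm II (nth_deriv II r ?f) = L2_norm II (\<lambda>x. 0 * glue t (uL 0) (uR 0) x)"
        by (rule L2_fun_spike(3)[where N="{t}", OF _ _ _ L2_fun_cmult[OF admissible_L2[OF bvp_chains_admissible[OF u]]]])
          (simp_all add: solution_derivative_sobolev(2)[OF r k t u])
      then have fr: "L2_norm II (nth_deriv II r ?f) = 0" unfolding L2_norm_cmult by simp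
      have fk: "nth_deriv II k ?f t = (a 0)\<^sup>2"
        using extremal_pairing[OF r k t u bvp_chains_admissible[OF u]]
        unfolding ab(1)[OF order_refl u] L2_norm_power2 by simp
      have "0 \<le> a 0" unfolding a_def by (rule L2_norm_nonneg)
      moreover have "a 0 * a 0 \<le> A * a 0"
        using A(2)[OF f] unfolding fr fk ab(1)[OF order_refl u] by (simp add: power2_eq_square)
      ultimately show ?thesis using A(1) by (cases "a 0 = 0") auto
    qed
    have "0 < A + 1" using A(1) by simp
    from derivative_norm_unbounded[OF r k t this]
    obtain L where L: "0 \<le> L" "\<And>wL wR. bvp_chains r k L t wL wR \<Longrightarrow> A + 1 \<le> L2_norm II (glue t (wL r) (wR r))" by metis
    obtain wL wR where w: "bvp_chains r k L t wL wR" using bvp_chains_exist[OF r k L(1)] .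
    have "A \<le> a L" using L(2)[OF w] unfolding ab(1)[OF L(1) w] by simp
    from IVT'[of a 0 A L, OF lower this L(1) cont] obtain l where l: "0 \<le> l" "a l = A" by blast
    \<comment> \<open>Sharpness makes the second component a function of the first, so it suffices
      to have hit A.\<close>
    have "b l = (SUP f\<in>W2 r. \<bar>nth_deriv II k f t\<bar> - A * L2_norm II f)"
      using G[OF l(1)] unfolding Gamma_set_def l(2) by auto
    then have "B = b l" using B by simp
    then show ?thesis using l by blast
  qed
  then have "Gamma_set r k t = {(a l, b l) | l. 0 \<le> l}" using G by auto
  then show ?thesis unfolding a_def b_def .
qed

end
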